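(* Let $B,\bar B$ be Banach spaces over $\mathbb K\in\{\mathbb R,\mathbb C\}$, $k\ge1$, $q\ge 2k+2$, $G\in C^q(B,\bar B)$ with $G[0]=0$, and let $z_0(\varepsilon)=\varepsilon\bar z_1+\cdots+\frac1{k!}\varepsilon^k\bar z_k+O(|\varepsilon|^{k+1})$ be a $C^q$-curve in $B$ whose first nonzero coefficient is $\bar z_l\neq0$, $1\le l\le k$. Let $C_k$ be the corresponding cone and let the fine resolution $B=N_1^c\oplus\cdots\oplus N_{k+1}^c\oplus N_{k+1}$, $\bar B=R_1\oplus\cdots\oplus R_{k+1}\oplus R_{k+1}^c$ (both as in the context) be given with $R_{k+1}^c=\{0\}$. Let $P^k(\varepsilon)$ denote the Taylor polynomial of degree $k$ at $\varepsilon=0$ of the operator family $\varepsilon\mapsto G'[z_0(\varepsilon)]\in L[B,\bar B]$. Then (i), (ii) and (iii) are equivalent. (i) The cone $C_k$ is $k$-transversal. (ii) There exist closed subspaces $U\ne\{0\}$, $V\neq\{0\}$ with $B=U\oplus V$ satisfying $G_U[z_0(\varepsilon)]:=G'[z_0(\varepsilon)]|_U\in GL[U,\bar B]$ for $\varepsilon\neq0$ (small) and $$\|G_U[z_0(\varepsilon)]^{-1}\|=O(|\varepsilon|^{-k}),\qquad G'[z_0(\varepsilon)]\cdot[I_B+\varepsilon\cdot Q(\varepsilon)]\cdot v=0,\quad v\in V,$$ with $Q\in C(\mathcal B_{\delta_1}(0),L[V,B])$, where $\mathcal B_{\delta_1}(0)=\{\varepsilon\in\mathbb K:|\varepsilon|<\delta_1\}$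 for some $\delta_1>0$. (iii) There exist closed subspaces $U\ne\{0\}$, $V\neq\{0\}$ with $B=U\oplus V$ satisfying $P_U^k(\varepsilon):=P^k(\varepsilon)|_U\in GL[U,\bar B]$ for $\varepsilon\neq0$ (small) and $$\|P_U^k(\varepsilon)^{-1}\|=O(|\varepsilon|^{-k}),\qquad \big\|P^k(\varepsilon)\cdot[I_B+\varepsilon\cdot Q(\varepsilon)]|_V\big\|=O(|\varepsilon|^{k+1})$$ with $Q\in C(\mathcal B_{\delta_1}(0),L[V,B])$ for some $\delta_1>0$.
   Context: Notation: $L[X,Y]$ bounded linear operators, $GL[X,Y]$ bounded bijections with bounded inverse, $N[\cdot],R[\cdot]$ kernel and range, $I_B$ the identity of $B$, $G_0^\beta$ the $\beta$-th Fréchet derivative of $G$ at $0$ (symmetric $\beta$-linear), $|\varepsilon|\ll1$ means $|\varepsilon|$ sufficiently small. Scalar matrices act on products $B^m$ in the obvious way; matrices of operators act on columns. Numbers: for $l\ge1$, $m\ge 2l-2$: $c_{m,l}=\binom{m}{l-1}\binom{2l-2}{l-1}^{-1}$. $C^{2m-1}=\mathrm{Diag}[c_{2m-1,1},\dots,c_{2m-1,m}]$ and $C^{2m}=\mathrm{Diag}[c_{2m,1},\dots,c_{2m,m}]$ (both $m\times m$). Operators $W$: for $m\ge2$ and $m\le\mu\le 2m$, $$W^{2m}_\mu(z_{m-1},\dots,z_1)=\frac1{\mu!}\sum_{\beta=1}^{2m}G_0^\beta\sum_{\substack{n_1+\cdots+n_{m-1}+1=\beta\\ 1\cdot n_1+\cdots+(m-1)n_{m-1}+\mu=2m}}\frac{(2m)!}{n_1!\cdots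 n_{m-1}!}\prod_{\tau=1}^{m-1}\Big(\frac1{\tau!}z_\tau\Big)^{n_\tau}\in L[B,\bar B]$$ (the remaining slot of $G_0^\beta$ takes the argument). Recursive fine resolution along $\bar z_1,\dots,\bar z_k$: put $N_0=B$, $R_0^c=\bar B$, $\bar S_1=G_0^1$, $\bar S_2=2G_0^2\bar z_1$, $M^3=I_B$. For $i=1,\dots,k+1$ let $S_i=P_{R_{i-1}^c}\bar S_i|_{N_{i-1}}\in L[N_{i-1},R_{i-1}^c]$, $N_i=N[S_i]$, $R_i=R[S_i]$, and choose complements $N_{i-1}=N_i^c\oplus N_i$, $R_{i-1}^c=R_i\oplus R_i^c$. So $B=N_1^c\oplus\cdots\oplus N_{k+1}^c\oplus N_{k+1}$, $\bar B=R_1\oplus\cdots\oplus R_{k+1}\oplus R_{k+1}^c$; all these subspaces are assumed closed with continuous projections ($P_{R_i},P_{R_i^c}$ are the projections of these decompositions), $S_i$ restricts to an element of $GL[N_i^c,R_i]$, and $S_i^{-1}:R_i\to N_i^c$ is its inverse. Put $N^c=N_1^c\oplus\cdots\oplus N_{k+1}^c$, identified with $N_1^c\times\cdots\times N_{k+1}^c$. Upper triangular $E^m=(E_{i,j})_{1\le i,j\le m}\in L[B^m,B^m]$: $E_{j,j}=I_B$, $E_{i,j}=-S_i^{-1}P_{R_i}\sum_{v=i+1}^{j}\bar S_vE_{v,j}$ for $i=j-1,\dots,1$, and $E_{i,j}=0$ for $i>j$. Define blocks by $$\begin{pmatrix} a^{2m} & \bar a^{2m} \\ A^{2m} & \bar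 A^{2m} \end{pmatrix}=(C^{2m})^{-1}E^mC^{2m},\qquad \begin{pmatrix} a^{2m-1} & \bar a^{2m-1} \\ A^{2m-1} & \bar A^{2m-1} \end{pmatrix}=(C^{2m-1})^{-1}E^{m}C^{2m-1},$$ where in each $m\times m$ matrix $(a\ \bar a)$ is the first row, $\begin{pmatrix}\bar a\\ \bar A\end{pmatrix}$ is the last column, so $a\in L[B^{m-1},B]$, $\bar a\in L[B,B]$, $A\in L[B^{m-1},B^{m-1}]$, $\bar A\in L[B,B^{m-1}]$. For $m\ge2$, $M^{2m+1}\in L[B^m,B^m]$ is obtained from $$\begin{pmatrix}(a^{2m}\ \ \bar a^{2m})\\ a^{2m-1}\cdot(A^{2m}\ \ \bar A^{2m})\\ M^{2m-1}\cdot A^{2m-1}\cdot(A^{2m}\ \ \bar A^{2m})\end{pmatrix}$$ ($m+1$ rows, $m$ columns) by deleting the last row. For $2\le m\le k$, $$\bar S_{m+1}=[W^{2m}_{2m-1},\dots,W^{2m}_m](\bar z_{m-1},\dots,\bar z_1)\cdot\begin{pmatrix}\bar a^{2m-1}\\ M^{2m-1}\bar A^{2m-1}\end{pmatrix}+\frac{(2m)!}{(m!)^2}G_0^2\bar z_m\in L[B,\bar B].$$ Cone: the complements $N_i^c$ are chosen such that $\bar z_l\notin N_i^c$ and $\bar z_l\notin N^c$, so the projection $\bar z_{l,k+1}$ of $\bar z_l$ onto $N_{k+1}$ is nonzero; choose a closed $P_{k+1}$ with $N_{k+1}=P_{k+1}\oplus\mathbb K\bar z_{l,k+1}$. Let $\widehat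 M_{k+1}=\mathrm{diag}(I_B,M^{2k+1})$, $A_\varepsilon=\big[\tfrac{\varepsilon^{2k+1}}{(2k+1)!}\cdots\tfrac{\varepsilon^{k+1}}{(k+1)!}\big]\cdot\widehat M_{k+1}$ and $$Z_k(\varepsilon,n_1^c,\dots,n_{k+1}^c,p_{k+1})=z_0(\varepsilon)+A_\varepsilon\cdot(n_1^c,\dots,n_k^c,n_{k+1}^c+p_{k+1})^T,\quad n_i^c\in N_i^c,\ p_{k+1}\in P_{k+1}.$$ With arbitrary open bounded neighborhoods of zero $U_i^c\subset N_i^c$, $U_{k+1}^p\subset P_{k+1}$, $$C_k=\{Z_k(\varepsilon,n^c,p):n^c\in U_1^c\times\cdots\times U_{k+1}^c,\ p\in U^p_{k+1},\ 0<|\varepsilon|\ll1\}.$$ $C_k$ is called $k$-transversal (with respect to $G$) if $R_{k+1}^c=\{0\}$, equivalently $\bar B=R_1\oplus\cdots\oplus R_{k+1}$.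
   Formalization: The formal theorem additionally assumes that the target space B̄ is not {0}; for B̄ = {0} condition (i) holds while (ii) and (iii) would need a nonzero U isomorphic to {0}, so the equivalence as stated fails there. *)

theory Defs
  imports "HOL-Analysis.Analysis" "HOL-Library.Landau_Symbols"
begin

text \<open>
  The scalar field is the real or the complex field. In the second alternative the multiplicative
  norm of \<^class>\<open>real_normed_field\<close> is necessarily the usual modulus.
\<close>

class real_or_complex = real_normed_field +
  assumes real_or_complex:
    "(\<forall>x. \<exists>a. x = a *\<^sub>R 1) \<or> (\<exists>j. j * j = - 1 \<and> (\<forall>x. \<exists>a b. x = a *\<^sub>R 1 + b *\<^sub>R j))"

instance real :: real_or_complex
  by standard auto

instance complex :: real_or_complex
proof (standard, rule disjI2, rule exI[of _ \<i>], intro conjI allI)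
  fix x :: complex
  show "\<exists>a b. x = a *\<^sub>R 1 + b *\<^sub>R \<i>"
    by (rule exI[of _ "Re x"], rule exI[of _ "Im x"]) (simp add: complex_eq_iff)
qed simp

text \<open>
  The norm, topology and completeness of a Banach space over the scalar field are those of the
  underlying real Banach space; the scalar multiplication is an explicit function extending
  \<^const>\<open>scaleR\<close>.
\<close>

locale normed_space_over = vector_space scale
  for scale :: "'k::real_or_complex \<Rightarrow> 'a::real_normed_vector \<Rightarrow> 'a" +
  assumes scale_of_real: "scale (of_real r) x = r *\<^sub>R x"
    and norm_scale: "norm (scale c x) = norm c * norm x"

definition bounded_op_on ::
  "('k \<Rightarrow> 'a \<Rightarrow> 'a) \<Rightarrow> ('k \<Rightarrow> 'b \<Rightarrow> 'b) \<Rightarrow> 'a::real_normed_vector set \<Rightarrow> ('a \<Rightarrow> 'b::real_normed_vector) \<Rightarrow> bool"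
  where "bounded_op_on sX sY U T \<longleftrightarrow>
    (\<forall>x\<in>U. \<forall>y\<in>U. T (x + y) = T x + T y) \<and>
    (\<forall>c. \<forall>x\<in>U. T (sX c x) = sY c (T x)) \<and>
    (\<exists>C. \<forall>x\<in>U. norm (T x) \<le> C * norm x)"

definition GL_on ::
  "('k \<Rightarrow> 'a \<Rightarrow> 'a) \<Rightarrow> ('k \<Rightarrow> 'b \<Rightarrow> 'b) \<Rightarrow> 'a::real_normed_vector set \<Rightarrow> 'b::real_normed_vector set \<Rightarrow> ('a \<Rightarrow> 'b) \<Rightarrow> bool"
  where "GL_on sX sY U V T \<longleftrightarrow>
    bounded_op_on sX sY U T \<and> bij_betw T U V \<and> bounded_op_on sY sX V (the_inv_into U T)"

definition onorm_on :: "'a::real_normed_vector set \<Rightarrow> ('a \<Rightarrow> 'b::real_normed_vector) \<Rightarrow> real"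
  where "onorm_on U T = (SUP x\<in>U. norm (T x) / norm x)"

definition continuous_op_family ::
  "('k::real_normed_field \<Rightarrow> 'a \<Rightarrow> 'a) \<Rightarrow> ('k \<Rightarrow> 'b \<Rightarrow> 'b) \<Rightarrow> 'k set \<Rightarrow> 'a::real_normed_vector set
    \<Rightarrow> ('k \<Rightarrow> 'a \<Rightarrow> 'b::real_normed_vector) \<Rightarrow> bool"
  where "continuous_op_family sX sY S V Q \<longleftrightarrow>
    (\<forall>t\<in>S. bounded_op_on sX sY V (Q t)) \<and>
    (\<forall>t\<in>S. ((\<lambda>s. onorm_on V (\<lambda>v. Q s v - Q t v)) \<longlongrightarrow> 0) (at t within S))"

definition direct_sum ::
  "('k::field \<Rightarrow> 'a \<Rightarrow> 'a) \<Rightarrow> 'a::real_normed_vector set \<Rightarrow> 'a set \<Rightarrow> 'a set \<Rightarrow> bool"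
  where "direct_sum s X U V \<longleftrightarrow>
    module.subspace s U \<and> module.subspace s V \<and> U \<inter> V = {0} \<and> X = {u + v | u v. u \<in> U \<and> v \<in> V}"

text \<open>The projection of \<open>U \<oplus> V\<close> onto \<open>U\<close> along \<open>V\<close>.\<close>

definition proj :: "'a::ab_group_add set \<Rightarrow> 'a set \<Rightarrow> 'a \<Rightarrow> 'a"
  where "proj U V x = (THE u. u \<in> U \<and> x - u \<in> V)"

definition closed_direct_sum ::
  "('k::field \<Rightarrow> 'a \<Rightarrow> 'a) \<Rightarrow> 'a::real_normed_vector set \<Rightarrow> 'a set \<Rightarrow> 'a set \<Rightarrow> bool"
  where "closed_direct_sum s X U V \<longleftrightarrow> direct_sum s X U V \<and> closed U \<and> closed V"

definition top_direct_sum ::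
  "('k::field \<Rightarrow> 'a \<Rightarrow> 'a) \<Rightarrow> 'a::real_normed_vector set \<Rightarrow> 'a set \<Rightarrow> 'a set \<Rightarrow> bool"
  where "top_direct_sum s X U V \<longleftrightarrow>
    closed_direct_sum s X U V \<and> continuous_on X (proj U V) \<and> continuous_on X (proj V U)"

text \<open>
  \<open>hderiv f [h\<^sub>1, \<dots>, h\<^sub>n] x\<close> is the \<open>n\<close>-th derivative of \<open>f\<close> at \<open>x\<close> applied to
  \<open>(h\<^sub>1, \<dots>, h\<^sub>n)\<close>; the order is the length of the list. The condition \<open>C_on\<close> below says that these
  iterated derivatives really are the Frechet derivatives with respect to the operator norm on
  \<open>n\<close>-linear maps, that they are linear over the scalar field, and that the last one is continuous.
\<close>

primrec hderiv ::
  "('a::real_normed_vector \<Rightarrow> 'b::real_normed_vector) \<Rightarrow> 'a list \<Rightarrow> 'a \<Rightarrow> 'b"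
  where
    "hderiv f [] = f"
  | "hderiv f (h # hs) = (\<lambda>x. frechet_derivative (hderiv f hs) (at x) h)"

definition bounded_multilinear ::
  "('k \<Rightarrow> 'a \<Rightarrow> 'a) \<Rightarrow> ('k \<Rightarrow> 'b \<Rightarrow> 'b) \<Rightarrow> nat \<Rightarrow> ('a::real_normed_vector list \<Rightarrow> 'b::real_normed_vector) \<Rightarrow> bool"
  where "bounded_multilinear sX sY n T \<longleftrightarrow>
    (\<forall>xs ys. length xs + length ys + 1 = n \<longrightarrow>
      (\<forall>u v. T (xs @ (u + v) # ys) = T (xs @ u # ys) + T (xs @ v # ys)) \<and>
      (\<forall>c u. T (xs @ sX c u # ys) = sY c (T (xs @ u # ys)))) \<and>
    (\<exists>C. \<forall>xs. length xs = n \<longrightarrow> norm (T xs) \<le> C * prod_list (map norm xs))"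

definition C_on ::
  "('k \<Rightarrow> 'a \<Rightarrow> 'a) \<Rightarrow> ('k \<Rightarrow> 'b \<Rightarrow> 'b) \<Rightarrow> nat \<Rightarrow> 'a::real_normed_vector set \<Rightarrow> ('a \<Rightarrow> 'b::real_normed_vector) \<Rightarrow> bool"
  where "C_on sX sY q S f \<longleftrightarrow> open S \<and>
    (\<forall>n\<le>q. \<forall>x\<in>S. bounded_multilinear sX sY n (\<lambda>hs. hderiv f hs x)) \<and>
    (\<forall>n<q. \<forall>x\<in>S. \<forall>e>0. \<exists>d>0. \<forall>y\<in>S. norm (y - x) < d \<longrightarrow>
      (\<forall>hs. length hs = n \<longrightarrow>
        norm (hderiv f hs y - hderiv f hs x - hderiv f ((y - x) # hs) x)
          \<le> e * norm (y - x) * prod_list (map norm hs))) \<and>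
    (\<forall>x\<in>S. \<forall>e>0. \<exists>d>0. \<forall>y\<in>S. norm (y - x) < d \<longrightarrow>
      (\<forall>hs. length hs = q \<longrightarrow>
        norm (hderiv f hs y - hderiv f hs x) \<le> e * prod_list (map norm hs)))"

definition taylor_poly ::
  "nat \<Rightarrow> ('a::real_normed_vector \<Rightarrow> 'b::real_normed_vector) \<Rightarrow> 'a \<Rightarrow> 'b"
  where "taylor_poly k f x = (\<Sum>n\<le>k. (1 / fact n) *\<^sub>R hderiv f (replicate n x) 0)"

definition deriv_family ::
  "('b::real_normed_vector \<Rightarrow> 'c::real_normed_vector) \<Rightarrow> ('k \<Rightarrow> 'b) \<Rightarrow> 'k \<Rightarrow> 'b \<Rightarrow>\<^sub>L 'c"
  where "deriv_family G z0 \<epsilon> = Blinfun (frechet_derivative G (at (z0 \<epsilon>)))"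

definition cnum :: "nat \<Rightarrow> nat \<Rightarrow> real"
  where "cnum m l = real (m choose (l - 1)) / real ((2 * l - 2) choose (l - 1))"

text \<open>
  Entry \<open>(i, j)\<close> of \<open>C\<^sup>-\<^sup>1 X C\<close>, where \<open>C\<close> is diagonal with entries \<open>cnum \<mu> l\<close> and \<open>T\<close> is the
  entry \<open>(i, j)\<close> of the operator matrix \<open>X\<close>.
\<close>

definition conj_entry :: "nat \<Rightarrow> nat \<Rightarrow> nat \<Rightarrow> ('b \<Rightarrow> 'b) \<Rightarrow> 'b \<Rightarrow> 'b::real_vector"
  where "conj_entry \<mu> i j T = (\<lambda>x. (cnum \<mu> j / cnum \<mu> i) *\<^sub>R T x)"

text \<open>
  The multi-indices \<open>(n\<^sub>1, \<dots>, n\<^bsub>m-1\<^esub>)\<close>; the bound \<open>2m\<close> on the components follows from the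
  second equation and only makes finiteness evident.
\<close>

definition W_indices :: "nat \<Rightarrow> nat \<Rightarrow> nat \<Rightarrow> (nat \<Rightarrow> nat) set"
  where "W_indices m \<mu> \<beta> = {n \<in> {1..m-1} \<rightarrow>\<^sub>E {..2*m}.
    (\<Sum>i=1..m-1. n i) + 1 = \<beta> \<and> (\<Sum>i=1..m-1. i * n i) + \<mu> = 2 * m}"

definition W_op ::
  "('b::real_normed_vector \<Rightarrow> 'c::real_normed_vector) \<Rightarrow> nat \<Rightarrow> nat \<Rightarrow> (nat \<Rightarrow> 'b) \<Rightarrow> 'b \<Rightarrow> 'c"
  where "W_op G m \<mu> z x = (1 / fact \<mu>) *\<^sub>R (\<Sum>\<beta>=1..2*m. \<Sum>n\<in>W_indices m \<mu> \<beta>.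
    (fact (2 * m) / (\<Prod>i=1..m-1. fact (n i))) *\<^sub>R
      hderiv G (concat (map (\<lambda>\<tau>. replicate (n \<tau>) ((1 / fact \<tau>) *\<^sub>R z \<tau>)) [1..<m]) @ [x]) 0)"

locale resolution_data =
  fixes G :: "'b::real_normed_vector \<Rightarrow> 'c::real_normed_vector"
    and zb :: "nat \<Rightarrow> 'b"
    and Nc :: "nat \<Rightarrow> 'b set"
    and R Rc :: "nat \<Rightarrow> 'c set"
begin

text \<open>
  \<open>P_Rc i\<close> is the projection onto \<open>Rc i\<close> along \<open>R 1 \<oplus> \<dots> \<oplus> R i\<close>, obtained by successively splitting
  \<open>Rc (i - 1) = R i \<oplus> Rc i\<close>; likewise \<open>P_R i\<close> projects onto \<open>R i\<close> along
  \<open>R 1 \<oplus> \<dots> \<oplus> R (i - 1) \<oplus> Rc i\<close>.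
\<close>

primrec P_Rc :: "nat \<Rightarrow> 'c \<Rightarrow> 'c"
  where
    "P_Rc 0 y = y"
  | "P_Rc (Suc i) y = proj (Rc (Suc i)) (R (Suc i)) (P_Rc i y)"

definition P_R :: "nat \<Rightarrow> 'c \<Rightarrow> 'c"
  where "P_R i y = proj (R i) (Rc i) (P_Rc (i - 1) y)"

text \<open>
  Indices start at 1. \<open>E i j\<close> is an entry of every \<open>E\<^sup>m\<close> with \<open>m \<ge> max i j\<close>, the recursion not
  depending on \<open>m\<close>. \<open>M m r s\<close>, for \<open>1 \<le> r, s \<le> m\<close>, is the entry \<open>(r, s)\<close> of the matrix with
  superscript \<open>2m + 1\<close>. Let \<open>F\<^sup>\<mu>\<close> be the conjugated matrix with entries
  \<open>conj_entry \<mu> i j (E i j)\<close>, where \<open>\<mu> \<in> {2m, 2m - 1}\<close> and \<open>1 \<le> i, j \<le> m\<close>. Then the entry \<open>t\<close> of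
  the block \<open>a\<close> is \<open>F\<^sup>\<mu> 1 t\<close>, the entry \<open>(u, t)\<close> of \<open>A\<close> is \<open>F\<^sup>\<mu> (u + 1) t\<close> (\<open>u, t < m\<close>), and the
  barred blocks are the column \<open>F\<^sup>\<mu> i m\<close>, split after its first entry.
\<close>

function Sbar :: "nat \<Rightarrow> 'b \<Rightarrow> 'c"
  and E :: "nat \<Rightarrow> nat \<Rightarrow> 'b \<Rightarrow> 'b"
  and M :: "nat \<Rightarrow> nat \<Rightarrow> nat \<Rightarrow> 'b \<Rightarrow> 'b"
  where
    "Sbar i =
      (if i = 0 then (\<lambda>x. 0)
       else if i = 1 then (\<lambda>x. hderiv G [x] 0)
       else if i = 2 then (\<lambda>x. 2 *\<^sub>R hderiv G [zb 1, x] 0)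
       else (let m = i - 1 in (\<lambda>x.
         W_op G m (2*m - 1) zb (conj_entry (2*m - 1) 1 m (E 1 m) x)
         + (\<Sum>r=1..m-1. W_op G m (2*m - 1 - r) zb
             (\<Sum>s=1..m-1. M (m - 1) r s (conj_entry (2*m - 1) (s + 1) m (E (s + 1) m) x)))
         + (fact (2*m) / (fact m)\<^sup>2) *\<^sub>R hderiv G [zb m, x] 0)))"
  | "E i j =
      (if i = j then (\<lambda>x. x)
       else if i > j then (\<lambda>x. 0)
       else (\<lambda>x. - the_inv_into (Nc i) (\<lambda>y. P_Rc (i - 1) (Sbar i y))
                    (P_R i (\<Sum>v=i+1..j. Sbar v (E v j x)))))"
  | "M m r s =
      (if m = 0 then (\<lambda>x. 0)
       else if m = 1 then (\<lambda>x. x)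
       else if r = 1 then conj_entry (2*m) 1 s (E 1 s)
       else if r = 2 then (\<lambda>x.
         \<Sum>t=1..m-1. conj_entry (2*m - 1) 1 t (E 1 t) (conj_entry (2*m) (t + 1) s (E (t + 1) s) x))
       else (\<lambda>x.
         \<Sum>u=1..m-1. M (m - 1) (r - 2) u
           (\<Sum>t=1..m-1. conj_entry (2*m - 1) (u + 1) t (E (u + 1) t)
             (conj_entry (2*m) (t + 1) s (E (t + 1) s) x))))"
  by pat_completeness auto
termination
  by (relation "measures
       [case_sum (\<lambda>i. i) (case_sum (\<lambda>(i, j). j) (\<lambda>(m, r, s). max m s)),
        case_sum (\<lambda>i. 0) (case_sum (\<lambda>(i, j). 1) (\<lambda>(m, r, s). 2)),
        case_sum (\<lambda>i. 0) (case_sum (\<lambda>(i, j). j - i) (\<lambda>(m, r, s). 0))]") auto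

declare Sbar.simps [simp del] E.simps [simp del] M.simps [simp del]

definition S_op :: "nat \<Rightarrow> 'b \<Rightarrow> 'c"
  where "S_op i = (\<lambda>x. P_Rc (i - 1) (Sbar i x))"

definition fine_resolution ::
  "('k::real_or_complex \<Rightarrow> 'b \<Rightarrow> 'b) \<Rightarrow> ('k \<Rightarrow> 'c \<Rightarrow> 'c) \<Rightarrow> nat \<Rightarrow> (nat \<Rightarrow> 'b set) \<Rightarrow> bool"
  where "fine_resolution sB sC k N \<longleftrightarrow>
    N 0 = UNIV \<and> Rc 0 = UNIV \<and>
    (\<forall>i\<in>{1..k+1}.
      N i = {x \<in> N (i - 1). S_op i x = 0} \<and>
      R i = S_op i ` N (i - 1) \<and>
      top_direct_sum sB (N (i - 1)) (Nc i) (N i) \<and>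
      top_direct_sum sC (Rc (i - 1)) (R i) (Rc i) \<and>
      GL_on sB sC (Nc i) (R i) (S_op i))"

definition Nc_sum :: "nat \<Rightarrow> 'b set"
  where "Nc_sum k = {(\<Sum>i=1..k+1. n i) | n. \<forall>i\<in>{1..k+1}. n i \<in> Nc i}"

definition cone_point ::
  "('k::real_or_complex \<Rightarrow> 'b \<Rightarrow> 'b) \<Rightarrow> nat \<Rightarrow> ('k \<Rightarrow> 'b) \<Rightarrow> 'k \<Rightarrow> (nat \<Rightarrow> 'b) \<Rightarrow> 'b \<Rightarrow> 'b"
  where "cone_point sB k z0 \<epsilon> n p =
    (let w = n(k + 1 := n (k + 1) + p) in
      z0 \<epsilon> + sB (\<epsilon> ^ (2*k + 1) / fact (2*k + 1)) (w 1)
      + (\<Sum>r=1..k. sB (\<epsilon> ^ (2*k + 1 - r) / fact (2*k + 1 - r)) (\<Sum>s=1..k. M k r s (w (s + 1)))))"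

definition cone ::
  "('k::real_or_complex \<Rightarrow> 'b \<Rightarrow> 'b) \<Rightarrow> nat \<Rightarrow> ('k \<Rightarrow> 'b) \<Rightarrow> (nat \<Rightarrow> 'b set) \<Rightarrow> 'b set \<Rightarrow> real \<Rightarrow> 'b set"
  where "cone sB k z0 Uc Up \<delta> = {cone_point sB k z0 \<epsilon> n p | \<epsilon> n p.
    (\<forall>i\<in>{1..k+1}. n i \<in> Uc i) \<and> p \<in> Up \<and> 0 < norm \<epsilon> \<and> norm \<epsilon> < \<delta>}"

text \<open>
  \<open>\<delta>0\<close> is the radius of the ball on which the curve \<open>z0\<close> is defined; the complement \<open>P\<close>, the
  neighbourhoods and the bound \<open>\<delta>\<close> for the small parameter are arbitrary.
\<close>

definition is_cone ::
  "('k::real_or_complex \<Rightarrow> 'b \<Rightarrow> 'b) \<Rightarrow> nat \<Rightarrow> nat \<Rightarrow> (nat \<Rightarrow> 'b set) \<Rightarrow> ('k \<Rightarrow> 'b) \<Rightarrow> real \<Rightarrow> 'b set \<Rightarrow> bool"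
  where "is_cone sB k l N z0 \<delta>0 C \<longleftrightarrow>
    (\<forall>i\<in>{1..k+1}. zb l \<notin> Nc i) \<and> zb l \<notin> Nc_sum k \<and>
    (\<exists>P Uc Up \<delta>.
      closed P \<and> direct_sum sB (N (k + 1)) P (range (\<lambda>c. sB c (proj (N (k + 1)) (Nc_sum k) (zb l)))) \<and>
      (\<forall>i\<in>{1..k+1}. openin (top_of_set (Nc i)) (Uc i) \<and> bounded (Uc i) \<and> 0 \<in> Uc i) \<and>
      openin (top_of_set P) Up \<and> bounded Up \<and> 0 \<in> Up \<and>
      0 < \<delta> \<and> \<delta> \<le> \<delta>0 \<and> C = cone sB k z0 Uc Up \<delta>)"

definition k_transversal ::
  "('k::real_or_complex \<Rightarrow> 'b \<Rightarrow> 'b) \<Rightarrow> ('k \<Rightarrow> 'c \<Rightarrow> 'c) \<Rightarrow> nat \<Rightarrow> nat \<Rightarrow> (nat \<Rightarrow> 'b set) \<Rightarrow> ('k \<Rightarrow> 'b) \<Rightarrow> real \<Rightarrow> 'b set \<Rightarrow> bool"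
  where "k_transversal sB sC k l N z0 \<delta>0 C \<longleftrightarrow>
    fine_resolution sB sC k N \<and> is_cone sB k l N z0 \<delta>0 C \<and> Rc (k + 1) = {0}"

end

end

theory Submission
  imports Defs
begin

text \<open>
  By hypothesis the cone is transversal, so the point is to derive (ii) and (iii) from the fine
  resolution, with \<open>U = N\<^sup>c\<close> and \<open>V = N\<^bsub>k+1\<^esub>\<close>. All binomial factors in the recursion disappear after
  rescaling: if \<open>T\<^sub>i\<close> are the Taylor coefficients of \<open>L(\<epsilon>) = G'[z\<^sub>0(\<epsilon>)]\<close> and \<open>\<mu> r s\<close> are the rescaled entries of the
  matrices \<open>M\<close>, then up to constants \<open>Sbar\<^bsub>m+1\<^esub> = \<Sum>\<^sub>r T\<^sub>r \<mu> r m\<close>, and the triangular matrix \<open>E\<close> turns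
  \<open>Sbar\<close> into \<open>S\<close>. This makes the columns of \<open>\<mu>\<close> Jordan chains: for \<open>x \<in> N\<^bsub>s-1\<^esub>\<close> the polynomial
  \<open>\<Phi>\<^sub>s(\<epsilon>) x = \<Sum>\<^sub>r \<epsilon>\<^bsup>s-r\<^esup> \<mu> r s x\<close> satisfies \<open>L(\<epsilon>) \<Phi>\<^sub>s(\<epsilon>) x = \<epsilon>\<^bsup>s-1\<^esup> S\<^sub>s x + O(\<epsilon>\<^sup>s)\<close>, again up to a constant.
  Weighting \<open>\<Phi>\<^sub>s\<close> by \<open>\<epsilon>\<^bsup>k+1-s\<^esup>\<close> gives operators \<open>A(\<epsilon>)\<close> with \<open>L(\<epsilon>) A(\<epsilon>) = \<epsilon>\<^sup>k (D\<^sub>0 + \<epsilon> D\<^sub>1(\<epsilon>))\<close>, where \<open>D\<^sub>0\<close>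
  maps \<open>U\<close> isomorphically onto the target and vanishes on \<open>V\<close>. Since \<open>A(\<epsilon>)\<close> is block triangular on
  \<open>U\<close> and \<open>v + O(\<epsilon>)\<close> on \<open>V\<close>, inverting a perturbation of the identity yields the inverse on \<open>U\<close> and the family \<open>Q\<close>. The argument only sees
  the Taylor coefficients up to order \<open>k\<close> and a continuous remainder, so it applies to \<open>L\<close> and to
  \<open>P\<^sup>k\<close> alike.
\<close>

section \<open>Bounded operators over the scalar field\<close>

text \<open>The operator \<open>A \<epsilon>\<close> degenerates at \<epsilon> = 0, so no bound on
  an inverse of it is ever used. With \<open>X\<close> the inverse of id + \<epsilon>
  \<open>D\<^sub>1\<close> \<open>K\<close>, the map J = \<epsilon>^(-k) \<open>A\<close>
  \<open>K\<close> \<open>X\<close> is a right inverse of L(\<epsilon>) with values in U. The rate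
  is thus exactly the weight \<epsilon>^k, and J L = id on U asks only that
  \<open>A \<epsilon>\<close> maps U onto U, without any estimate. The rescaling comes from c_{m,l}
  = m! / ((m-l+1)! (2l-2)!/(l-1)!). The factor depending on l alone is moved into E. What remains of
  the conjugations are quotients of factorials, which telescope along the matrix products. Two
  obstacles shape the rest. The resolution is built from the coefficients of the curve, while P^k is
  defined by iterated derivatives of an operator-valued map. Hence that map has to be shown
  differentiable in operator norm, and the two sets of coefficients are identified by uniqueness of
  expansions. Moreover the operator type knows only real scalars, so linearity over the field
  travels as a separate hypothesis.\<close>

context normed_space_over
begin

lemma module_scale: "module scale"
  using vector_space_axioms module_iff_vector_space by blast

lemma bounded_bilinear_scale: "bounded_bilinear scale"
proof
  show "scale (r *\<^sub>R a) b = r *\<^sub>R scale a b" for r a b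
    by (metis scaleR_conv_of_real scale_of_real scale_scale)
  show "scale a (r *\<^sub>R b) = r *\<^sub>R scale a b" for r a b
    by (metis scale_of_real scale_left_commute)
  show "\<exists>K. \<forall>a b. norm (scale a b) \<le> norm a * norm b * K"
    by (rule exI[of _ 1]) (simp add: norm_scale)
qed (auto simp: scale_left_distrib scale_right_distrib)

lemma subspace_scaleR: "subspace U \<Longrightarrow> x \<in> U \<Longrightarrow> r *\<^sub>R x \<in> U"
  by (metis scale_of_real subspace_scale)

lemma subspace_uminus: "subspace U \<Longrightarrow> x \<in> U \<Longrightarrow> - x \<in> U"
  using subspace_scaleR[of U x "-1"] by simp

lemma tendsto_scale_power:
  fixes w :: 'a
  assumes "1 \<le> n"
  shows "((\<lambda>c::'k. scale (c ^ n) w) \<longlongrightarrow> 0) (nhds 0)"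
proof -
  have "((\<lambda>c::'k. scale (c ^ n) w) \<longlongrightarrow> scale (0 ^ n) w) (nhds 0)"
    by (intro bounded_bilinear.tendsto[OF bounded_bilinear_scale] tendsto_intros) (simp add: filterlim_ident)
  then show ?thesis using assms by (simp add: power_0_left)
qed

lemma tendsto_scale_polynomial:
  fixes w :: "nat \<Rightarrow> 'a"
  shows "((\<lambda>c::'k. \<Sum>n=1..p. scale (c ^ n) (w n)) \<longlongrightarrow> 0) (nhds 0)"
proof -
  have "((\<lambda>c::'k. \<Sum>n=1..p. scale (c ^ n) (w n)) \<longlongrightarrow> (\<Sum>n=1..p. 0)) (nhds 0)"
    by (intro tendsto_sum tendsto_scale_power) simp
  then show ?thesis by simp
qed

lemma scale_scaleR: "scale c (r *\<^sub>R x) = r *\<^sub>R scale c x"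
  by (metis scale_of_real scale_left_commute)

end

lemma bounded_op_onI:
  assumes "\<And>x y. x \<in> U \<Longrightarrow> y \<in> U \<Longrightarrow> T (x + y) = T x + T y"
    and "\<And>c x. x \<in> U \<Longrightarrow> T (sX c x) = sY c (T x)"
    and "\<And>x. x \<in> U \<Longrightarrow> norm (T x) \<le> C * norm x"
  shows "bounded_op_on sX sY U T"
  using assms unfolding bounded_op_on_def by blast

lemma bounded_op_on_add: "bounded_op_on sX sY U T \<Longrightarrow> x \<in> U \<Longrightarrow> y \<in> U \<Longrightarrow> T (x + y) = T x + T y"
  and bounded_op_on_scale: "bounded_op_on sX sY U T \<Longrightarrow> x \<in> U \<Longrightarrow> T (sX c x) = sY c (T x)"
  unfolding bounded_op_on_def by blast+

lemma bounded_op_on_bound: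
  assumes "bounded_op_on sX sY U T"
  obtains C where "C > 0" "\<And>x. x \<in> U \<Longrightarrow> norm (T x) \<le> C * norm x"
proof -
  obtain C where C: "\<forall>x\<in>U. norm (T x) \<le> C * norm x"
    using assms unfolding bounded_op_on_def by blast
  have "norm (T x) \<le> (\<bar>C\<bar> + 1) * norm x" if "x \<in> U" for x
    using C that by (smt (verit, best) mult_right_mono norm_ge_zero)
  then show ?thesis using that[of "\<bar>C\<bar> + 1"] by auto
qed

lemma bounded_op_on_compose:
  assumes T: "bounded_op_on sX sY U T" and S: "bounded_op_on sY sZ V S" and TU: "\<And>x. x \<in> U \<Longrightarrow> T x \<in> V"
  shows "bounded_op_on sX sZ U (\<lambda>x. S (T x))"
proof -
  obtain C where C: "C > 0" "\<And>x. x \<in> U \<Longrightarrow> norm (T x) \<le> C * norm x"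
    using T by (rule bounded_op_on_bound) blast
  obtain D where D: "D > 0" "\<And>x. x \<in> V \<Longrightarrow> norm (S x) \<le> D * norm x"
    using S by (rule bounded_op_on_bound) blast
  show ?thesis
  proof (rule bounded_op_onI)
    show "norm (S (T x)) \<le> (D * C) * norm x" if "x \<in> U" for x
      using D(2)[OF TU[OF that]] C(2)[OF that] D(1)
      by (smt (verit, best) mult.assoc mult_left_mono)
  qed (use T S TU in \<open>auto simp: bounded_op_on_add bounded_op_on_scale\<close>)
qed

lemma bounded_op_on_compose_UNIV:
  "bounded_op_on sY sZ UNIV g \<Longrightarrow> bounded_op_on sX sY UNIV f \<Longrightarrow> bounded_op_on sX sZ UNIV (\<lambda>x. g (f x))"
  by (rule bounded_op_on_compose) auto

lemma bounded_op_on_id: "bounded_op_on sX sX U (\<lambda>x. x)"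
  by (rule bounded_op_onI[where C = 1]) auto

context
  fixes sX :: "'k::real_or_complex \<Rightarrow> 'a::real_normed_vector \<Rightarrow> 'a"
    and sY :: "'k \<Rightarrow> 'b::real_normed_vector \<Rightarrow> 'b"
  assumes sX: "normed_space_over sX" and sY: "normed_space_over sY"
begin

interpretation X: normed_space_over sX by (fact sX)
interpretation Y: normed_space_over sY by (fact sY)

lemma bounded_op_on_zero: "bounded_op_on sX sY U (\<lambda>x. 0)"
  by (rule bounded_op_onI[where C = 0]) auto

lemma bounded_op_on_plus:
  assumes T: "bounded_op_on sX sY U T" and S: "bounded_op_on sX sY U S"
  shows "bounded_op_on sX sY U (\<lambda>x. T x + S x)"
proof -
  obtain C where C: "C > 0" "\<And>x. x \<in> U \<Longrightarrow> norm (T x) \<le> C * norm x"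
    using T by (rule bounded_op_on_bound) blast
  obtain D where D: "D > 0" "\<And>x. x \<in> U \<Longrightarrow> norm (S x) \<le> D * norm x"
    using S by (rule bounded_op_on_bound) blast
  show ?thesis
  proof (rule bounded_op_onI)
    show "norm (T x + S x) \<le> (C + D) * norm x" if "x \<in> U" for x
      using D(2)[OF that] C(2)[OF that] norm_triangle_ineq[of "T x" "S x"]
      by (simp add: distrib_right)
  qed (use T S in \<open>auto simp: bounded_op_on_add bounded_op_on_scale Y.scale_right_distrib\<close>)
qed

lemma bounded_op_on_scaleR:
  assumes T: "bounded_op_on sX sY U T"
  shows "bounded_op_on sX sY U (\<lambda>x. r *\<^sub>R T x)"
proof -
  obtain C where C: "C > 0" "\<And>x. x \<in> U \<Longrightarrow> norm (T x) \<le> C * norm x"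
    using T by (rule bounded_op_on_bound) blast
  show ?thesis
  proof (rule bounded_op_onI)
    show "norm (r *\<^sub>R T x) \<le> (\<bar>r\<bar> * C) * norm x" if "x \<in> U" for x
      using C(2)[OF that] by (simp add: mult.assoc mult_left_mono)
  qed (use T in \<open>auto simp: bounded_op_on_add bounded_op_on_scale scaleR_add_right Y.scale_scaleR\<close>)
qed

lemma bounded_op_on_uminus:
  "bounded_op_on sX sY U T \<Longrightarrow> bounded_op_on sX sY U (\<lambda>x. - T x)"
  using bounded_op_on_scaleR[of U T "-1"] by simp

lemma bounded_op_on_sum:
  "(\<And>i. i \<in> I \<Longrightarrow> bounded_op_on sX sY U (T i)) \<Longrightarrow> bounded_op_on sX sY U (\<lambda>x. \<Sum>i\<in>I. T i x)"
  by (induction I rule: infinite_finite_induct) (auto simp: bounded_op_on_zero bounded_op_on_plus)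

lemma bounded_op_on_scaleR_arg:
  assumes "bounded_op_on sX sY U T" "x \<in> U"
  shows "T (r *\<^sub>R x) = r *\<^sub>R T x"
  by (metis bounded_op_on_scale X.scale_of_real Y.scale_of_real assms)

lemma bounded_op_on_zero_arg:
  assumes "bounded_op_on sX sY U T" "X.subspace U"
  shows "T 0 = 0"
  using bounded_op_on_scaleR_arg[OF assms(1) X.subspace_0[OF assms(2)], of 0] by simp

lemma bounded_op_on_uminus_arg:
  assumes "bounded_op_on sX sY U T" "x \<in> U"
  shows "T (- x) = - T x"
  using bounded_op_on_scaleR_arg[OF assms, of "-1"] by simp

lemma bounded_op_on_sum_arg:
  assumes T: "bounded_op_on sX sY U T" and U: "X.subspace U" and f: "\<And>i. i \<in> I \<Longrightarrow> f i \<in> U"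
  shows "T (\<Sum>i\<in>I. f i) = (\<Sum>i\<in>I. T (f i))"
  using f
proof (induction I rule: infinite_finite_induct)
  case (insert i I)
  have "sum f I \<in> U" by (rule X.subspace_sum[OF U]) (use insert in auto)
  then show ?case using insert by (simp add: bounded_op_on_add[OF T])
qed (auto simp: bounded_op_on_zero_arg[OF T U])

lemma bounded_op_UNIV_bounded_linear:
  assumes "bounded_op_on sX sY UNIV T"
  shows "bounded_linear T"
proof -
  obtain C where C: "C > 0" "\<And>x. x \<in> UNIV \<Longrightarrow> norm (T x) \<le> C * norm x"
    using assms by (rule bounded_op_on_bound) blast
  show ?thesis
    by (rule bounded_linear_intro[of _ C])
       (use C assms in \<open>auto simp: bounded_op_on_add bounded_op_on_scaleR_arg mult.commute\<close>)
qed

text \<open>A topological direct sum provides only continuity of its projections, and only on a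
  subspace. Rescaling a vector to half the radius of continuity at 0 turns this into a norm
  bound.\<close>

lemma continuous_bounded_op_on:
  assumes U: "X.subspace U"
    and add: "\<And>x y. x \<in> U \<Longrightarrow> y \<in> U \<Longrightarrow> T (x + y) = T x + T y"
    and sc: "\<And>c x. x \<in> U \<Longrightarrow> T (sX c x) = sY c (T x)"
    and cont: "continuous_on U T"
  shows "bounded_op_on sX sY U T"
proof -
  have 0: "0 \<in> U" by (rule X.subspace_0[OF U])
  have T0: "T 0 = 0" using add[OF 0 0] by simp
  have scR: "T (r *\<^sub>R x) = r *\<^sub>R T x" if "x \<in> U" for r x
    by (metis X.scale_of_real Y.scale_of_real sc that)
  obtain d where d: "d > 0" "\<And>x. x \<in> U \<Longrightarrow> dist x 0 < d \<Longrightarrow> dist (T x) (T 0) < 1"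
    using cont 0 unfolding continuous_on_iff by (meson zero_less_one)
  have "norm (T x) \<le> (2 / d) * norm x" if x: "x \<in> U" for x
  proof (cases "x = 0")
    case True then show ?thesis by (simp add: T0)
  next
    case False
    define r where "r = d / (2 * norm x)"
    have r: "r > 0" using False d by (simp add: r_def)
    have "r *\<^sub>R x \<in> U" by (rule X.subspace_scaleR[OF U x])
    moreover have "norm (r *\<^sub>R x) = d / 2" using False d by (simp add: r_def)
    ultimately have "norm (T (r *\<^sub>R x)) < 1" using d T0 by (auto simp: dist_norm)
    then have "r * norm (T x) < 1" using r scR[OF x] by simp
    then have "norm (T x) \<le> 1 / r" using r by (simp add: field_simps)
    then show ?thesis by (simp add: r_def)
  qed
  then show ?thesis using add sc by (intro bounded_op_onI[where C = "2 / d"]) auto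
qed

end

section \<open>Nested direct sums\<close>

text \<open>\<open>proj\<close> is a definite description, so its values are computed through this
  uniqueness statement: two candidates differ by an element of both summands.\<close>

lemma proj_eqI:
  assumes "direct_sum s X U V" "module s" "u \<in> U" "x - u \<in> V"
  shows "proj U V x = u"
  unfolding proj_def
proof (rule the_equality)
  interpret module s by fact
  show "u \<in> U \<and> x - u \<in> V" using assms by auto
  fix w assume w: "w \<in> U \<and> x - w \<in> V"
  have UV: "subspace U" "subspace V" "U \<inter> V = {0}" using assms(1) unfolding direct_sum_def by auto
  have "w - u \<in> U" by (rule subspace_diff[OF UV(1)]) (use w assms(3) in auto)
  moreover have "(x - u) - (x - w) \<in> V" by (rule subspace_diff[OF UV(2)]) (use w assms(4) in auto)
  ultimately have "w - u \<in> {0}" unfolding UV(3)[symmetric] by simp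
  then show "w = u" by simp
qed

lemma direct_sum_sym: "direct_sum s X U V \<Longrightarrow> direct_sum s X V U"
proof -
  have "{u + v |u v. u \<in> U \<and> v \<in> V} = {u + v |u v. u \<in> V \<and> v \<in> U}"
    using add.commute by blast
  then show "direct_sum s X U V \<Longrightarrow> direct_sum s X V U"
    unfolding direct_sum_def by (simp add: Int_commute)
qed

lemma top_direct_sum_sym: "top_direct_sum s X U V \<Longrightarrow> top_direct_sum s X V U"
  unfolding top_direct_sum_def closed_direct_sum_def using direct_sum_sym by blast

lemma proj_props:
  assumes D: "direct_sum s X U V" and s: "module s" and x: "x \<in> X"
  shows proj_in: "proj U V x \<in> U" and proj_diff_in: "x - proj U V x \<in> V"
    and proj_decomp: "proj U V x + proj V U x = x"
proof -
  obtain u v where uv: "u \<in> U" "v \<in> V" "x = u + v" using D x unfolding direct_sum_def by auto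
  have 1: "proj U V x = u" by (rule proj_eqI[OF D s]) (use uv in auto)
  have 2: "proj V U x = v" by (rule proj_eqI[OF direct_sum_sym[OF D] s]) (use uv in auto)
  show "proj U V x \<in> U" "x - proj U V x \<in> V" "proj U V x + proj V U x = x"
    using 1 2 uv by auto
qed

lemma direct_sum_subset:
  assumes "direct_sum s X U V" "module s"
  shows "U \<subseteq> X" "V \<subseteq> X"
proof -
  interpret module s by fact
  have X: "X = {u + v |u v. u \<in> U \<and> v \<in> V}" and 0: "0 \<in> U" "0 \<in> V"
    using assms subspace_0 unfolding direct_sum_def by auto
  show "U \<subseteq> X" using 0(2) unfolding X by (intro subsetI CollectI exI[of _ 0] exI) auto
  show "V \<subseteq> X" using 0(1) unfolding X by (intro subsetI CollectI exI[of _ 0] exI) auto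
qed

lemma proj_bounded_op:
  assumes s: "normed_space_over s" and X: "module.subspace s X" and D: "top_direct_sum s X U V"
  shows "bounded_op_on s s X (proj U V)"
proof -
  interpret normed_space_over s by fact
  have D': "direct_sum s X U V" and C: "continuous_on X (proj U V)"
    using D unfolding top_direct_sum_def closed_direct_sum_def by auto
  have UV: "subspace U" "subspace V" using D' unfolding direct_sum_def by auto
  show ?thesis
  proof (rule continuous_bounded_op_on[OF s s X _ _ C])
    fix x y assume xy: "x \<in> X" "y \<in> X"
    show "proj U V (x + y) = proj U V x + proj U V y"
    proof (rule proj_eqI[OF D' module_scale])
      show "x + y - (proj U V x + proj U V y) \<in> V"
        using subspace_add[OF UV(2) proj_diff_in[OF D' module_scale xy(1)] proj_diff_in[OF D' module_scale xy(2)]]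
        by (simp add: algebra_simps)
    qed (intro subspace_add UV proj_in[OF D' module_scale] xy)
  next
    fix c x assume x: "x \<in> X"
    show "proj U V (s c x) = s c (proj U V x)"
    proof (rule proj_eqI[OF D' module_scale])
      show "s c x - s c (proj U V x) \<in> V"
        using subspace_scale[OF UV(2) proj_diff_in[OF D' module_scale x], of c]
        by (simp add: scale_right_diff_distrib)
    qed (intro subspace_scale UV proj_in[OF D' module_scale] x)
  qed
qed

text \<open>For \<open>X 0 = UNIV\<close> and \<open>X (i - 1) = Y i \<oplus> X i\<close>, the map \<open>rest_proj Y X j\<close> is the projection onto
  \<open>X j\<close> along \<open>Y 1 \<oplus> \<dots> \<oplus> Y j\<close>, and \<open>summand_proj Y X i\<close> the one onto \<open>Y i\<close>.\<close>

primrec rest_proj :: "(nat \<Rightarrow> 'a::ab_group_add set) \<Rightarrow> (nat \<Rightarrow> 'a set) \<Rightarrow> nat \<Rightarrow> 'a \<Rightarrow> 'a"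
  where
    "rest_proj Y X 0 x = x"
  | "rest_proj Y X (Suc j) x = proj (X (Suc j)) (Y (Suc j)) (rest_proj Y X j x)"

definition summand_proj :: "(nat \<Rightarrow> 'a::ab_group_add set) \<Rightarrow> (nat \<Rightarrow> 'a set) \<Rightarrow> nat \<Rightarrow> 'a \<Rightarrow> 'a"
  where "summand_proj Y X i x = proj (Y i) (X i) (rest_proj Y X (i - 1) x)"

text \<open>Used twice, for the domain with \<open>Nc\<close>, \<open>N\<close> and for the target
  with \<open>R\<close>, \<open>Rc\<close>, so that both decompositions of the fine resolution share
  one set of projection facts.\<close>

locale nested_sums = normed_space_over s for s :: "'k::real_or_complex \<Rightarrow> 'a::real_normed_vector \<Rightarrow> 'a" +
  fixes Y X :: "nat \<Rightarrow> 'a set" and n :: nat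
  assumes X_0: "X 0 = UNIV"
    and step: "\<And>i. 1 \<le> i \<Longrightarrow> i \<le> n \<Longrightarrow> top_direct_sum s (X (i - 1)) (Y i) (X i)"
begin

lemma dsum: "1 \<le> i \<Longrightarrow> i \<le> n \<Longrightarrow> direct_sum s (X (i - 1)) (Y i) (X i)"
  using step unfolding top_direct_sum_def closed_direct_sum_def by auto

lemma dsum': "1 \<le> i \<Longrightarrow> i \<le> n \<Longrightarrow> direct_sum s (X (i - 1)) (X i) (Y i)"
  using dsum direct_sum_sym by blast

lemma subspace_X: "i \<le> n \<Longrightarrow> subspace (X i)"
  using dsum[of i] X_0 by (cases "i = 0") (auto simp: direct_sum_def)

lemma subspace_Y: "1 \<le> i \<Longrightarrow> i \<le> n \<Longrightarrow> subspace (Y i)"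
  using dsum[of i] by (auto simp: direct_sum_def)

lemma closed_X: "1 \<le> i \<Longrightarrow> i \<le> n \<Longrightarrow> closed (X i)"
  using step[of i] by (auto simp: top_direct_sum_def closed_direct_sum_def)

lemma X_antimono: "i \<le> j \<Longrightarrow> j \<le> n \<Longrightarrow> X j \<subseteq> X i"
proof (induction j)
  case (Suc j)
  have "X (Suc j) \<subseteq> X j" using direct_sum_subset(2)[OF dsum[of "Suc j"] module_scale] Suc by auto
  then show ?case using Suc by (cases "i = Suc j") auto
qed auto

lemma Y_subset:
  assumes "1 \<le> i" "i \<le> n" "j < i"
  shows "Y i \<subseteq> X j"
proof -
  have "Y i \<subseteq> X (i - 1)" using direct_sum_subset(1)[OF dsum[of i] module_scale] assms by simp
  moreover have "X (i - 1) \<subseteq> X j" by (rule X_antimono) (use assms in auto)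
  ultimately show ?thesis by blast
qed

lemma rest_proj_in: "j \<le> n \<Longrightarrow> rest_proj Y X j x \<in> X j"
proof (induction j)
  case (Suc j)
  then show ?case using proj_in[OF dsum'[of "Suc j"] module_scale] by auto
qed (simp add: X_0)

lemma summand_proj_in: "1 \<le> i \<Longrightarrow> i \<le> n \<Longrightarrow> summand_proj Y X i x \<in> Y i"
  using proj_in[OF dsum[of i] module_scale] rest_proj_in[of "i - 1"] by (auto simp: summand_proj_def)

lemma bounded_op_rest_proj: "j \<le> n \<Longrightarrow> bounded_op_on s s UNIV (rest_proj Y X j)"
proof (induction j)
  case 0
  show ?case using bounded_op_on_id[of s UNIV] by (simp add: bounded_op_on_def)
next
  case (Suc j)
  have "bounded_op_on s s (X j) (proj (X (Suc j)) (Y (Suc j)))"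
    using proj_bounded_op[OF normed_space_over_axioms subspace_X top_direct_sum_sym[OF step[of "Suc j"]]] Suc
    by auto
  then have "bounded_op_on s s UNIV (\<lambda>x. proj (X (Suc j)) (Y (Suc j)) (rest_proj Y X j x))"
    by (rule bounded_op_on_compose[rotated]) (use Suc rest_proj_in in auto)
  then show ?case by (simp add: bounded_op_on_def)
qed

lemma bounded_op_summand_proj:
  assumes "1 \<le> i" "i \<le> n"
  shows "bounded_op_on s s UNIV (summand_proj Y X i)"
proof -
  have "bounded_op_on s s (X (i - 1)) (proj (Y i) (X i))"
    by (rule proj_bounded_op[OF normed_space_over_axioms subspace_X step]) (use assms in auto)
  then have "bounded_op_on s s UNIV (\<lambda>x. proj (Y i) (X i) (rest_proj Y X (i - 1) x))"
    by (rule bounded_op_on_compose[rotated]) (use assms bounded_op_rest_proj[of "i-1"] rest_proj_in[of "i-1"] in auto)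
  then show ?thesis by (simp add: bounded_op_on_def summand_proj_def)
qed

lemma rest_proj_id: "j \<le> n \<Longrightarrow> x \<in> X j \<Longrightarrow> rest_proj Y X j x = x"
proof (induction j)
  case (Suc j)
  have "x \<in> X j" using Suc X_antimono[of j "Suc j"] by auto
  then have "rest_proj Y X j x = x" using Suc by auto
  moreover have "proj (X (Suc j)) (Y (Suc j)) x = x"
    by (rule proj_eqI[OF dsum'[of "Suc j"] module_scale])
      (use Suc subspace_Y[of "Suc j"] in \<open>auto intro: subspace_0\<close>)
  ultimately show ?case by simp
qed auto

lemma rest_proj_zero_mono:
  assumes "rest_proj Y X i x = 0" "i \<le> j" "j \<le> n"
  shows "rest_proj Y X j x = 0"
  using assms(2,3)
proof (induction j)
  case (Suc j)
  show ?case
  proof (cases "i = Suc j")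
    case False
    then have "rest_proj Y X j x = 0" using Suc by auto
    moreover have "proj (X (Suc j)) (Y (Suc j)) 0 = 0"
      by (rule proj_eqI[OF dsum'[of "Suc j"] module_scale])
        (use Suc subspace_Y[of "Suc j"] subspace_X[of "Suc j"] in \<open>auto intro: subspace_0\<close>)
    ultimately show ?thesis by simp
  qed (use assms in simp)
qed (use assms in auto)

text \<open>The hypothesis concerns what is left of \<open>x\<close> after \<open>i - 1\<close>
  splittings, not \<open>x\<close> itself. This is all that is known about the values of
  \<open>Sbar\<close>, whose components in the earlier ranges are uncontrolled.\<close>

lemma rest_proj_summand:
  assumes "1 \<le> i" "i \<le> j" "j \<le> n" "rest_proj Y X (i - 1) x \<in> Y i"
  shows "rest_proj Y X j x = 0"
proof -
  obtain i' where i: "i = Suc i'" using assms by (cases i) auto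
  have "proj (X i) (Y i) (rest_proj Y X (i - 1) x) = 0"
    by (rule proj_eqI[OF dsum'[of i] module_scale])
      (use assms subspace_X[of i] in \<open>auto intro: subspace_0\<close>)
  then have "rest_proj Y X i x = 0" by (simp add: i)
  then show ?thesis by (rule rest_proj_zero_mono) (use assms in auto)
qed

lemma summand_proj_of_rest:
  assumes "1 \<le> i" "i \<le> n" "rest_proj Y X (i - 1) x \<in> Y i"
  shows "summand_proj Y X i x = rest_proj Y X (i - 1) x"
  unfolding summand_proj_def
  by (rule proj_eqI[OF dsum[of i] module_scale])
      (use assms subspace_X[of i] in \<open>auto intro: subspace_0\<close>)

lemma summand_proj_zero:
  assumes "1 \<le> i" "i \<le> n" "rest_proj Y X (i - 1) x \<in> X i"
  shows "summand_proj Y X i x = 0"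
  unfolding summand_proj_def
  by (rule proj_eqI[OF dsum[of i] module_scale])
      (use assms subspace_Y[of i] in \<open>auto intro: subspace_0\<close>)

lemma summand_proj_rest:
  assumes "1 \<le> i" "i \<le> j" "j \<le> n" "x \<in> X j"
  shows "summand_proj Y X i x = 0"
proof (rule summand_proj_zero)
  have "x \<in> X i" by (rule subsetD[OF X_antimono[of i j]]) (use assms in auto)
  moreover have "x \<in> X (i - 1)" by (rule subsetD[OF X_antimono[of "i - 1" j]]) (use assms in auto)
  ultimately
  show "rest_proj Y X (i - 1) x \<in> X i" using rest_proj_id[of "i - 1" x] assms by auto
qed (use assms in auto)

lemma summand_proj_summand:
  assumes "1 \<le> i" "i \<le> n" "1 \<le> j" "j \<le> n" "x \<in> Y j"
  shows "summand_proj Y X i x = (if i = j then x else 0)"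
proof -
  have j: "x \<in> X (j - 1)" using Y_subset[of j "j - 1"] assms by auto
  have r: "rest_proj Y X (j - 1) x = x" by (rule rest_proj_id) (use assms j in auto)
  consider "i = j" | "i < j" | "j < i" by linarith
  then show ?thesis
  proof cases
    case 1 then show ?thesis using summand_proj_of_rest[of i x] assms r by simp
  next
    case 2
    then show ?thesis using summand_proj_rest[of i "j - 1" x] assms j by simp
  next
    case 3
    then have "rest_proj Y X (i - 1) x = 0" using rest_proj_summand[of j "i - 1" x] assms r by simp
    then show ?thesis using 3 summand_proj_zero[of i x] assms subspace_X[of i] by (auto intro: subspace_0)
  qed
qed

text \<open>Telescoping: each splitting replaces the current rest by a summand and a smaller
  rest.\<close>

lemma nested_decomp: "j \<le> n \<Longrightarrow> (\<Sum>i=1..j. summand_proj Y X i x) + rest_proj Y X j x = x"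
proof (induction j)
  case (Suc j)
  have "summand_proj Y X (Suc j) x + rest_proj Y X (Suc j) x = rest_proj Y X j x"
    using proj_decomp[OF dsum[of "Suc j"] module_scale, of "rest_proj Y X j x"] rest_proj_in[of j] Suc
    by (simp add: summand_proj_def)
  then show ?case using Suc by (simp add: add.assoc)
qed simp

end

section \<open>The reduced operator family\<close>

text \<open>Solving x + H x = y is a fixed point problem for the contraction x -> y - H x. Linearity
  of the solution map follows from uniqueness, and the bound 2 is 1 / (1 - 1/2).\<close>

lemma neumann_inverse:
  fixes H :: "'c::banach \<Rightarrow>\<^sub>L 'c"
  assumes H: "norm H \<le> 1 / 2"
  shows "\<exists>X. (id_blinfun + H) o\<^sub>L X = id_blinfun \<and> X o\<^sub>L (id_blinfun + H) = id_blinfun \<and> norm X \<le> 2"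
proof -
  have Hx: "norm (H x) \<le> norm x / 2" for x
    using norm_blinfun[of H x] mult_right_mono[OF H norm_ge_zero[of x]] by linarith
  have "\<exists>!x\<in>UNIV. y - H x = x" for y
    by (rule Banach_fix[where c = "1 / 2"])
       (use Hx[of "a - b" for a b] in \<open>auto simp: dist_norm blinfun.diff_right norm_minus_commute complete_UNIV\<close>)
  then have "\<exists>!x. x + H x = y" for y by (simp add: algebra_simps) (metis add.commute diff_eq_eq)
  then obtain X where X: "\<And>y. X y + H (X y) = y" "\<And>x y. x + H x = y \<Longrightarrow> x = X y"
    by metis
  have nX: "norm (X y) \<le> 2 * norm y" for y
  proof -
    have "norm (X y) = norm (y - H (X y))" using X(1)[of y] by (metis add_diff_cancel_right')
    also have "\<dots> \<le> norm y + norm (X y) / 2" using norm_triangle_ineq4[of y "H (X y)"] Hx[of "X y"] by simp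
    finally show ?thesis by simp
  qed
  have "bounded_linear X"
  proof (rule bounded_linear_intro[of _ 2])
    show "X (a + b) = X a + X b" for a b
    proof -
      have "X a + X b + H (X a + X b) = (X a + H (X a)) + (X b + H (X b))"
        by (simp add: blinfun.add_right algebra_simps)
      then show ?thesis using X(2)[of "X a + X b" "a + b"] X(1) by simp
    qed
    show "X (r *\<^sub>R a) = r *\<^sub>R X a" for r a
    proof -
      have "r *\<^sub>R X a + H (r *\<^sub>R X a) = r *\<^sub>R (X a + H (X a))"
        by (simp add: blinfun.scaleR_right algebra_simps)
      then show ?thesis using X(2)[of "r *\<^sub>R X a" "r *\<^sub>R a"] X(1) by simp
    qed
    show "norm (X a) \<le> norm a * 2" for a using nX by (simp add: mult.commute)
  qed
  then have B: "blinfun_apply (Blinfun X) = X" by (rule bounded_linear_Blinfun_apply)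
  show ?thesis
  proof (intro exI[of _ "Blinfun X"] conjI)
    show "(id_blinfun + H) o\<^sub>L Blinfun X = id_blinfun"
      by (rule blinfun_eqI) (simp add: B X blinfun.add_left)
    show "Blinfun X o\<^sub>L (id_blinfun + H) = id_blinfun"
      by (rule blinfun_eqI) (simp add: B X(2)[symmetric] blinfun.add_left)
    show "norm (Blinfun X) \<le> 2" by (rule norm_blinfun_bound) (use B nX in auto)
  qed
qed

text \<open>Resolvent identity: X(s) - X(t) = X(s) (H(t) - H(s)) X(t), so the uniform bound 2 makes
  X Lipschitz in H with constant 4.\<close>

lemma continuous_on_neumann_inverse:
  fixes H X :: "'a::topological_space \<Rightarrow> 'c::banach \<Rightarrow>\<^sub>L 'c"
  assumes H: "continuous_on S H"
    and X: "\<And>t. t \<in> S \<Longrightarrow> (id_blinfun + H t) o\<^sub>L X t = id_blinfun"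
      "\<And>t. t \<in> S \<Longrightarrow> X t o\<^sub>L (id_blinfun + H t) = id_blinfun" "\<And>t. t \<in> S \<Longrightarrow> norm (X t) \<le> 2"
  shows "continuous_on S X"
  unfolding continuous_on_def
proof
  fix t assume t: "t \<in> S"
  have "((\<lambda>s. X s - X t) \<longlongrightarrow> 0) (at t within S)"
  proof (rule Lim_null_comparison)
    show "\<forall>\<^sub>F s in at t within S. norm (X s - X t) \<le> 4 * norm (H t - H s)"
      unfolding eventually_at_filter
    proof (intro always_eventually allI impI)
      fix s assume s: "s \<in> S"
      have "X s - X t = (X s o\<^sub>L ((id_blinfun + H t) o\<^sub>L X t)) - ((X s o\<^sub>L (id_blinfun + H s)) o\<^sub>L X t)"
        unfolding X(1)[OF t] X(2)[OF s] by (rule blinfun_eqI) (simp add: blinfun.diff_left)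
      also have "\<dots> = X s o\<^sub>L ((H t - H s) o\<^sub>L X t)"
        by (rule blinfun_eqI) (simp add: blinfun.bilinear_simps)
      finally have "norm (X s - X t) \<le> norm (X s) * (norm (H t - H s) * norm (X t))"
        using norm_blinfun_compose[of "X s" "(H t - H s) o\<^sub>L X t"]
          mult_left_mono[OF norm_blinfun_compose[of "H t - H s" "X t"], of "norm (X s)"] by simp
      also have "\<dots> \<le> 2 * (norm (H t - H s) * 2)"
        by (intro mult_mono X(3) s t) auto
      finally show "norm (X s - X t) \<le> 4 * norm (H t - H s)" by simp
    qed
    have "((\<lambda>s. H t - H s) \<longlongrightarrow> H t - H t) (at t within S)"
      using H t unfolding continuous_on_def by (intro tendsto_intros) auto
    then show "((\<lambda>s. 4 * norm (H t - H s)) \<longlongrightarrow> 0) (at t within S)"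
      by (intro tendsto_mult_right_zero tendsto_norm_zero) simp
  qed
  then show "(X \<longlongrightarrow> X t) (at t within S)" by (rule LIM_zero_cancel)
qed

section \<open>Scalar multiples of operators, restricted operator norms and inversion of a reduced
  family\<close>

context normed_space_over
begin

text \<open>The type of bounded operators is a vector space over the reals only. Multiplying an
  operator by a scalar of the field is written as composition with this operator.\<close>

definition scale_op :: "'k \<Rightarrow> 'a \<Rightarrow>\<^sub>L 'a" where "scale_op c = Blinfun (scale c)"

lemma scale_op_apply [simp]: "blinfun_apply (scale_op c) x = scale c x"
  unfolding scale_op_def
  by (subst bounded_linear_Blinfun_apply)
     (auto intro: bounded_bilinear.bounded_linear_right[OF bounded_bilinear_scale])

lemma bounded_linear_scale_op: "bounded_linear scale_op"
proof (rule bounded_linear_intro[of _ 1])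
  show "scale_op (a + b) = scale_op a + scale_op b" for a b
    by (rule blinfun_eqI) (simp add: blinfun.add_left scale_left_distrib)
  show "scale_op (r *\<^sub>R a) = r *\<^sub>R scale_op a" for r a
    by (rule blinfun_eqI)
      (simp add: blinfun.scaleR_left bounded_bilinear.scaleR_left[OF bounded_bilinear_scale])
  show "norm (scale_op a) \<le> norm a * 1" for a
    by (rule norm_blinfun_bound) (auto simp: norm_scale)
qed

lemma continuous_on_scale_op [continuous_intros]:
  "continuous_on S f \<Longrightarrow> continuous_on S (\<lambda>t. scale_op (f t))"
  by (rule bounded_linear.continuous_on[OF bounded_linear_scale_op])

end

text \<open>The quotient at 0 is 0 by the convention for division. This member of the family yields
  the lower bound, also when \<open>U\<close> is trivial.\<close>

lemma onorm_on_le: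
  assumes "\<And>x. x \<in> U \<Longrightarrow> norm (T x) \<le> C * norm x" "0 \<in> U" "0 \<le> C"
  shows "0 \<le> onorm_on U T" "onorm_on U T \<le> C"
proof -
  have le: "norm (T x) / norm x \<le> C" if "x \<in> U" for x
    using assms(1)[OF that] assms(3) by (cases "x = 0") (auto simp: divide_simps)
  then have bdd: "bdd_above ((\<lambda>x. norm (T x) / norm x) ` U)" by (auto intro!: bdd_aboveI2)
  show "0 \<le> onorm_on U T" unfolding onorm_on_def
    using cSUP_upper[OF assms(2) bdd] by simp
  show "onorm_on U T \<le> C" unfolding onorm_on_def
    by (rule cSUP_least) (use assms le in auto)
qed

text \<open>Restricting to \<open>V\<close> can only decrease the operator norm, so continuity of
  the globally defined family suffices.\<close>

lemma continuous_op_family_blinfun: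
  fixes Q :: "'k::real_normed_field \<Rightarrow> 'a::real_normed_vector \<Rightarrow>\<^sub>L 'b::real_normed_vector"
  assumes Q: "continuous_on S Q" and lin: "\<And>t c x. t \<in> S \<Longrightarrow> Q t (sX c x) = sY c (Q t x)" and V: "0 \<in> V"
  shows "continuous_op_family sX sY S V (\<lambda>t. blinfun_apply (Q t))"
  unfolding continuous_op_family_def
proof (intro conjI ballI)
  fix t assume t: "t \<in> S"
  show "bounded_op_on sX sY V (blinfun_apply (Q t))"
    by (rule bounded_op_onI[where C = "norm (Q t)"]) (auto simp: lin t blinfun.add_right norm_blinfun)
  have "((\<lambda>s. Q s - Q t) \<longlongrightarrow> Q t - Q t) (at t within S)"
    using Q t unfolding continuous_on_def by (intro tendsto_intros) auto
  then have "((\<lambda>s. norm (Q s - Q t)) \<longlongrightarrow> 0) (at t within S)" by (simp add: tendsto_norm_zero)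
  then show "((\<lambda>s. onorm_on V (\<lambda>v. Q s v - Q t v)) \<longlongrightarrow> 0) (at t within S)"
  proof (rule Lim_null_comparison[rotated])
    have *: "norm (Q s v - Q t v) \<le> norm (Q s - Q t) * norm v" for s v
      using norm_blinfun[of "Q s - Q t" v] by (simp add: blinfun.diff_left)
    show "\<forall>\<^sub>F s in at t within S. norm (onorm_on V (\<lambda>v. Q s v - Q t v)) \<le> norm (Q s - Q t)"
      using onorm_on_le[OF * V norm_ge_zero] by simp
  qed
qed

lemma GL_on_inverse:
  assumes T: "bounded_op_on sX sY U T" and J: "bounded_op_on sY sX UNIV J"
    and JU: "\<And>y. J y \<in> U" and TJ: "\<And>y. T (J y) = y" and JT: "\<And>x. x \<in> U \<Longrightarrow> J (T x) = x"
  shows "GL_on sX sY U UNIV T" "the_inv_into U T = J"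
proof -
  have inj: "inj_on T U" using JT by (rule inj_on_inverseI)
  show inv: "the_inv_into U T = J"
    by (rule ext) (rule the_inv_into_f_eq[OF inj TJ JU])
  have "bij_betw T U UNIV" by (rule bij_betw_byWitness[where f' = J]) (use JU TJ JT in auto)
  then show "GL_on sX sY U UNIV T" using T J inv unfolding GL_on_def by simp
qed

lemma continuous_on_ball_near:
  fixes f :: "'a::real_normed_vector \<Rightarrow> 'b::real_normed_vector"
  assumes "continuous_on (ball 0 \<delta>) f" "0 < \<delta>" "0 < r"
  obtains d where "d > 0" "\<And>t. norm t < \<delta> \<Longrightarrow> norm t < d \<Longrightarrow> norm (f t - f 0) < r"
proof -
  have "0 \<in> ball 0 \<delta>" using assms(2) by simp
  then obtain d where "d > 0" "\<forall>t\<in>ball 0 \<delta>. dist t 0 < d \<longrightarrow> dist (f t) (f 0) < r"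
    using assms(1,3) unfolding continuous_on_iff by blast
  then show ?thesis by (intro that[of d]) (auto simp: dist_norm)
qed

text \<open>Since \<open>D\<^sub>0\<close> \<open>K\<close> = id, the factorization gives L A K =
  \<epsilon>^k (id + \<epsilon> \<open>D\<^sub>1\<close> \<open>K\<close>), and the bracket is
  invertible for small \<epsilon>. On \<open>V\<close>, where \<open>D\<^sub>0\<close> vanishes, the
  defect \<epsilon>^(k+1) \<open>D\<^sub>1\<close> v is removed by subtracting \<epsilon> K X
  \<open>D\<^sub>1\<close> v from v before applying \<open>A\<close>.\<close>

lemma reduced_family_inversion:
  fixes sB :: "'k::real_or_complex \<Rightarrow> 'b::banach \<Rightarrow> 'b" and sC :: "'k \<Rightarrow> 'c::banach \<Rightarrow> 'c"
    and L D\<^sub>1 :: "'k \<Rightarrow> 'b \<Rightarrow>\<^sub>L 'c" and A A\<^sub>1 :: "'k \<Rightarrow> 'b \<Rightarrow>\<^sub>L 'b" and D\<^sub>0 :: "'b \<Rightarrow>\<^sub>L 'c" and K :: "'c \<Rightarrow>\<^sub>L 'b"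
  assumes sB: "normed_space_over sB" and sC: "normed_space_over sC" and \<delta>0: "0 < \<delta>0"
    and U: "module.subspace sB U" and V: "0 \<in> V"
    and L_lin: "\<And>\<epsilon> c x. norm \<epsilon> < \<delta>0 \<Longrightarrow> L \<epsilon> (sB c x) = sC c (L \<epsilon> x)"
    and D1_lin: "\<And>\<epsilon> c x. norm \<epsilon> < \<delta>0 \<Longrightarrow> D\<^sub>1 \<epsilon> (sB c x) = sC c (D\<^sub>1 \<epsilon> x)"
    and A_lin: "\<And>\<epsilon> c x. A \<epsilon> (sB c x) = sB c (A \<epsilon> x)"
    and A1_lin: "\<And>\<epsilon> c x. A\<^sub>1 \<epsilon> (sB c x) = sB c (A\<^sub>1 \<epsilon> x)"
    and K_lin: "\<And>c y. K (sC c y) = sB c (K y)"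
    and D0_lin: "\<And>c x. D\<^sub>0 (sB c x) = sC c (D\<^sub>0 x)"
    and cont: "continuous_on (ball 0 \<delta>0) D\<^sub>1" "continuous_on UNIV A" "continuous_on UNIV A\<^sub>1"
    and LA: "\<And>\<epsilon> x. norm \<epsilon> < \<delta>0 \<Longrightarrow> L \<epsilon> (A \<epsilon> x) = sC (\<epsilon> ^ k) (D\<^sub>0 x + sC \<epsilon> (D\<^sub>1 \<epsilon> x))"
    and DK: "\<And>y. D\<^sub>0 (K y) = y" and KU: "\<And>y. K y \<in> U" and KD: "\<And>u. u \<in> U \<Longrightarrow> K (D\<^sub>0 u) = u"
    and AU: "\<And>\<epsilon> u. u \<in> U \<Longrightarrow> A \<epsilon> u \<in> U"
    and A_onto: "\<And>\<epsilon> u. \<epsilon> \<noteq> 0 \<Longrightarrow> u \<in> U \<Longrightarrow> \<exists>w\<in>U. A \<epsilon> w = u"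
    and DV: "\<And>v. v \<in> V \<Longrightarrow> D\<^sub>0 v = 0"
    and AV: "\<And>\<epsilon> v. v \<in> V \<Longrightarrow> A \<epsilon> v = v + sB \<epsilon> (A\<^sub>1 \<epsilon> v)"
  shows "\<exists>\<delta>1 c. 0 < \<delta>1 \<and> \<delta>1 \<le> \<delta>0 \<and>
    (\<forall>\<epsilon>. 0 < norm \<epsilon> \<and> norm \<epsilon> < \<delta>1 \<longrightarrow>
      GL_on sB sC U UNIV (L \<epsilon>) \<and> (\<forall>y. norm (the_inv_into U (L \<epsilon>) y) \<le> c / norm \<epsilon> ^ k * norm y)) \<and>
    (\<exists>Q. continuous_op_family sB sB (ball 0 \<delta>1) V Q \<and>
      (\<forall>\<epsilon>\<in>ball 0 \<delta>1. \<forall>v\<in>V. L \<epsilon> (v + sB \<epsilon> (Q \<epsilon> v)) = 0))"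
proof -
  interpret B: normed_space_over sB by (fact sB)
  interpret C: normed_space_over sC by (fact sC)
  define H where "H \<epsilon> = C.scale_op \<epsilon> o\<^sub>L (D\<^sub>1 \<epsilon> o\<^sub>L K)" for \<epsilon>
  have contH: "continuous_on (ball 0 \<delta>0) H" unfolding H_def
    by (intro continuous_intros C.continuous_on_scale_op cont)
  have "H 0 = 0" unfolding H_def by (rule blinfun_eqI) simp
  obtain d1 where d1: "d1 > 0" "\<And>t. norm t < \<delta>0 \<Longrightarrow> norm t < d1 \<Longrightarrow> norm (H t) < 1/2"
    using continuous_on_ball_near[OF contH \<delta>0, of "1/2"] \<open>H 0 = 0\<close> by (metis diff_zero half_gt_zero_iff zero_less_one)
  have "continuous_on (ball 0 \<delta>0) A" using cont(2) continuous_on_subset by blast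
  from continuous_on_ball_near[OF this \<delta>0 zero_less_one]
  obtain d2 where d2: "d2 > 0" "\<And>t. norm t < \<delta>0 \<Longrightarrow> norm t < d2 \<Longrightarrow> norm (A t - A 0) < 1"
    by blast
  \<comment> \<open>\<open>d1\<close> keeps \<open>H\<close> below 1/2, so that it can be inverted;
    \<open>d2\<close> keeps \<open>A\<close> within distance 1 of \<open>A 0\<close>, so that the
    constant \<open>c\<close> below is independent of \<epsilon>.\<close>
  define \<delta>1 where "\<delta>1 = min \<delta>0 (min d1 d2)"
  have \<delta>1: "\<delta>1 > 0" "\<delta>1 \<le> \<delta>0" "\<delta>1 \<le> d1" "\<delta>1 \<le> d2" using d1 d2 \<delta>0 by (auto simp: \<delta>1_def)
  have "\<forall>\<epsilon>\<in>ball 0 \<delta>1. \<exists>X. (id_blinfun + H \<epsilon>) o\<^sub>L X = id_blinfun \<and> X o\<^sub>L (id_blinfun + H \<epsilon>) = id_blinfun \<and> norm X \<le> 2"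
    using d1(2) \<delta>1 by (intro ballI neumann_inverse) (auto intro!: less_imp_le)
  then obtain X where X0: "\<And>\<epsilon>. \<epsilon> \<in> ball 0 \<delta>1 \<Longrightarrow> (id_blinfun + H \<epsilon>) o\<^sub>L X \<epsilon> = id_blinfun"
     "\<And>\<epsilon>. \<epsilon> \<in> ball 0 \<delta>1 \<Longrightarrow> X \<epsilon> o\<^sub>L (id_blinfun + H \<epsilon>) = id_blinfun" "\<And>\<epsilon>. \<epsilon> \<in> ball 0 \<delta>1 \<Longrightarrow> norm (X \<epsilon>) \<le> 2"
    by metis
  have contX: "continuous_on (ball 0 \<delta>1) X"
    by (rule continuous_on_neumann_inverse[of _ H])
      (use X0 \<delta>1 in \<open>auto intro: continuous_on_subset[OF contH]\<close>)
  have X1: "X \<epsilon> y + sC \<epsilon> (D\<^sub>1 \<epsilon> (K (X \<epsilon> y))) = y" and X2: "X \<epsilon> (y + sC \<epsilon> (D\<^sub>1 \<epsilon> (K y))) = y"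
    if "norm \<epsilon> < \<delta>1" for \<epsilon> y
    using arg_cong[OF X0(1)[of \<epsilon>], of "\<lambda>T. blinfun_apply T y"] arg_cong[OF X0(2)[of \<epsilon>], of "\<lambda>T. blinfun_apply T y"] that
    by (auto simp: H_def blinfun.add_left)
  have X_lin: "X \<epsilon> (sC c y) = sC c (X \<epsilon> y)" if e: "norm \<epsilon> < \<delta>1" for \<epsilon> c y
  proof -
    have e0: "norm \<epsilon> < \<delta>0" using e \<delta>1 by simp
    have "X \<epsilon> (sC c (X \<epsilon> y) + sC \<epsilon> (D\<^sub>1 \<epsilon> (K (sC c (X \<epsilon> y))))) = sC c (X \<epsilon> y)" by (rule X2[OF e])
    moreover have "sC c (X \<epsilon> y) + sC \<epsilon> (D\<^sub>1 \<epsilon> (K (sC c (X \<epsilon> y)))) = sC c (X \<epsilon> y + sC \<epsilon> (D\<^sub>1 \<epsilon> (K (X \<epsilon> y))))"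
      by (simp only: K_lin D1_lin[OF e0] C.scale_right_distrib C.scale_left_commute)
    ultimately show ?thesis using X1[OF e] by simp
  qed
  define J where "J \<epsilon> y = sB (inverse (\<epsilon> ^ k)) (A \<epsilon> (K (X \<epsilon> y)))" for \<epsilon> y
  \<comment> \<open>The three factors bound \<open>A \<epsilon>\<close>, \<open>K\<close> and
    \<open>X \<epsilon>\<close>.\<close>
  define c where "c = (norm (A 0) + 1) * (norm K * 2)"
  have LJ: "L \<epsilon> (J \<epsilon> y) = y" if "0 < norm \<epsilon>" "norm \<epsilon> < \<delta>1" for \<epsilon> y
    using that \<delta>1 by (simp add: J_def L_lin LA DK X1)
  have JL: "J \<epsilon> (L \<epsilon> u) = u" if e: "0 < norm \<epsilon>" "norm \<epsilon> < \<delta>1" and u: "u \<in> U" for \<epsilon> u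
  proof -
    \<comment> \<open>Writing u = A w reduces J L u to the factorization: L u = \<epsilon>^k (id +
      H) \<open>D\<^sub>0\<close> w, and applying X, K and A in turn leads back to A w.\<close>
    obtain w where w: "w \<in> U" "A \<epsilon> w = u" using A_onto[OF _ u, of \<epsilon>] e by auto
    have "L \<epsilon> u = sC (\<epsilon> ^ k) (D\<^sub>0 w + sC \<epsilon> (D\<^sub>1 \<epsilon> (K (D\<^sub>0 w))))"
      using LA[of \<epsilon> w] w e \<delta>1 KD by simp
    then have "X \<epsilon> (L \<epsilon> u) = sC (\<epsilon> ^ k) (D\<^sub>0 w)" using X2[OF e(2)] X_lin[OF e(2)] by simp
    then show ?thesis using e w by (simp add: J_def K_lin KD A_lin)
  qed
  have JU: "J \<epsilon> y \<in> U" for \<epsilon> y unfolding J_def by (intro B.subspace_scale U AU KU)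
  have nJ: "norm (J \<epsilon> y) \<le> c / norm \<epsilon> ^ k * norm y" if e: "norm \<epsilon> < \<delta>1" for \<epsilon> y
  proof -
    have "norm (A \<epsilon>) \<le> norm (A 0) + 1"
      using d2(2)[of \<epsilon>] e \<delta>1 norm_triangle_sub[of "A \<epsilon>" "A 0"] by simp
    then have "norm (A \<epsilon>) * (norm K * norm (X \<epsilon>)) \<le> c" unfolding c_def
      using X0(3)[of \<epsilon>] e by (intro mult_mono) auto
    moreover have "norm (A \<epsilon> (K (X \<epsilon> y))) \<le> norm (A \<epsilon>) * (norm K * (norm (X \<epsilon>) * norm y))"
      by (intro order_trans[OF norm_blinfun] mult_left_mono) auto
    ultimately have "norm (A \<epsilon> (K (X \<epsilon> y))) \<le> c * norm y"
      by (smt (verit, best) mult.assoc mult_right_mono norm_ge_zero)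
    then have "norm (A \<epsilon> (K (X \<epsilon> y))) / norm \<epsilon> ^ k \<le> c * norm y / norm \<epsilon> ^ k"
      by (rule divide_right_mono) simp
    then show ?thesis
      by (simp add: J_def B.norm_scale norm_inverse norm_power divide_inverse mult_ac)
  qed
  have GL: "GL_on sB sC U UNIV (L \<epsilon>)" "the_inv_into U (L \<epsilon>) = J \<epsilon>" if e: "0 < norm \<epsilon>" "norm \<epsilon> < \<delta>1" for \<epsilon>
  proof -
    have e0: "norm \<epsilon> < \<delta>0" using e \<delta>1 by simp
    have 1: "bounded_op_on sB sC U (L \<epsilon>)"
      by (rule bounded_op_onI[where C = "norm (L \<epsilon>)"]) (auto simp: L_lin[OF e0] blinfun.add_right norm_blinfun)
    have 2: "bounded_op_on sC sB UNIV (J \<epsilon>)"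
    proof (rule bounded_op_onI)
      show "J \<epsilon> (y + z) = J \<epsilon> y + J \<epsilon> z" for y z
        by (simp add: J_def blinfun.add_right B.scale_right_distrib)
      show "J \<epsilon> (sC b y) = sB b (J \<epsilon> y)" for b y
        by (simp add: J_def X_lin[OF e(2)] K_lin A_lin mult.commute)
      show "norm (J \<epsilon> y) \<le> c / norm \<epsilon> ^ k * norm y" for y by (rule nJ[OF e(2)])
    qed
    show "GL_on sB sC U UNIV (L \<epsilon>)"
      by (rule GL_on_inverse[OF 1 2]) (use LJ JL JU e in auto)
    show "the_inv_into U (L \<epsilon>) = J \<epsilon>"
      by (rule GL_on_inverse(2)[OF 1 2]) (use LJ JL JU e in auto)
  qed
  \<comment> \<open>Read off from v + \<epsilon> Q v = A (v - \<epsilon> K X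
    \<open>D\<^sub>1\<close> v), where A v = v + \<epsilon> \<open>A\<^sub>1\<close> v on
    \<open>V\<close>.\<close>
  define Q where "Q \<epsilon> = A\<^sub>1 \<epsilon> - (A \<epsilon> o\<^sub>L (K o\<^sub>L (X \<epsilon> o\<^sub>L D\<^sub>1 \<epsilon>)))" for \<epsilon>
  have "continuous_on (ball 0 \<delta>1) Q" unfolding Q_def
    using \<delta>1 by (intro continuous_intros contX continuous_on_subset[OF cont(1)]
      continuous_on_subset[OF cont(2)] continuous_on_subset[OF cont(3)]) auto
  moreover have "Q \<epsilon> (sB c x) = sB c (Q \<epsilon> x)" if "\<epsilon> \<in> ball 0 \<delta>1" for \<epsilon> c x
    using that \<delta>1 by (simp add: Q_def blinfun.diff_left A1_lin D1_lin X_lin K_lin A_lin B.scale_right_diff_distrib)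
  ultimately have contQ: "continuous_op_family sB sB (ball 0 \<delta>1) V (\<lambda>t. blinfun_apply (Q t))"
    by (intro continuous_op_family_blinfun V)
  have "L \<epsilon> (v + sB \<epsilon> (Q \<epsilon> v)) = 0" if e: "\<epsilon> \<in> ball 0 \<delta>1" and v: "v \<in> V" for \<epsilon> v
  proof -
    have e1: "norm \<epsilon> < \<delta>1" and e0: "norm \<epsilon> < \<delta>0" using e \<delta>1 by auto
    define y where "y = D\<^sub>1 \<epsilon> v"
    have "v + sB \<epsilon> (Q \<epsilon> v) = A \<epsilon> (v - sB \<epsilon> (K (X \<epsilon> y)))"
      by (simp add: Q_def y_def blinfun.diff_left blinfun.diff_right AV[OF v] A_lin B.scale_right_diff_distrib)
    then have "L \<epsilon> (v + sB \<epsilon> (Q \<epsilon> v)) = sC (\<epsilon> ^ k) (D\<^sub>0 (v - sB \<epsilon> (K (X \<epsilon> y))) + sC \<epsilon> (D\<^sub>1 \<epsilon> (v - sB \<epsilon> (K (X \<epsilon> y)))))"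
      using LA[OF e0] by simp
    also have "D\<^sub>0 (v - sB \<epsilon> (K (X \<epsilon> y))) + sC \<epsilon> (D\<^sub>1 \<epsilon> (v - sB \<epsilon> (K (X \<epsilon> y))))
       = sC \<epsilon> y - sC \<epsilon> (X \<epsilon> y + sC \<epsilon> (D\<^sub>1 \<epsilon> (K (X \<epsilon> y))))"
      by (simp add: blinfun.diff_right DV[OF v] D0_lin D1_lin[OF e0] DK y_def C.scale_right_diff_distrib
          C.scale_right_distrib del: C.scale_scale)
    also have "\<dots> = 0" using X1[OF e1] by simp
    finally show ?thesis by simp
  qed
  then show ?thesis using \<delta>1 GL nJ contQ
    by (intro exI[of _ \<delta>1] exI[of _ c] conjI allI impI exI[of _ "\<lambda>t. blinfun_apply (Q t)"]) auto
qed

section \<open>Jordan chains of the operator family\<close>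

text \<open>If \<open>e\<close> is the matrix \<open>E\<close> up to scaling and \<open>J\<close> is the shift \<open>(J x)\<^sub>i = x\<^bsub>i+1\<^esub>\<close>, then \<open>chain_coeff e r s\<close>
  is the entry \<open>(1, s)\<close> of \<open>e (J e)\<^bsup>r-1\<^esup>\<close>. These are the entries of the matrices \<open>M\<close> of the fine
  resolution without the factorials.\<close>

primrec chain_coeff :: "(nat \<Rightarrow> nat \<Rightarrow> 'b \<Rightarrow> 'b::real_vector) \<Rightarrow> nat \<Rightarrow> nat \<Rightarrow> 'b \<Rightarrow> 'b"
  where
    "chain_coeff e 0 s x = 0"
  | "chain_coeff e (Suc r) s x =
      (if r = 0 then e 1 s x else \<Sum>t=r..<s. chain_coeff e r t (e (Suc t) s x))"

lemma bounded_op_chain_coeff: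
  assumes sB: "normed_space_over sB"
    and e: "\<And>i j. 1 \<le> i \<Longrightarrow> i \<le> j \<Longrightarrow> j \<le> m \<Longrightarrow> bounded_op_on sB sB UNIV (e i j)"
  shows "r \<le> s \<Longrightarrow> s \<le> m \<Longrightarrow> bounded_op_on sB sB UNIV (chain_coeff e r s)"
proof (induction r arbitrary: s)
  case 0
  have "chain_coeff e 0 s = (\<lambda>x. 0)" by (rule ext) simp
  then show ?case using bounded_op_on_zero[OF sB sB] by simp
next
  case (Suc r)
  show ?case
  proof (cases "r = 0")
    case True
    then have "chain_coeff e (Suc r) s = e 1 s" by (intro ext) simp
    then show ?thesis using e[of 1 s] Suc by simp
  next
    case False
    have "bounded_op_on sB sB UNIV (\<lambda>x. \<Sum>t=r..<s. chain_coeff e r t (e (Suc t) s x))"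
    proof (rule bounded_op_on_sum[OF sB sB])
      fix t assume t: "t \<in> {r..<s}"
      show "bounded_op_on sB sB UNIV (\<lambda>x. chain_coeff e r t (e (Suc t) s x))"
        by (rule bounded_op_on_compose_UNIV[OF Suc.IH e]) (use t Suc in auto)
    qed
    moreover have "chain_coeff e (Suc r) s = (\<lambda>x. \<Sum>t=r..<s. chain_coeff e r t (e (Suc t) s x))"
      using False by (intro ext) simp
    ultimately show ?thesis by simp
  qed
qed

lemma chain_coeff_diag:
  assumes "\<And>j x. 1 \<le> j \<Longrightarrow> j \<le> m \<Longrightarrow> e j j x = x"
  shows "1 \<le> s \<Longrightarrow> s \<le> m \<Longrightarrow> chain_coeff e s s x = x"
proof (induction s)
  case (Suc s)
  then show ?case by (cases "s = 0") (auto simp: assms)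
qed simp

text \<open>Each application of the shift raises the smallest column that can be reached by
  one.\<close>

lemma chain_coeff_eq_0: "1 \<le> t \<Longrightarrow> t < r \<Longrightarrow> chain_coeff e r t x = 0"
  by (cases r) auto

lemma sum_triangle_swap:
  fixes F :: "nat \<Rightarrow> nat \<Rightarrow> 'a::comm_monoid_add"
  assumes "1 \<le> s" "s \<le> k + 1"
  shows "(\<Sum>i\<le>k. \<Sum>d=1..s - i. F i d) = (\<Sum>d=1..s. \<Sum>i\<le>s - d. F i d)"
proof -
  have "(\<Sum>(i, d)\<in>(SIGMA i:{..k}. {1..s - i}). F i d) = (\<Sum>(d, i)\<in>(SIGMA d:{1..s}. {..s - d}). F i d)"
    by (rule sum.reindex_bij_witness[of _ "\<lambda>(d, i). (i, d)" "\<lambda>(i, d). (d, i)"]) (use assms in auto)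
  then show ?thesis by (simp add: sum.Sigma)
qed

text \<open>Everything the inversion uses of a fine resolution: \<open>T\<close> are Taylor
  coefficients of the family, \<open>e\<close> and \<open>\<sigma>\<close> the rescaled
  \<open>E\<close> and \<open>S_op\<close>, and \<open>K\<close> inverts the sum of the
  \<open>\<sigma> i\<close> on the sum of the \<open>Nc i\<close>. The assumption
  \<open>\<sigma>_eq\<close> is the only link between \<open>T\<close> and
  \<open>\<sigma>\<close>.\<close>

locale operator_chain = B: nested_sums sB Nc N "k + 1" + C: normed_space_over sC
  for sB :: "'k::real_or_complex \<Rightarrow> 'b::banach \<Rightarrow> 'b" and sC :: "'k \<Rightarrow> 'c::banach \<Rightarrow> 'c"
    and Nc N :: "nat \<Rightarrow> 'b set" and k :: nat +
  fixes T :: "nat \<Rightarrow> 'b \<Rightarrow> 'c" and e :: "nat \<Rightarrow> nat \<Rightarrow> 'b \<Rightarrow> 'b" and \<sigma> :: "nat \<Rightarrow> 'b \<Rightarrow> 'c" and K :: "'c \<Rightarrow> 'b"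
  assumes T_op: "\<And>i. i \<le> k \<Longrightarrow> bounded_op_on sB sC UNIV (T i)"
    and e_op: "\<And>i j. 1 \<le> i \<Longrightarrow> i \<le> j \<Longrightarrow> j \<le> k + 1 \<Longrightarrow> bounded_op_on sB sB UNIV (e i j)"
    and e_diag: "\<And>j x. 1 \<le> j \<Longrightarrow> j \<le> k + 1 \<Longrightarrow> e j j x = x"
    and e_in: "\<And>i j x. 1 \<le> i \<Longrightarrow> i < j \<Longrightarrow> j \<le> k + 1 \<Longrightarrow> e i j x \<in> Nc i"
    and \<sigma>_op: "\<And>i. 1 \<le> i \<Longrightarrow> i \<le> k + 1 \<Longrightarrow> bounded_op_on sB sC UNIV (\<sigma> i)"
    and \<sigma>_eq: "\<And>j x. 1 \<le> j \<Longrightarrow> j \<le> k + 1 \<Longrightarrow> x \<in> N (j - 1) \<Longrightarrow>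
      T 0 (e 1 j x) + (\<Sum>v=1..<j. \<Sum>r=1..v. T r (chain_coeff e r v (e (Suc v) j x))) = \<sigma> j x"
    and \<sigma>_zero: "\<And>j x. 1 \<le> j \<Longrightarrow> j \<le> k + 1 \<Longrightarrow> x \<in> N j \<Longrightarrow> \<sigma> j x = 0"
    and K_op: "bounded_op_on sC sB UNIV K"
    and K_in: "\<And>y. rest_proj Nc N (k + 1) (K y) = 0"
    and \<sigma>_K: "\<And>y. (\<Sum>i=1..k+1. \<sigma> i (summand_proj Nc N i (K y))) = y"
    and K_\<sigma>: "\<And>u. rest_proj Nc N (k + 1) u = 0 \<Longrightarrow> K (\<Sum>i=1..k+1. \<sigma> i (summand_proj Nc N i u)) = u"
begin

abbreviation "\<mu> \<equiv> chain_coeff e"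

text \<open>Allows the chain identities of the shorter columns to be applied to the vectors
  \<open>e i j x\<close> that the recursion produces.\<close>

lemma e_mem: "1 \<le> i \<Longrightarrow> i \<le> j \<Longrightarrow> j \<le> k + 1 \<Longrightarrow> x \<in> N (j - 1) \<Longrightarrow> e i j x \<in> N (i - 1)"
  using e_in[of i j x] B.Y_subset[of i "i - 1"] by (cases "i = j") (auto simp: e_diag)

lemma sBC: "normed_space_over sB" "normed_space_over sC"
  using B.normed_space_over_axioms C.normed_space_over_axioms by auto

lemma \<mu>_op: "r \<le> s \<Longrightarrow> s \<le> k + 1 \<Longrightarrow> bounded_op_on sB sB UNIV (\<mu> r s)"
  by (rule bounded_op_chain_coeff[OF sBC(1) e_op])

lemma T_sum: "i \<le> k \<Longrightarrow> T i (\<Sum>j\<in>I. f j) = (\<Sum>j\<in>I. T i (f j))"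
  by (rule bounded_op_on_sum_arg[OF sBC T_op]) auto

text \<open>Unfolding one level of \<open>chain_coeff\<close> and exchanging the sums lowers the
  shift from \<open>d + 1\<close> to \<open>d\<close>, at the price of passing to the columns
  \<open>t < s\<close>.\<close>

lemma chain_step:
  assumes "1 \<le> d" "d < s" "s \<le> k + 1"
  shows "(\<Sum>i\<le>s - Suc d. T i (\<mu> (i + Suc d) s x)) =
    (\<Sum>t=d..<s. \<Sum>i\<le>t - d. T i (\<mu> (i + d) t (e (Suc t) s x)))"
proof -
  have "(\<Sum>i\<le>s - Suc d. T i (\<mu> (i + Suc d) s x)) =
      (\<Sum>i\<le>s - Suc d. \<Sum>t=i+d..<s. T i (\<mu> (i + d) t (e (Suc t) s x)))"
    using assms by (intro sum.cong refl) (auto simp: T_sum)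
  also have "\<dots> = (\<Sum>t=d..<s. \<Sum>i\<le>t - d. T i (\<mu> (i + d) t (e (Suc t) s x)))"
    using assms
    by (simp add: sum.Sigma)
       (rule sum.reindex_bij_witness[of _ "\<lambda>(t, i). (i, t)" "\<lambda>(i, t). (t, i)"], auto)
  finally show ?thesis .
qed

text \<open>The sum is the coefficient of \<epsilon>^(s-1) in L(\<epsilon>) \<Phi>_s(\<epsilon>) x:
  the product of \<epsilon>^i and \<epsilon>^(s-r) has exponent s - d for r = i + d, here with d =
  1. After exchanging sums it is the left side of \<open>\<sigma>_eq\<close>.\<close>

lemma chain_first:
  assumes "1 \<le> s" "s \<le> k + 1" "x \<in> N (s - 1)"
  shows "(\<Sum>i\<le>s - 1. T i (\<mu> (Suc i) s x)) = \<sigma> s x"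
proof -
  have "(\<Sum>i\<le>s - 1. T i (\<mu> (Suc i) s x)) = T 0 (e 1 s x) + (\<Sum>i=1..s-1. T i (\<mu> (Suc i) s x))"
    by (simp add: atMost_atLeast0 sum.atLeast_Suc_atMost)
  also have "(\<Sum>i=1..s-1. T i (\<mu> (Suc i) s x)) = (\<Sum>i=1..s-1. \<Sum>t=i..<s. T i (\<mu> i t (e (Suc t) s x)))"
    using assms by (intro sum.cong refl) (auto simp: T_sum)
  also have "\<dots> = (\<Sum>t=1..<s. \<Sum>i=1..t. T i (\<mu> i t (e (Suc t) s x)))"
    by (simp add: sum.Sigma)
       (rule sum.reindex_bij_witness[of _ "\<lambda>(t, i). (i, t)" "\<lambda>(i, t). (t, i)"], auto)
  finally show ?thesis using \<sigma>_eq[OF assms] by simp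
qed

text \<open>These are the coefficients of \<epsilon>^(s-d) below the order s - 1 of the chain. The
  induction on \<open>d\<close> lowers the shift with \<open>chain_step\<close>; at d = 2 it arrives
  at \<open>chain_first\<close>.\<close>

lemma chain_zero:
  assumes "2 \<le> d" "d \<le> s" "s \<le> k + 1" "x \<in> N (s - 1)"
  shows "(\<Sum>i\<le>s - d. T i (\<mu> (i + d) s x)) = 0"
  using assms
proof (induction d arbitrary: s x rule: dec_induct)
  case base
  have "(\<Sum>i\<le>s - Suc 1. T i (\<mu> (i + Suc 1) s x)) = (\<Sum>t=1..<s. \<Sum>i\<le>t - 1. T i (\<mu> (i + 1) t (e (Suc t) s x)))"
    by (rule chain_step) (use base in auto)
  also have "\<dots> = 0"
  proof (rule sum.neutral, rule ballI)
    fix t assume t: "t \<in> {1..<s}"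
    have "e (Suc t) s x \<in> N (Suc t - 1)" by (rule e_mem) (use t base in auto)
    \<comment> \<open>The vector lies in \<open>N t\<close>, one level deeper than
      \<open>chain_first\<close> asks for, and there \<open>\<sigma> t\<close> vanishes.\<close>
    then have *: "e (Suc t) s x \<in> N t" by simp
    then have "e (Suc t) s x \<in> N (t - 1)" using B.X_antimono[of "t - 1" t] t base by auto
    then show "(\<Sum>i\<le>t - 1. T i (\<mu> (i + 1) t (e (Suc t) s x))) = 0"
      using chain_first[of t "e (Suc t) s x"] \<sigma>_zero[of t, OF _ _ *] t base by simp
  qed
  finally show ?case by (simp add: numeral_2_eq_2)
next
  case (step d)
  have "(\<Sum>i\<le>s - Suc d. T i (\<mu> (i + Suc d) s x)) = (\<Sum>t=d..<s. \<Sum>i\<le>t - d. T i (\<mu> (i + d) t (e (Suc t) s x)))"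
    by (rule chain_step) (use step in auto)
  also have "\<dots> = 0"
  proof (rule sum.neutral, rule ballI)
    fix t assume t: "t \<in> {d..<s}"
    have "e (Suc t) s x \<in> N (Suc t - 1)" by (rule e_mem) (use t step.prems step.hyps in auto)
    then have "e (Suc t) s x \<in> N (t - 1)" using B.X_antimono[of "t - 1" t] t step.prems by auto
    then show "(\<Sum>i\<le>t - d. T i (\<mu> (i + d) t (e (Suc t) s x))) = 0"
      by (intro step.IH) (use t step.prems in auto)
  qed
  finally show ?case .
qed

section \<open>Block triangularity and the weighted operators\<close>

lemma chain_diag: "1 \<le> s \<Longrightarrow> s \<le> k + 1 \<Longrightarrow> \<mu> s s x = x"
  by (rule chain_coeff_diag[OF e_diag])

text \<open>This is the sum of \<open>Nc 1\<close>, ..., \<open>Nc j\<close>. As the kernel of a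
  bounded projection it is closed without further argument, which matters for
  \<open>U = ker (k + 1)\<close>.\<close>

definition ker :: "nat \<Rightarrow> 'b set" where "ker j = {x. rest_proj Nc N j x = 0}"

lemma subspace_ker: assumes "j \<le> k + 1" shows "B.subspace (ker j)"
proof (rule B.subspaceI)
  note op = B.bounded_op_rest_proj[OF assms]
  show "0 \<in> ker j" using bounded_op_on_zero_arg[OF sBC(1) sBC(1) op] by (simp add: ker_def)
  show "x + y \<in> ker j" if "x \<in> ker j" "y \<in> ker j" for x y
    using that bounded_op_on_add[OF op] by (simp add: ker_def)
  show "sB c x \<in> ker j" if "x \<in> ker j" for c x
    using that bounded_op_on_scale[OF op] by (simp add: ker_def)
qed

lemma ker_mono: "i \<le> j \<Longrightarrow> j \<le> k + 1 \<Longrightarrow> ker i \<subseteq> ker j"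
  using B.rest_proj_zero_mono by (auto simp: ker_def)

lemma Nc_ker: "1 \<le> i \<Longrightarrow> i \<le> j \<Longrightarrow> j \<le> k + 1 \<Longrightarrow> Nc i \<subseteq> ker j"
  using B.rest_proj_summand[of i j] B.rest_proj_id[of "i - 1"] B.Y_subset[of i "i - 1"] by (auto simp: ker_def)

text \<open>In the recursion the terms with t > r stay in \<open>ker r\<close> by induction. The
  term t = r is \<open>e (Suc r) s x\<close> itself, which adds only a component in
  \<open>Nc (Suc r)\<close>.\<close>

lemma chain_ker: "1 \<le> r \<Longrightarrow> r < s \<Longrightarrow> s \<le> k + 1 \<Longrightarrow> \<mu> r s x \<in> ker r"
proof (induction r arbitrary: s x)
  case (Suc r)
  show ?case
  proof (cases "r = 0")
    case True
    then show ?thesis using e_in[of 1 s x] Nc_ker[of 1 1] Suc by auto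
  next
    case False
    have "(\<Sum>t=r..<s. \<mu> r t (e (Suc t) s x)) \<in> ker (Suc r)"
    proof (rule B.subspace_sum[OF subspace_ker])
      fix t assume t: "t \<in> {r..<s}"
      show "\<mu> r t (e (Suc t) s x) \<in> ker (Suc r)"
      proof (cases "t = r")
        case True
        then show ?thesis using chain_diag[of r] False Suc e_in[of "Suc r" s x] Nc_ker[of "Suc r" "Suc r"] by auto
      next
        case False
        then have "\<mu> r t (e (Suc t) s x) \<in> ker r" using Suc t \<open>r \<noteq> 0\<close> by (intro Suc.IH) auto
        then show ?thesis using ker_mono[of r "Suc r"] Suc by auto
      qed
    qed (use Suc in auto)
    then show ?thesis using False by simp
  qed
qed simp

text \<open>The last summand keeps the whole of \<open>N k = N\<^sup>c\<^sub>k\<^sub>+\<^sub>1 \<oplus> N\<^sub>k\<^sub>+\<^sub>1\<close>.\<close>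

definition pr :: "nat \<Rightarrow> 'b \<Rightarrow> 'b"
  where "pr s = (if s = k + 1 then rest_proj Nc N k else summand_proj Nc N s)"

lemma pr_op: "1 \<le> s \<Longrightarrow> s \<le> k + 1 \<Longrightarrow> bounded_op_on sB sB UNIV (pr s)"
  using B.bounded_op_rest_proj[of k] B.bounded_op_summand_proj[of s] by (auto simp: pr_def)

lemma pr_in: "1 \<le> s \<Longrightarrow> s \<le> k + 1 \<Longrightarrow> pr s x \<in> N (s - 1)"
  using B.rest_proj_in[of k x] B.summand_proj_in[of s x] B.Y_subset[of s "s - 1"] by (auto simp: pr_def)

lemma rest_proj_split: "j \<le> k \<Longrightarrow> rest_proj Nc N j x = summand_proj Nc N (Suc j) x + rest_proj Nc N (Suc j) x"
  using proj_decomp[OF B.dsum[of "Suc j"] B.module_scale, of "rest_proj Nc N j x"] B.rest_proj_in[of j x]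
  by (simp add: summand_proj_def)

lemma pr_ker: "x \<in> ker (k + 1) \<Longrightarrow> pr s x = summand_proj Nc N s x"
  using rest_proj_split[of k x] by (simp add: pr_def ker_def del: rest_proj.simps)

lemma pr_last: "1 \<le> s \<Longrightarrow> s \<le> k + 1 \<Longrightarrow> v \<in> N (k + 1) \<Longrightarrow> pr s v = (if s = k + 1 then v else 0)"
  using B.summand_proj_rest[of s "k + 1" v] B.rest_proj_id[of k v] B.X_antimono[of k "k + 1"] by (auto simp: pr_def)

text \<open>The exponent k + 1 - r combines s - r from the chain \<Phi>_s with the weight k + 1 - s,
  which lifts every chain from its own order s - 1 to the common order k.\<close>

definition A :: "'k \<Rightarrow> 'b \<Rightarrow>\<^sub>L 'b"
  where "A \<epsilon> = (\<Sum>s=1..k+1. \<Sum>r=1..s. B.scale_op (\<epsilon> ^ (k + 1 - r)) o\<^sub>L (Blinfun (\<mu> r s) o\<^sub>L Blinfun (pr s)))"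

lemma Blinfun_op: "bounded_op_on sB sB UNIV f \<Longrightarrow> blinfun_apply (Blinfun f) = f"
  "bounded_op_on sB sC UNIV g \<Longrightarrow> blinfun_apply (Blinfun g) = g"
  using bounded_op_UNIV_bounded_linear[OF sBC(1) sBC(1)] bounded_op_UNIV_bounded_linear[OF sBC]
  by (auto intro: bounded_linear_Blinfun_apply)

lemma A_apply: "A \<epsilon> x = (\<Sum>s=1..k+1. \<Sum>r=1..s. sB (\<epsilon> ^ (k + 1 - r)) (\<mu> r s (pr s x)))"
  unfolding A_def blinfun.sum_left
  by (intro sum.cong refl) (auto simp: Blinfun_op(1)[OF \<mu>_op] Blinfun_op(1)[OF pr_op])

lemma A_lin: "A \<epsilon> (sB c x) = sB c (A \<epsilon> x)"
  unfolding A_apply B.scale_sum_right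
  by (intro sum.cong refl)
     (auto simp: bounded_op_on_scale[OF pr_op] bounded_op_on_scale[OF \<mu>_op] B.scale_left_commute simp del: B.scale_scale)

text \<open>Terms with r > i are sorted by d = r - i and carry \<epsilon>^(k+1-d): d = 1 gives
  \<open>\<sigma> s y\<close>, and all larger d vanish by \<open>chain_zero\<close>. Terms with r
  \<le> i already contain \<epsilon>^(k+1) and form the error.\<close>

lemma chain_identity:
  assumes s: "1 \<le> s" "s \<le> k + 1" and y: "y \<in> N (s - 1)"
  shows "(\<Sum>i\<le>k. \<Sum>r=1..s. sC (\<epsilon> ^ (i + (k + 1 - r))) (T i (\<mu> r s y))) =
    sC (\<epsilon> ^ k) (\<sigma> s y) + sC (\<epsilon> ^ (k + 1)) (\<Sum>i\<le>k. \<Sum>r=1..min s i. sC (\<epsilon> ^ (i - r)) (T i (\<mu> r s y)))"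
proof -
  have "(\<Sum>r=1..s. sC (\<epsilon> ^ (i + (k + 1 - r))) (T i (\<mu> r s y))) =
     (\<Sum>d=1..s-i. sC (\<epsilon> ^ (k + 1 - d)) (T i (\<mu> (i + d) s y))) +
     (\<Sum>r=1..min s i. sC (\<epsilon> ^ (k + 1)) (sC (\<epsilon> ^ (i - r)) (T i (\<mu> r s y))))" if i: "i \<le> k" for i
  proof -
    have "{1..s} = {i+1..s} \<union> {1..min s i}" "{i+1..s} \<inter> {1..min s i} = {}" by auto
    then have "(\<Sum>r=1..s. sC (\<epsilon> ^ (i + (k + 1 - r))) (T i (\<mu> r s y))) =
      (\<Sum>r=i+1..s. sC (\<epsilon> ^ (i + (k + 1 - r))) (T i (\<mu> r s y))) +
      (\<Sum>r=1..min s i. sC (\<epsilon> ^ (i + (k + 1 - r))) (T i (\<mu> r s y)))"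
      using sum.union_disjoint[of "{i+1..s}" "{1..min s i}"] by simp
    moreover have "(\<Sum>r=i+1..s. sC (\<epsilon> ^ (i + (k + 1 - r))) (T i (\<mu> r s y))) =
      (\<Sum>d=1..s-i. sC (\<epsilon> ^ (k + 1 - d)) (T i (\<mu> (i + d) s y)))"
      by (rule sum.reindex_bij_witness[of _ "\<lambda>d. i + d" "\<lambda>r. r - i"]) (use s i in \<open>auto simp: add.commute\<close>)
    moreover have "(\<Sum>r=1..min s i. sC (\<epsilon> ^ (i + (k + 1 - r))) (T i (\<mu> r s y))) =
      (\<Sum>r=1..min s i. sC (\<epsilon> ^ (k + 1)) (sC (\<epsilon> ^ (i - r)) (T i (\<mu> r s y))))"
    proof (rule sum.cong[OF refl])
      fix r assume r: "r \<in> {1..min s i}"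
      then have "i + (k + 1 - r) = (k + 1) + (i - r)" using i by auto
      then show "sC (\<epsilon> ^ (i + (k + 1 - r))) (T i (\<mu> r s y)) = sC (\<epsilon> ^ (k + 1)) (sC (\<epsilon> ^ (i - r)) (T i (\<mu> r s y)))"
        by (simp only: power_add C.scale_scale)
    qed
    ultimately show ?thesis by simp
  qed
  then have "(\<Sum>i\<le>k. \<Sum>r=1..s. sC (\<epsilon> ^ (i + (k + 1 - r))) (T i (\<mu> r s y))) =
     (\<Sum>i\<le>k. \<Sum>d=1..s-i. sC (\<epsilon> ^ (k + 1 - d)) (T i (\<mu> (i + d) s y))) +
     (\<Sum>i\<le>k. \<Sum>r=1..min s i. sC (\<epsilon> ^ (k + 1)) (sC (\<epsilon> ^ (i - r)) (T i (\<mu> r s y))))"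
    by (simp add: sum.distrib)
  moreover have "(\<Sum>i\<le>k. \<Sum>d=1..s-i. sC (\<epsilon> ^ (k + 1 - d)) (T i (\<mu> (i + d) s y))) = sC (\<epsilon> ^ k) (\<sigma> s y)"
  proof -
    have "(\<Sum>i\<le>k. \<Sum>d=1..s-i. sC (\<epsilon> ^ (k + 1 - d)) (T i (\<mu> (i + d) s y))) =
      (\<Sum>d=1..s. sC (\<epsilon> ^ (k + 1 - d)) (\<Sum>i\<le>s - d. T i (\<mu> (i + d) s y)))"
      by (simp only: sum_triangle_swap[OF s] C.scale_sum_right)
    also have "\<dots> = sC (\<epsilon> ^ k) (\<Sum>i\<le>s - 1. T i (\<mu> (i + 1) s y)) +
      (\<Sum>d=2..s. sC (\<epsilon> ^ (k + 1 - d)) (\<Sum>i\<le>s - d. T i (\<mu> (i + d) s y)))"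
      using s by (subst sum.atLeast_Suc_atMost) (auto simp: numeral_2_eq_2)
    also have "(\<Sum>d=2..s. sC (\<epsilon> ^ (k + 1 - d)) (\<Sum>i\<le>s - d. T i (\<mu> (i + d) s y))) = 0"
    proof (rule sum.neutral, rule ballI)
      fix d assume "d \<in> {2..s}"
      then have "(\<Sum>i\<le>s - d. T i (\<mu> (i + d) s y)) = 0" by (intro chain_zero s(2) y) auto
      then show "sC (\<epsilon> ^ (k + 1 - d)) (\<Sum>i\<le>s - d. T i (\<mu> (i + d) s y)) = 0" by simp
    qed
    finally show ?thesis using chain_first[OF s y] by simp
  qed
  ultimately show ?thesis by (simp only: C.scale_sum_right)
qed

definition D\<^sub>0 :: "'b \<Rightarrow>\<^sub>L 'c"
  where "D\<^sub>0 = (\<Sum>s=1..k+1. Blinfun (\<sigma> s) o\<^sub>L Blinfun (pr s))"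

text \<open>Collects the terms of order at least k + 1 in \<open>chain_identity\<close> together
  with the contribution of the remainder \<open>Rm\<close> of the family.\<close>

definition D\<^sub>1 :: "('k \<Rightarrow> 'b \<Rightarrow>\<^sub>L 'c) \<Rightarrow> 'k \<Rightarrow> 'b \<Rightarrow>\<^sub>L 'c"
  where "D\<^sub>1 Rm \<epsilon> = (\<Sum>s=1..k+1. \<Sum>i\<le>k. \<Sum>r=1..min s i.
    C.scale_op (\<epsilon> ^ (i - r)) o\<^sub>L (Blinfun (T i) o\<^sub>L (Blinfun (\<mu> r s) o\<^sub>L Blinfun (pr s)))) + (Rm \<epsilon> o\<^sub>L A \<epsilon>)"

lemma D\<^sub>0_apply: "D\<^sub>0 x = (\<Sum>s=1..k+1. \<sigma> s (pr s x))"
  unfolding D\<^sub>0_def blinfun.sum_left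
  by (intro sum.cong refl) (auto simp: Blinfun_op(2)[OF \<sigma>_op] Blinfun_op(1)[OF pr_op])

lemma D\<^sub>1_apply: "D\<^sub>1 Rm \<epsilon> x = (\<Sum>s=1..k+1. \<Sum>i\<le>k. \<Sum>r=1..min s i.
    sC (\<epsilon> ^ (i - r)) (T i (\<mu> r s (pr s x)))) + Rm \<epsilon> (A \<epsilon> x)"
  unfolding D\<^sub>1_def blinfun.add_left blinfun.sum_left blinfun_apply_blinfun_compose
  by (intro arg_cong2[of _ _ _ _ "(+)"] refl sum.cong)
     (auto simp: Blinfun_op(1)[OF \<mu>_op] Blinfun_op(2)[OF T_op] Blinfun_op(1)[OF pr_op])

lemma factorization:
  fixes L :: "'b \<Rightarrow> 'c" and Rm :: "'k \<Rightarrow> 'b \<Rightarrow>\<^sub>L 'c"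
  assumes L: "\<And>x. L x = (\<Sum>i\<le>k. sC (\<epsilon> ^ i) (T i x)) + sC (\<epsilon> ^ (k + 1)) (Rm \<epsilon> x)"
  shows "L (A \<epsilon> x) = sC (\<epsilon> ^ k) (D\<^sub>0 x + sC \<epsilon> (D\<^sub>1 Rm \<epsilon> x))"
proof -
  have TA: "T i (A \<epsilon> x) = (\<Sum>s=1..k+1. \<Sum>r=1..s. sC (\<epsilon> ^ (k + 1 - r)) (T i (\<mu> r s (pr s x))))" if "i \<le> k" for i
    unfolding A_apply T_sum[OF that] bounded_op_on_scale[OF T_op[OF that] UNIV_I] ..
  have "(\<Sum>i\<le>k. sC (\<epsilon> ^ i) (T i (A \<epsilon> x))) =
    (\<Sum>i\<le>k. \<Sum>s=1..k+1. \<Sum>r=1..s. sC (\<epsilon> ^ (i + (k + 1 - r))) (T i (\<mu> r s (pr s x))))"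
    by (intro sum.cong refl) (simp only: TA atMost_iff C.scale_sum_right C.scale_scale power_add)
  also have "\<dots> = (\<Sum>s=1..k+1. \<Sum>i\<le>k. \<Sum>r=1..s. sC (\<epsilon> ^ (i + (k + 1 - r))) (T i (\<mu> r s (pr s x))))"
    by (rule sum.swap)
  also have "\<dots> = (\<Sum>s=1..k+1. sC (\<epsilon> ^ k) (\<sigma> s (pr s x)) +
     sC (\<epsilon> ^ (k + 1)) (\<Sum>i\<le>k. \<Sum>r=1..min s i. sC (\<epsilon> ^ (i - r)) (T i (\<mu> r s (pr s x)))))"
    by (intro sum.cong refl chain_identity pr_in) auto
  also have "\<dots> = sC (\<epsilon> ^ k) (D\<^sub>0 x) + sC (\<epsilon> ^ (k + 1)) (\<Sum>s=1..k+1. \<Sum>i\<le>k. \<Sum>r=1..min s i. sC (\<epsilon> ^ (i - r)) (T i (\<mu> r s (pr s x))))"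
    unfolding D\<^sub>0_apply by (simp only: sum.distrib C.scale_sum_right)
  finally show ?thesis unfolding L D\<^sub>1_apply
    by (simp add: C.scale_right_distrib mult.commute add.assoc)
qed

lemma A_ker: assumes "u \<in> ker (k + 1)" shows "A \<epsilon> u \<in> ker (k + 1)"
  unfolding A_apply
proof (intro B.subspace_sum subspace_ker B.subspace_scale)
  fix s r assume s: "s \<in> {1..k+1}" and r: "r \<in> {1..s}"
  have p: "pr s u \<in> Nc s" using pr_ker[OF assms] B.summand_proj_in[of s u] s by auto
  show "\<mu> r s (pr s u) \<in> ker (k + 1)"
  proof (cases "r = s")
    case True then show ?thesis using p chain_diag[of s] Nc_ker[of s "k + 1"] s by auto
  next
    case False
    then show ?thesis using chain_ker[of r s "pr s u"] ker_mono[of r "k + 1"] r s by auto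
  qed
qed auto

text \<open>Back substitution: \<open>A \<epsilon>\<close> is block triangular with invertible diagonal blocks
  \<open>\<epsilon>\<^bsup>k+1-s\<^esup>\<close>.\<close>

lemma A_onto_ker:
  assumes "\<epsilon> \<noteq> 0" "j \<le> k + 1" "u \<in> ker j"
  shows "\<exists>w\<in>ker j. A \<epsilon> w = u"
  using assms(2,3)
proof (induction j arbitrary: u)
  case 0
  then show ?case by (intro bexI[of _ 0]) (auto simp: ker_def)
next
  case (Suc j)
  define y where "y = summand_proj Nc N (Suc j) u"
  \<comment> \<open>The diagonal weight in column j + 1 is \<epsilon>^(k-j). Dividing by it makes
    the last component of \<open>A \<epsilon> w\<close> equal to \<open>y\<close>, so that
    \<open>u - A \<epsilon> w\<close> falls into \<open>ker j\<close>.\<close>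
  define w where "w = sB (inverse (\<epsilon> ^ (k - j))) y"
  have j: "j \<le> k" using Suc by simp
  have y: "y \<in> Nc (Suc j)" unfolding y_def by (rule B.summand_proj_in) (use j in auto)
  have w: "w \<in> Nc (Suc j)" unfolding w_def by (rule B.subspace_scale[OF B.subspace_Y y]) (use j in auto)
  have wk: "w \<in> ker (Suc j)" using w Nc_ker[of "Suc j" "Suc j"] j by auto
  then have wk': "w \<in> ker (k + 1)" using ker_mono[of "Suc j" "k + 1"] j by auto
  have pw: "pr s w = (if s = Suc j then w else 0)" if "s \<in> {1..k+1}" for s
    using that pr_ker[OF wk'] B.summand_proj_summand[of s "Suc j" w] w j by auto
  have \<mu>0: "\<mu> r s 0 = 0" if "r \<le> s" "s \<le> k + 1" for r s
    using bounded_op_on_zero_arg[OF sBC(1) sBC(1) \<mu>_op[OF that]] by simp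
  have "A \<epsilon> w = (\<Sum>s\<in>{1..k+1}. if s = Suc j then \<Sum>r=1..s. sB (\<epsilon> ^ (k + 1 - r)) (\<mu> r s w) else 0)"
    unfolding A_apply by (intro sum.cong refl) (auto simp: pw \<mu>0)
  also have "\<dots> = (\<Sum>r=1..Suc j. sB (\<epsilon> ^ (k + 1 - r)) (\<mu> r (Suc j) w))" using j by simp
  also have "\<dots> = (\<Sum>r=1..j. sB (\<epsilon> ^ (k + 1 - r)) (\<mu> r (Suc j) w)) + y"
    using assms(1) j by (simp add: chain_diag del: chain_coeff.simps) (simp add: w_def)
  finally have Aw: "A \<epsilon> w = (\<Sum>r=1..j. sB (\<epsilon> ^ (k + 1 - r)) (\<mu> r (Suc j) w)) + y" .
  note op = B.bounded_op_rest_proj[of j]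
  have "(\<Sum>r=1..j. sB (\<epsilon> ^ (k + 1 - r)) (\<mu> r (Suc j) w)) \<in> ker j"
  proof (intro B.subspace_sum subspace_ker B.subspace_scale)
    fix r assume r: "r \<in> {1..j}"
    then show "\<mu> r (Suc j) w \<in> ker j" using chain_ker[of r "Suc j" w] ker_mono[of r j] j by auto
  qed (use j in auto)
  moreover have "rest_proj Nc N j y = y"
    by (rule B.rest_proj_id) (use j y B.Y_subset[of "Suc j" j] in auto)
  moreover have "rest_proj Nc N j u = y"
    using rest_proj_split[OF j, of u] Suc.prems by (simp add: ker_def y_def del: rest_proj.simps)
  moreover have "linear (rest_proj Nc N j)"
    using bounded_op_UNIV_bounded_linear[OF sBC(1) sBC(1) op] j bounded_linear.linear by auto
  ultimately have "u - A \<epsilon> w \<in> ker j"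
    using Aw by (simp add: ker_def linear_diff linear_add)
  then obtain z where z: "z \<in> ker j" "A \<epsilon> z = u - A \<epsilon> w" using Suc.IH j by auto
  have "z \<in> ker (Suc j)" using z ker_mono[of j "Suc j"] j by auto
  then have "w + z \<in> ker (Suc j)" using wk by (intro B.subspace_add subspace_ker) (use j in auto)
  then show ?case using z by (intro bexI[of _ "w + z"]) (auto simp: blinfun.add_right)
qed

text \<open>The off-diagonal part of the last column of \<open>A\<close>, which has weight 1 on its
  diagonal, divided by \<epsilon>.\<close>

definition A\<^sub>1 :: "'k \<Rightarrow> 'b \<Rightarrow>\<^sub>L 'b"
  where "A\<^sub>1 \<epsilon> = (\<Sum>r=1..k. B.scale_op (\<epsilon> ^ (k - r)) o\<^sub>L Blinfun (\<mu> r (k + 1)))"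

lemma A\<^sub>1_apply: "A\<^sub>1 \<epsilon> x = (\<Sum>r=1..k. sB (\<epsilon> ^ (k - r)) (\<mu> r (k + 1) x))"
  unfolding A\<^sub>1_def blinfun.sum_left
  by (intro sum.cong refl) (auto simp: Blinfun_op(1)[OF \<mu>_op] simp del: chain_coeff.simps)

lemma A_last:
  assumes "v \<in> N (k + 1)"
  shows "A \<epsilon> v = v + sB \<epsilon> (A\<^sub>1 \<epsilon> v)"
proof -
  have \<mu>0: "\<mu> r s 0 = 0" if "r \<le> s" "s \<le> k + 1" for r s
    using bounded_op_on_zero_arg[OF sBC(1) sBC(1) \<mu>_op[OF that]] by simp
  have "A \<epsilon> v = (\<Sum>s\<in>{1..k+1}. if s = k + 1 then \<Sum>r=1..s. sB (\<epsilon> ^ (k + 1 - r)) (\<mu> r s v) else 0)"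
    unfolding A_apply by (intro sum.cong refl) (auto simp: pr_last[OF _ _ assms] \<mu>0)
  also have "\<dots> = (\<Sum>r=1..Suc k. sB (\<epsilon> ^ (k + 1 - r)) (\<mu> r (Suc k) v))" by simp
  also have "\<dots> = (\<Sum>r=1..k. sB (\<epsilon> ^ (k + 1 - r)) (\<mu> r (Suc k) v)) + v"
    by (simp add: chain_diag del: chain_coeff.simps)
  also have "(\<Sum>r=1..k. sB (\<epsilon> ^ (k + 1 - r)) (\<mu> r (Suc k) v)) = sB \<epsilon> (A\<^sub>1 \<epsilon> v)"
    unfolding A\<^sub>1_apply B.scale_sum_right
    by (intro sum.cong refl) (auto simp: Suc_diff_le simp del: chain_coeff.simps)
  finally show ?thesis by simp
qed

text \<open>\<open>Rm\<close> enters as a continuous operator family and not merely as a bound,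
  because \<open>D\<^sub>1 Rm\<close>, and with it the family on the kernel side, must be continuous
  at \<epsilon> = 0 as well.\<close>

theorem family_inversion:
  fixes L Rm :: "'k \<Rightarrow> 'b \<Rightarrow>\<^sub>L 'c"
  assumes \<delta>0: "0 < \<delta>0"
    and L: "\<And>\<epsilon> x. norm \<epsilon> < \<delta>0 \<Longrightarrow> L \<epsilon> x = (\<Sum>i\<le>k. sC (\<epsilon> ^ i) (T i x)) + sC (\<epsilon> ^ (k + 1)) (Rm \<epsilon> x)"
    and Rm: "continuous_on (ball 0 \<delta>0) Rm" "\<And>\<epsilon> c x. norm \<epsilon> < \<delta>0 \<Longrightarrow> Rm \<epsilon> (sB c x) = sC c (Rm \<epsilon> x)"
  shows "\<exists>\<delta>1 c. 0 < \<delta>1 \<and> \<delta>1 \<le> \<delta>0 \<and>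
    (\<forall>\<epsilon>. 0 < norm \<epsilon> \<and> norm \<epsilon> < \<delta>1 \<longrightarrow>
      GL_on sB sC (ker (k + 1)) UNIV (L \<epsilon>) \<and>
      (\<forall>y. norm (the_inv_into (ker (k + 1)) (L \<epsilon>) y) \<le> c / norm \<epsilon> ^ k * norm y)) \<and>
    (\<exists>Q. continuous_op_family sB sB (ball 0 \<delta>1) (N (k + 1)) Q \<and>
      (\<forall>\<epsilon>\<in>ball 0 \<delta>1. \<forall>v\<in>N (k + 1). L \<epsilon> (v + sB \<epsilon> (Q \<epsilon> v)) = 0))"
proof (rule reduced_family_inversion[OF sBC \<delta>0, where A = A and A\<^sub>1 = A\<^sub>1 and D\<^sub>0 = D\<^sub>0 and D\<^sub>1 = "D\<^sub>1 Rm" and K = "Blinfun K"])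
  have K: "blinfun_apply (Blinfun K) = K"
    using bounded_op_UNIV_bounded_linear[OF sBC(2) sBC(1) K_op] by (rule bounded_linear_Blinfun_apply)
  show "L \<epsilon> (sB c x) = sC c (L \<epsilon> x)" if "norm \<epsilon> < \<delta>0" for \<epsilon> c x
    using that by (simp add: L Rm bounded_op_on_scale[OF T_op] C.scale_right_distrib C.scale_sum_right C.scale_left_commute mult.commute)
  show "D\<^sub>1 Rm \<epsilon> (sB c x) = sC c (D\<^sub>1 Rm \<epsilon> x)" if "norm \<epsilon> < \<delta>0" for \<epsilon> c x
    unfolding D\<^sub>1_apply C.scale_right_distrib C.scale_sum_right
    by (intro arg_cong2[of _ _ _ _ "(+)"] sum.cong refl)
       (auto simp: A_lin Rm that bounded_op_on_scale[OF pr_op] bounded_op_on_scale[OF \<mu>_op] bounded_op_on_scale[OF T_op]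
          C.scale_left_commute simp del: C.scale_scale)
  show "D\<^sub>0 (sB c x) = sC c (D\<^sub>0 x)" for c x
    unfolding D\<^sub>0_apply C.scale_sum_right
    by (intro sum.cong refl) (auto simp: bounded_op_on_scale[OF pr_op] bounded_op_on_scale[OF \<sigma>_op])
  show "A\<^sub>1 \<epsilon> (sB c x) = sB c (A\<^sub>1 \<epsilon> x)" for \<epsilon> c x
    unfolding A\<^sub>1_apply B.scale_sum_right
    by (intro sum.cong refl) (auto simp: bounded_op_on_scale[OF \<mu>_op] B.scale_left_commute simp del: chain_coeff.simps B.scale_scale)
  show "continuous_on UNIV A" unfolding A_def
    by (intro continuous_intros B.continuous_on_scale_op)
  show "continuous_on UNIV A\<^sub>1" unfolding A\<^sub>1_def
    by (intro continuous_intros B.continuous_on_scale_op)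
  have "continuous_on (ball 0 \<delta>0) A" using \<open>continuous_on UNIV A\<close> continuous_on_subset by blast
  then show "continuous_on (ball 0 \<delta>0) (D\<^sub>1 Rm)" unfolding D\<^sub>1_def
    by (intro continuous_intros C.continuous_on_scale_op Rm)
  show "L \<epsilon> (A \<epsilon> x) = sC (\<epsilon> ^ k) (D\<^sub>0 x + sC \<epsilon> (D\<^sub>1 Rm \<epsilon> x))" if "norm \<epsilon> < \<delta>0" for \<epsilon> x
    by (rule factorization) (rule L[OF that])
  have Kk: "K y \<in> ker (k + 1)" for y using K_in by (simp add: ker_def)
  show "blinfun_apply (Blinfun K) y \<in> ker (k + 1)" for y using K Kk by simp
  show "D\<^sub>0 (blinfun_apply (Blinfun K) y) = y" for y
    unfolding K D\<^sub>0_apply pr_ker[OF Kk] by (rule \<sigma>_K)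
  show "blinfun_apply (Blinfun K) (D\<^sub>0 u) = u" if "u \<in> ker (k + 1)" for u
    unfolding K D\<^sub>0_apply pr_ker[OF that] by (rule K_\<sigma>) (use that in \<open>simp add: ker_def\<close>)
  show "blinfun_apply (Blinfun K) (sC c y) = sB c (blinfun_apply (Blinfun K) y)" for c y
    unfolding K by (rule bounded_op_on_scale[OF K_op]) simp
  show "D\<^sub>0 v = 0" if "v \<in> N (k + 1)" for v
    unfolding D\<^sub>0_apply
  proof (rule sum.neutral, rule ballI)
    fix s assume s: "s \<in> {1..k+1}"
    then show "\<sigma> s (pr s v) = 0"
      using pr_last[of s, OF _ _ that] \<sigma>_zero[of s] that bounded_op_on_zero_arg[OF sBC \<sigma>_op, of s] by auto
  qed
  show "0 \<in> N (k + 1)" by (rule B.subspace_0[OF B.subspace_X]) simp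
  show "\<exists>w\<in>ker (k + 1). A \<epsilon> w = u" if "\<epsilon> \<noteq> 0" "u \<in> ker (k + 1)" for \<epsilon> u
    by (rule A_onto_ker) (use that in auto)
  show "A \<epsilon> u \<in> ker (k + 1)" if "u \<in> ker (k + 1)" for \<epsilon> u by (rule A_ker[OF that])
qed (auto intro: subspace_ker A_lin A_last)

end

section \<open>Taylor expansion along the curve\<close>

text \<open>Induction on \<open>N\<close>: the derivative of the remainder of \<open>g 0\<close> is
  the remainder of \<open>g 1\<close>, and the mean value inequality on the unit interval carries
  the bound over. Measuring the oscillation of the top derivative serves both O and o estimates,
  depending on what is known about it.\<close>

lemma taylor_segment:
  fixes g :: "nat \<Rightarrow> real \<Rightarrow> 'a::real_normed_vector"
  assumes "\<And>n t. n < N \<Longrightarrow> t \<in> {0..1} \<Longrightarrow> (g n has_vector_derivative g (Suc n) t) (at t within {0..1})"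
    and "\<And>t. t \<in> {0..1} \<Longrightarrow> norm (g N t - g N 0) \<le> B"
    and "t \<in> {0..1}"
  shows "norm (g 0 t - (\<Sum>n\<le>N. (t ^ n / fact n) *\<^sub>R g n 0)) \<le> B"
  using assms
proof (induction N arbitrary: g t)
  case 0
  then show ?case by simp
next
  case (Suc N)
  define r where "r = (\<lambda>t. g 0 t - (g 0 0 + (\<Sum>n\<le>N. (t ^ Suc n / fact (Suc n)) *\<^sub>R g (Suc n) 0)))"
  define r' where "r' t = g 1 t - (\<Sum>n\<le>N. (t ^ n / fact n) *\<^sub>R g (Suc n) 0)" for t
  have d: "((\<lambda>t::real. t ^ Suc n / fact (Suc n)) has_real_derivative t ^ n / fact n) (at t within {0..1})" for n t
  proof -
    have "((\<lambda>t::real. t ^ Suc n / fact (Suc n)) has_real_derivative real (Suc n) * t ^ n / fact (Suc n)) (at t within {0..1})"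
      by (rule DERIV_cdivide) (use has_field_derivative_at_within[OF DERIV_pow[of "Suc n" t]] in simp)
    then show ?thesis by (simp add: divide_simps del: power_Suc of_nat_Suc)
  qed
  have r: "(r has_vector_derivative r' t) (at t within {0..1})" if "t \<in> {0..1}" for t
  proof -
    have "((\<lambda>t. \<Sum>n\<le>N. (t ^ Suc n / fact (Suc n)) *\<^sub>R g (Suc n) 0) has_vector_derivative
        (\<Sum>n\<le>N. (t ^ n / fact n) *\<^sub>R g (Suc n) 0)) (at t within {0..1})"
    proof (rule has_vector_derivative_sum)
      show "((\<lambda>t. (t ^ Suc n / fact (Suc n)) *\<^sub>R g (Suc n) 0) has_vector_derivative (t ^ n / fact n) *\<^sub>R g (Suc n) 0)
        (at t within {0..1})" for n
        using has_vector_derivative_scaleR[OF d has_vector_derivative_const, of n "g (Suc n) 0" t] by simp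
    qed
    from has_vector_derivative_diff[OF Suc.prems(1)[of 0 t] has_vector_derivative_add[OF has_vector_derivative_const this]]
    show ?thesis using that unfolding r_def r'_def by (simp del: power_Suc fact_Suc)
  qed
  have r': "norm (r' t) \<le> B" if "t \<in> {0..1}" for t
    unfolding r'_def using Suc.IH[of "\<lambda>n. g (Suc n)" t] Suc.prems(1,2) that by auto
  have "0 \<le> B" using r'[OF Suc.prems(3)] norm_ge_zero order_trans by blast
  have "norm (r t - r 0) \<le> B * norm (t - 0)"
  proof (rule differentiable_bound[of "{0..1}" r "\<lambda>t h. h *\<^sub>R r' t"])
    show "(r has_derivative (\<lambda>h. h *\<^sub>R r' t)) (at t within {0..1})" if "t \<in> {0..1}" for t
      using r[OF that] by (simp add: has_vector_derivative_def)
    show "onorm (\<lambda>h. h *\<^sub>R r' t) \<le> B" if "t \<in> {0..1}" for t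
      using r'[OF that] by (intro onorm_le) (simp add: mult.commute[of B] mult_left_mono)
  qed (use Suc.prems in auto)
  also have "\<dots> \<le> B" using Suc.prems(3) \<open>0 \<le> B\<close> by (simp add: mult_left_le)
  also have "r 0 = 0" by (simp add: r_def)
  finally show ?case by (simp add: r_def sum.atMost_Suc_shift del: sum.atMost_Suc)
qed

abbreviation prod_norm :: "'a::real_normed_vector list \<Rightarrow> real"
  where "prod_norm hs \<equiv> prod_list (map norm hs)"

lemma prod_norm_nonneg [simp]: "0 \<le> prod_norm hs"
  by (rule prod_list_nonneg) auto

lemma prod_norm_replicate [simp]: "prod_norm (replicate n u) = norm u ^ n"
  by (induction n) auto

lemma normed_space_over_mult: "normed_space_over ((*) :: 'k::real_or_complex \<Rightarrow> 'k \<Rightarrow> 'k)"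
  by standard (auto simp: algebra_simps scaleR_conv_of_real norm_mult)

locale smooth_map = X: normed_space_over sX + Y: normed_space_over sY
  for sX :: "'k::real_or_complex \<Rightarrow> 'a::real_normed_vector \<Rightarrow> 'a"
    and sY :: "'k \<Rightarrow> 'b::real_normed_vector \<Rightarrow> 'b" +
  fixes q :: nat and S :: "'a set" and f :: "'a \<Rightarrow> 'b"
  assumes C_on: "C_on sX sY q S f"
begin

lemma open_S: "open S" using C_on unfolding C_on_def by blast

lemma multilinear: "n \<le> q \<Longrightarrow> x \<in> S \<Longrightarrow> bounded_multilinear sX sY n (\<lambda>hs. hderiv f hs x)"
  using C_on unfolding C_on_def by blast

lemma hderiv_add:
  assumes "length xs + length ys < q" "x \<in> S"
  shows "hderiv f (xs @ (u + v) # ys) x = hderiv f (xs @ u # ys) x + hderiv f (xs @ v # ys) x"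
  using multilinear[of "length xs + length ys + 1" x] assms unfolding bounded_multilinear_def by simp

lemma hderiv_scale:
  assumes "length xs + length ys < q" "x \<in> S"
  shows "hderiv f (xs @ sX c u # ys) x = sY c (hderiv f (xs @ u # ys) x)"
  using multilinear[of "length xs + length ys + 1" x] assms unfolding bounded_multilinear_def by simp

lemma hderiv_bound:
  assumes "n \<le> q" "x \<in> S"
  obtains C where "C \<ge> 0" "\<And>hs. length hs = n \<Longrightarrow> norm (hderiv f hs x) \<le> C * prod_norm hs"
proof -
  obtain C where C: "\<And>hs. length hs = n \<Longrightarrow> norm (hderiv f hs x) \<le> C * prod_norm hs"
    using multilinear[OF assms] unfolding bounded_multilinear_def by blast
  have "norm (hderiv f hs x) \<le> \<bar>C\<bar> * prod_norm hs" if "length hs = n" for hs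
    by (rule order_trans[OF C[OF that] mult_right_mono]) auto
  then show ?thesis using that[of "\<bar>C\<bar>"] by simp
qed

lemma hderiv_scale_replicate:
  assumes "length xs + n + length hs \<le> q" "x \<in> S"
  shows "hderiv f (xs @ replicate n (sX c u) @ hs) x = sY (c ^ n) (hderiv f (xs @ replicate n u @ hs) x)"
  using assms
proof (induction n arbitrary: xs)
  case (Suc n)
  have "hderiv f (xs @ replicate (Suc n) (sX c u) @ hs) x = sY c (hderiv f (xs @ u # replicate n (sX c u) @ hs) x)"
    using hderiv_scale[of xs "replicate n (sX c u) @ hs" x c u] Suc.prems by simp
  also have "\<dots> = sY c (sY (c ^ n) (hderiv f ((xs @ [u]) @ replicate n u @ hs) x))"
    using Suc.IH[of "xs @ [u]"] Suc.prems by simp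
  finally show ?case by simp
qed simp

text \<open>The free argument stands last in \<open>W_op\<close> but first in the recursion of
  \<open>hderiv\<close>; the two positions are treated separately.\<close>

lemma hderiv_last_op:
  assumes "length hs < q" "x \<in> S"
  shows "bounded_op_on sX sY UNIV (\<lambda>h. hderiv f (hs @ [h]) x)"
proof -
  obtain C where C: "C \<ge> 0" "\<And>ks. length ks = Suc (length hs) \<Longrightarrow> norm (hderiv f ks x) \<le> C * prod_norm ks"
    using hderiv_bound[of "Suc (length hs)" x] assms by auto
  show ?thesis
  proof (rule bounded_op_onI)
    show "norm (hderiv f (hs @ [h]) x) \<le> (C * prod_norm hs) * norm h" for h
      using C(2)[of "hs @ [h]"] by (simp add: mult_ac)
  qed (use hderiv_add[of hs "[]" x] hderiv_scale[of hs "[]" x] assms in auto)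
qed

lemma hderiv_first_op:
  assumes "length hs < q" "x \<in> S"
  shows "bounded_op_on sX sY UNIV (\<lambda>h. hderiv f (h # hs) x)"
proof -
  obtain C where C: "C \<ge> 0" "\<And>ks. length ks = Suc (length hs) \<Longrightarrow> norm (hderiv f ks x) \<le> C * prod_norm ks"
    using hderiv_bound[of "Suc (length hs)" x] assms by auto
  show ?thesis
  proof (rule bounded_op_onI)
    show "norm (hderiv f (h # hs) x) \<le> (C * prod_norm hs) * norm h" for h
      using C(2)[of "h # hs"] by (simp add: mult_ac)
  qed (use hderiv_add[of "[]" hs x] hderiv_scale[of "[]" hs x] assms in \<open>auto simp del: hderiv.simps\<close>)
qed

lemma hderiv_increment:
  assumes "n < q" "x \<in> S" "e > 0"
  obtains d where "d > 0" "\<And>y hs. y \<in> S \<Longrightarrow> norm (y - x) < d \<Longrightarrow> length hs = n \<Longrightarrow>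
    norm (hderiv f hs y - hderiv f hs x - hderiv f ((y - x) # hs) x) \<le> e * norm (y - x) * prod_norm hs"
proof -
  have "\<exists>d>0. \<forall>y\<in>S. norm (y - x) < d \<longrightarrow> (\<forall>hs. length hs = n \<longrightarrow>
    norm (hderiv f hs y - hderiv f hs x - hderiv f ((y - x) # hs) x) \<le> e * norm (y - x) * prod_norm hs)"
    by (rule C_on[unfolded C_on_def, THEN conjunct2, THEN conjunct2, THEN conjunct1, THEN spec, THEN mp, OF assms(1),
          THEN bspec, OF assms(2), THEN spec, THEN mp, OF assms(3)])
  then show ?thesis using that by blast
qed

lemma hderiv_has_derivative:
  assumes "length hs < q" "x \<in> S"
  shows "(hderiv f hs has_derivative (\<lambda>h. hderiv f (h # hs) x)) (at x)"
proof -
  have "bounded_linear (\<lambda>h. hderiv f (h # hs) x)"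
    using bounded_op_UNIV_bounded_linear[OF X.normed_space_over_axioms Y.normed_space_over_axioms hderiv_first_op[OF assms]] .
  moreover have "\<exists>d>0. \<forall>y\<in>S. norm (y - x) < d \<longrightarrow>
      norm (hderiv f hs y - hderiv f hs x - hderiv f ((y - x) # hs) x) \<le> e * norm (y - x)" if e: "e > 0" for e
  proof -
    \<comment> \<open>The increment estimate is relative to the norms of all arguments; the 1 added
      keeps the denominator positive when one of them is 0.\<close>
    define e' where "e' = e / (prod_norm hs + 1)"
    have p: "prod_norm hs + 1 > 0" using prod_norm_nonneg[of hs] by linarith
    have "e' > 0" using e p by (simp add: e'_def)
    then obtain d where d: "d > 0" "\<And>y ks. y \<in> S \<Longrightarrow> norm (y - x) < d \<Longrightarrow> length ks = length hs \<Longrightarrow>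
      norm (hderiv f ks y - hderiv f ks x - hderiv f ((y - x) # ks) x) \<le> e' * norm (y - x) * prod_norm ks"
      using hderiv_increment[OF assms] by metis
    have le: "e' * norm (y - x) * prod_norm hs \<le> e * norm (y - x)" for y
    proof -
      have "e' * prod_norm hs \<le> e" using e p by (simp add: e'_def field_simps)
      then show ?thesis using mult_right_mono[of "e' * prod_norm hs" e "norm (y - x)"] by (simp add: mult_ac)
    qed
    show ?thesis by (intro exI[of _ d] conjI ballI impI d(1) order_trans[OF d(2)[OF _ _ refl] le])
  qed
  ultimately have "(hderiv f hs has_derivative (\<lambda>h. hderiv f (h # hs) x)) (at x within S)"
    unfolding has_derivative_within_alt by blast
  then show ?thesis using at_within_open[OF assms(2) open_S] by simp
qed

text \<open>Below the top order the increment estimate with e = 1 bounds the derivative by its value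
  and the next derivative at \<open>x\<close>; at the top order continuity at \<open>x\<close> does
  it.\<close>

lemma hderiv_locally_bounded:
  assumes "n \<le> q" "x \<in> S"
  obtains C d where "C \<ge> 0" "d > 0" "\<And>y hs. y \<in> S \<Longrightarrow> norm (y - x) < d \<Longrightarrow> length hs = n \<Longrightarrow>
    norm (hderiv f hs y) \<le> C * prod_norm hs"
proof -
  obtain C0 where C0: "C0 \<ge> 0" "\<And>hs. length hs = n \<Longrightarrow> norm (hderiv f hs x) \<le> C0 * prod_norm hs"
    using hderiv_bound[OF assms] by blast
  consider "n < q" | "n = q" using assms by linarith
  then show ?thesis
  proof cases
    case 1
    obtain C1 where C1: "C1 \<ge> 0" "\<And>hs. length hs = Suc n \<Longrightarrow> norm (hderiv f hs x) \<le> C1 * prod_norm hs"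
      using hderiv_bound[of "Suc n" x] 1 assms by auto
    obtain d where d: "d > 0" "\<And>y hs. y \<in> S \<Longrightarrow> norm (y - x) < d \<Longrightarrow> length hs = n \<Longrightarrow>
      norm (hderiv f hs y - hderiv f hs x - hderiv f ((y - x) # hs) x) \<le> 1 * norm (y - x) * prod_norm hs"
      using hderiv_increment[OF 1 assms(2) zero_less_one] by metis
    have "norm (hderiv f hs y) \<le> (C0 + (C1 + 1) * d) * prod_norm hs"
      if y: "y \<in> S" "norm (y - x) < d" "length hs = n" for y hs
    proof -
      have "norm (hderiv f hs y) \<le> norm (hderiv f hs y - hderiv f hs x - hderiv f ((y - x) # hs) x)
          + norm (hderiv f hs x) + norm (hderiv f ((y - x) # hs) x)"
        using norm_triangle_ineq[of "hderiv f hs y - hderiv f hs x - hderiv f ((y - x) # hs) x + hderiv f hs x" "hderiv f ((y - x) # hs) x"]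
          norm_triangle_ineq[of "hderiv f hs y - hderiv f hs x - hderiv f ((y - x) # hs) x" "hderiv f hs x"]
        by (simp del: hderiv.simps)
      also have "\<dots> \<le> norm (y - x) * prod_norm hs + C0 * prod_norm hs + C1 * (norm (y - x) * prod_norm hs)"
        using d(2)[OF y] C0(2)[OF y(3)] C1(2)[of "(y - x) # hs"] y(3) by (simp del: hderiv.simps)
      also have "\<dots> = (C0 + (C1 + 1) * norm (y - x)) * prod_norm hs" by (simp add: algebra_simps)
      also have "\<dots> \<le> (C0 + (C1 + 1) * d) * prod_norm hs"
        using y(2) C1(1) by (intro mult_right_mono add_left_mono mult_left_mono) auto
      finally show ?thesis .
    qed
    then show ?thesis using that[of "C0 + (C1 + 1) * d" d] C0 C1 d by auto
  next
    case 2
    have "\<exists>d>0. \<forall>y\<in>S. norm (y - x) < d \<longrightarrow>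
      (\<forall>hs. length hs = q \<longrightarrow> norm (hderiv f hs y - hderiv f hs x) \<le> 1 * prod_norm hs)"
      by (rule C_on[unfolded C_on_def, THEN conjunct2, THEN conjunct2, THEN conjunct2, THEN bspec, OF assms(2),
            THEN spec, THEN mp, OF zero_less_one])
    then obtain d where d: "d > 0" "\<And>y hs. y \<in> S \<Longrightarrow> norm (y - x) < d \<Longrightarrow> length hs = q \<Longrightarrow>
      norm (hderiv f hs y - hderiv f hs x) \<le> prod_norm hs" by auto
    have "norm (hderiv f hs y) \<le> (C0 + 1) * prod_norm hs"
      if y: "y \<in> S" "norm (y - x) < d" "length hs = n" for y hs
      using d(2)[OF y(1,2), of hs] C0(2)[OF y(3)] y(3) 2 norm_triangle_sub[of "hderiv f hs y" "hderiv f hs x"]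
      by (simp add: distrib_right)
    then show ?thesis using that[of "C0 + 1" d] C0 d by auto
  qed
qed

text \<open>Expanding to order N + 1 costs the oscillation 2C of the top derivative; dropping the
  last term again costs at most C. This explains the factor 3.\<close>

lemma hderiv_taylor:
  assumes len: "length hs + N + 1 \<le> q" and seg: "\<And>t. t \<in> {0..1} \<Longrightarrow> y + t *\<^sub>R u \<in> S"
    and C: "\<And>t ks. t \<in> {0..1} \<Longrightarrow> length ks = length hs + N + 1 \<Longrightarrow> norm (hderiv f ks (y + t *\<^sub>R u)) \<le> C * prod_norm ks"
  shows "norm (hderiv f hs (y + u) - (\<Sum>n\<le>N. (1 / fact n) *\<^sub>R hderiv f (replicate n u @ hs) y))
    \<le> 3 * C * norm u ^ (N + 1) * prod_norm hs"
proof -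
  define g where "g = (\<lambda>n t. hderiv f (replicate n u @ hs) (y + t *\<^sub>R u))"
  define P where "P = norm u ^ (N + 1) * prod_norm hs"
  have gN: "norm (g (N + 1) t) \<le> C * P" if "t \<in> {0..1}" for t
    using C[OF that, of "replicate (N + 1) u @ hs"] by (simp add: g_def P_def del: replicate.simps power_Suc)
  have "norm (g 0 1 - (\<Sum>n\<le>N + 1. (1 ^ n / fact n) *\<^sub>R g n 0)) \<le> 2 * (C * P)"
  proof (rule taylor_segment)
    fix n and t :: real assume n: "n < N + 1" and t: "t \<in> {0..1}"
    have "((\<lambda>t. y + t *\<^sub>R u) has_vector_derivative u) (at t within {0..1})"
      by (auto intro!: derivative_eq_intros)
    moreover have "(hderiv f (replicate n u @ hs) has_derivative (\<lambda>h. hderiv f (h # replicate n u @ hs) (y + t *\<^sub>R u)))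
        (at (y + t *\<^sub>R u) within ((\<lambda>t. y + t *\<^sub>R u) ` {0..1}))"
      by (rule has_derivative_at_withinI[OF hderiv_has_derivative]) (use n len seg[OF t] in auto)
    ultimately have "(hderiv f (replicate n u @ hs) \<circ> (\<lambda>t. y + t *\<^sub>R u) has_vector_derivative
        hderiv f (u # replicate n u @ hs) (y + t *\<^sub>R u)) (at t within {0..1})"
      by (rule vector_derivative_diff_chain_within)
    then show "(g n has_vector_derivative g (Suc n) t) (at t within {0..1})"
      by (simp add: g_def o_def)
  next
    fix t :: real assume t: "t \<in> {0..1}"
    show "norm (g (N + 1) t - g (N + 1) 0) \<le> 2 * (C * P)"
      using gN[OF t] gN[of 0] norm_triangle_ineq4[of "g (N + 1) t" "g (N + 1) 0"] by simp
  qed auto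
  moreover have "norm ((1 / fact (N + 1)) *\<^sub>R g (N + 1) 0) \<le> C * P"
  proof -
    have "norm ((1 / fact (N + 1)) *\<^sub>R g (N + 1) 0) \<le> 1 * norm (g (N + 1) 0)"
      unfolding norm_scaleR by (rule mult_right_mono) (auto simp del: fact_Suc simp: fact_ge_1)
    then show ?thesis using gN[of 0] by simp
  qed
  ultimately have "norm (g 0 1 - (\<Sum>n\<le>N. (1 / fact n) *\<^sub>R g n 0)) \<le> 3 * (C * P)"
    using norm_triangle_ineq[of "g 0 1 - (\<Sum>n\<le>N + 1. (1 / fact n) *\<^sub>R g n 0)" "(1 / fact (N + 1)) *\<^sub>R g (N + 1) 0"]
    by (simp add: algebra_simps del: fact_Suc)
  then show ?thesis by (simp add: g_def P_def mult_ac)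
qed

end

subsection \<open>Remainders that are uniform in the remaining arguments\<close>

text \<open>An O in the norm of \<open>j\<close>-linear maps, phrased with argument lists so that no
  space of multilinear maps has to be formed.\<close>

definition unif_O :: "nat \<Rightarrow> nat \<Rightarrow> ('k::real_normed_field \<Rightarrow> 'a::real_normed_vector list \<Rightarrow> 'b::real_normed_vector) \<Rightarrow> bool"
  where "unif_O j K F \<longleftrightarrow> (\<exists>C\<ge>0. \<forall>\<^sub>F \<epsilon> in nhds 0. \<forall>hs. length hs = j \<longrightarrow>
    norm (F \<epsilon> hs) \<le> C * norm \<epsilon> ^ K * prod_norm hs)"

lemma unif_O_mono:
  assumes "unif_O j K F" "L \<le> K"
  shows "unif_O j L F"
proof -
  obtain C where C: "C \<ge> 0" "\<forall>\<^sub>F \<epsilon> in nhds 0. \<forall>hs. length hs = j \<longrightarrow> norm (F \<epsilon> hs) \<le> C * norm \<epsilon> ^ K * prod_norm hs"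
    using assms unfolding unif_O_def by blast
  have "\<forall>\<^sub>F \<epsilon> in nhds (0::'a). norm \<epsilon> < 1"
    using eventually_nhds_metric by (metis dist_0_norm dist_commute zero_less_one)
  with C(2) have "\<forall>\<^sub>F \<epsilon> in nhds 0. \<forall>hs. length hs = j \<longrightarrow> norm (F \<epsilon> hs) \<le> C * norm \<epsilon> ^ L * prod_norm hs"
  proof eventually_elim
    case (elim \<epsilon>)
    have "norm \<epsilon> ^ K \<le> norm \<epsilon> ^ L" using elim assms(2) by (intro power_decreasing) auto
    then have "C * norm \<epsilon> ^ K * prod_norm hs \<le> C * norm \<epsilon> ^ L * prod_norm hs" for hs :: "'b list"
      using C(1) by (intro mult_right_mono mult_left_mono) auto
    then show ?case using elim order_trans by blast
  qed
  then show ?thesis using C(1) unfolding unif_O_def by blast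
qed

lemma unif_O_add:
  assumes "unif_O j K F" "unif_O j K G"
  shows "unif_O j K (\<lambda>\<epsilon> hs. F \<epsilon> hs + G \<epsilon> hs)"
proof -
  obtain C where C: "C \<ge> 0" "\<forall>\<^sub>F \<epsilon> in nhds 0. \<forall>hs. length hs = j \<longrightarrow> norm (F \<epsilon> hs) \<le> C * norm \<epsilon> ^ K * prod_norm hs"
    using assms unfolding unif_O_def by blast
  obtain D where D: "D \<ge> 0" "\<forall>\<^sub>F \<epsilon> in nhds 0. \<forall>hs. length hs = j \<longrightarrow> norm (G \<epsilon> hs) \<le> D * norm \<epsilon> ^ K * prod_norm hs"
    using assms unfolding unif_O_def by blast
  from C(2) D(2) have "\<forall>\<^sub>F \<epsilon> in nhds 0. \<forall>hs. length hs = j \<longrightarrow> norm (F \<epsilon> hs + G \<epsilon> hs) \<le> (C + D) * norm \<epsilon> ^ K * prod_norm hs"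
  proof eventually_elim
    case (elim \<epsilon>)
    then show ?case by (auto simp: distrib_right intro!: order_trans[OF norm_triangle_ineq] add_mono)
  qed
  then show ?thesis using C(1) D(1) unfolding unif_O_def by (intro exI[of _ "C + D"]) auto
qed

lemma unif_O_zero: "unif_O j K (\<lambda>\<epsilon> hs. 0)"
  unfolding unif_O_def by (intro exI[of _ 0]) auto

lemma unif_O_sum:
  "(\<And>i. i \<in> I \<Longrightarrow> unif_O j K (F i)) \<Longrightarrow> unif_O j K (\<lambda>\<epsilon> hs. \<Sum>i\<in>I. F i \<epsilon> hs)"
  by (induction I rule: infinite_finite_induct) (auto simp: unif_O_zero unif_O_add)

lemma unif_O_scaleR:
  assumes "unif_O j K F"
  shows "unif_O j K (\<lambda>\<epsilon> hs. r *\<^sub>R F \<epsilon> hs)"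
proof -
  obtain C where C: "C \<ge> 0" "\<forall>\<^sub>F \<epsilon> in nhds 0. \<forall>hs. length hs = j \<longrightarrow> norm (F \<epsilon> hs) \<le> C * norm \<epsilon> ^ K * prod_norm hs"
    using assms unfolding unif_O_def by blast
  from C(2) have "\<forall>\<^sub>F \<epsilon> in nhds 0. \<forall>hs. length hs = j \<longrightarrow> norm (r *\<^sub>R F \<epsilon> hs) \<le> (\<bar>r\<bar> * C) * norm \<epsilon> ^ K * prod_norm hs"
    by eventually_elim (auto simp: mult.assoc intro!: mult_left_mono)
  then show ?thesis using C(1) unfolding unif_O_def by (intro exI[of _ "\<bar>r\<bar> * C"]) auto
qed

lemma (in normed_space_over) unif_O_scale:
  fixes F :: "'k \<Rightarrow> 'x::real_normed_vector list \<Rightarrow> 'a"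
  assumes "unif_O j K F"
  shows "unif_O j (K + m) (\<lambda>\<epsilon> hs. scale (\<epsilon> ^ m) (F \<epsilon> hs))"
proof -
  obtain C where C: "C \<ge> 0" "\<forall>\<^sub>F \<epsilon> in nhds 0. \<forall>hs. length hs = j \<longrightarrow> norm (F \<epsilon> hs) \<le> C * norm \<epsilon> ^ K * prod_norm hs"
    using assms unfolding unif_O_def by blast
  from C(2) have "\<forall>\<^sub>F \<epsilon> in nhds 0. \<forall>hs. length hs = j \<longrightarrow> norm (scale (\<epsilon> ^ m) (F \<epsilon> hs)) \<le> C * norm \<epsilon> ^ (K + m) * prod_norm hs"
  proof eventually_elim
    case (elim \<epsilon>)
    show ?case
    proof (intro allI impI)
      fix hs :: "'x list" assume "length hs = j"
      then have "norm \<epsilon> ^ m * norm (F \<epsilon> hs) \<le> norm \<epsilon> ^ m * (C * norm \<epsilon> ^ K * prod_norm hs)"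
        using elim by (intro mult_left_mono) auto
      then show "norm (scale (\<epsilon> ^ m) (F \<epsilon> hs)) \<le> C * norm \<epsilon> ^ (K + m) * prod_norm hs"
        by (simp add: norm_scale norm_power power_add mult_ac)
    qed
  qed
  then show ?thesis using C(1) unfolding unif_O_def by blast
qed

lemma unif_O_prepend:
  assumes "unif_O (length ws + j) K F"
  shows "unif_O j K (\<lambda>\<epsilon> hs. F \<epsilon> (ws @ hs))"
proof -
  obtain C where C: "C \<ge> 0" "\<forall>\<^sub>F \<epsilon> in nhds 0. \<forall>hs. length hs = length ws + j \<longrightarrow> norm (F \<epsilon> hs) \<le> C * norm \<epsilon> ^ K * prod_norm hs"
    using assms unfolding unif_O_def by blast
  from C(2) have "\<forall>\<^sub>F \<epsilon> in nhds 0. \<forall>hs. length hs = j \<longrightarrow> norm (F \<epsilon> (ws @ hs)) \<le> (C * prod_norm ws) * norm \<epsilon> ^ K * prod_norm hs"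
  proof eventually_elim
    case (elim \<epsilon>)
    show ?case
    proof (intro allI impI)
      fix hs :: "'b list" assume "length hs = j"
      then show "norm (F \<epsilon> (ws @ hs)) \<le> (C * prod_norm ws) * norm \<epsilon> ^ K * prod_norm hs"
        using elim[rule_format, of "ws @ hs"] by (simp add: mult_ac)
    qed
  qed
  then show ?thesis using C(1) unfolding unif_O_def by (intro exI[of _ "C * prod_norm ws"]) auto
qed

text \<open>The coefficient of \<open>\<epsilon>\<^sup>i\<close> in the derivative \<open>hderiv f hs\<close> along the polynomial curve
  \<open>\<Sum>\<tau>=1..p. \<epsilon>\<^sup>\<tau> w \<tau>\<close>, obtained by expanding in the direction \<open>w p\<close> first. Expanding in one direction after the other
  produces the arguments in the order of \<^const>\<open>W_op\<close>, so that the symmetry of the derivatives is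
  never needed.\<close>

primrec curve_coeff ::
  "('a::real_normed_vector \<Rightarrow> 'b::real_normed_vector) \<Rightarrow> (nat \<Rightarrow> 'a) \<Rightarrow> nat \<Rightarrow> nat \<Rightarrow> 'a list \<Rightarrow> 'b"
  where
    "curve_coeff f w 0 i hs = (if i = 0 then hderiv f hs 0 else 0)"
  | "curve_coeff f w (Suc p) i hs =
      (\<Sum>n\<le>i div Suc p. (1 / fact n) *\<^sub>R curve_coeff f w p (i - Suc p * n) (replicate n (w (Suc p)) @ hs))"

text \<open>A direction \<open>w \<tau>\<close> carries \<epsilon>^\<tau>, so directions beyond
  \<open>i\<close> cannot contribute to the coefficient of \<epsilon>^i.\<close>

lemma curve_coeff_stable: "i \<le> p \<Longrightarrow> curve_coeff f w p i hs = curve_coeff f w i i hs"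
proof (induction p)
  case (Suc p)
  show ?case
  proof (cases "i = Suc p")
    case False
    then have "i div Suc p = 0" using Suc.prems by simp
    then show ?thesis using Suc False by simp
  qed simp
qed simp

lemma curve_coeff_zero: "curve_coeff f w p 0 hs = hderiv f hs 0"
  by (induction p arbitrary: hs) auto

text \<open>For the coefficient of \<epsilon>^m the direction \<open>w m\<close> can occur at most
  once, and then alone. This is the origin of the separate last summand in the recursion for
  \<open>Sbar\<close>.\<close>

lemma curve_coeff_top:
  assumes "m \<ge> 1"
  shows "curve_coeff f w m m hs = curve_coeff f w (m - 1) m hs + hderiv f (w m # hs) 0"
proof -
  obtain p where p: "m = Suc p" using assms by (cases m) auto
  show ?thesis by (simp add: p curve_coeff_zero del: hderiv.simps)
qed

lemma div_reindex:
  fixes F :: "nat \<Rightarrow> nat \<Rightarrow> 'a::comm_monoid_add"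
  assumes "0 < p"
  shows "(\<Sum>i\<le>K. \<Sum>n\<le>i div p. F n (i - p * n)) = (\<Sum>n\<le>K div p. \<Sum>i\<le>K - p * n. F n i)"
proof -
  have le: "n \<le> i div p \<longleftrightarrow> p * n \<le> i" for n i
    using assms by (simp add: less_eq_div_iff_mult_less_eq mult.commute)
  have "(\<Sum>(i, n)\<in>(SIGMA i:{..K}. {..i div p}). F n (i - p * n)) = (\<Sum>(n, i)\<in>(SIGMA n:{..K div p}. {..K - p * n}). F n i)"
    by (rule sum.reindex_bij_witness[of _ "\<lambda>(n, i). (i + p * n, n)" "\<lambda>(i, n). (n, i - p * n)"])
      (auto simp: le)
  then show ?thesis by (simp add: sum.Sigma)
qed

context smooth_map
begin

lemma curve_coeff_op:
  assumes "0 \<in> S" "length hs + i < q"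
  shows "bounded_op_on sX sY UNIV (\<lambda>h. curve_coeff f w p i (hs @ [h]))"
  using assms(2)
proof (induction p arbitrary: i hs)
  case 0
  then show ?case
    using hderiv_last_op[of hs 0] assms(1) bounded_op_on_zero[OF X.normed_space_over_axioms Y.normed_space_over_axioms]
    by (cases "i = 0") simp_all
next
  case (Suc p)
  have "bounded_op_on sX sY UNIV (\<lambda>h. \<Sum>n\<le>i div Suc p. (1 / fact n) *\<^sub>R
    curve_coeff f w p (i - Suc p * n) ((replicate n (w (Suc p)) @ hs) @ [h]))"
  proof (intro bounded_op_on_sum[OF X.normed_space_over_axioms Y.normed_space_over_axioms]
      bounded_op_on_scaleR[OF X.normed_space_over_axioms Y.normed_space_over_axioms] Suc.IH)
    fix n assume "n \<in> {..i div Suc p}"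
    then have "n * Suc p \<le> i" by (simp add: less_eq_div_iff_mult_less_eq)
    then show "length (replicate n (w (Suc p)) @ hs) + (i - Suc p * n) < q"
      using Suc.prems by (simp add: algebra_simps)
  qed
  then show ?case by simp
qed

text \<open>Induction on the number of directions: Taylor expansion in the newest one, then the
  induction hypothesis for each derivative that appears. With n copies of the new direction the
  number of arguments grows to j + n and the required order drops to K - (p+1) n, hence the
  generality in \<open>j\<close> and \<open>K\<close>.\<close>

lemma curve_expansion:
  assumes S: "S = UNIV" and "j + K + 1 \<le> q"
  shows "unif_O j (K + 1) (\<lambda>\<epsilon> hs. hderiv f hs (\<Sum>\<tau>=1..p. sX (\<epsilon> ^ \<tau>) (w \<tau>)) -
    (\<Sum>i\<le>K. sY (\<epsilon> ^ i) (curve_coeff f w p i hs)))"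
  using assms(2)
proof (induction p arbitrary: j K)
  case 0
  have "(\<Sum>i\<le>K. sY (\<epsilon> ^ i) (curve_coeff f w 0 i hs)) = hderiv f hs 0" for \<epsilon> hs
  proof -
    have "(\<Sum>i\<le>K. sY (\<epsilon> ^ i) (curve_coeff f w 0 i hs)) = (\<Sum>i\<le>K. if i = 0 then hderiv f hs 0 else 0)"
      by (intro sum.cong refl) auto
    then show ?thesis by simp
  qed
  then show ?case by (simp add: unif_O_zero)
next
  case (Suc p)
  \<comment> \<open>The largest number of copies of the new direction whose power of \<epsilon> does
    not exceed \<open>K\<close>; one more copy already belongs to the error.\<close>
  define N where "N = K div Suc p"
  define y where "y \<epsilon> = (\<Sum>\<tau>=1..p. sX (\<epsilon> ^ \<tau>) (w \<tau>))" for \<epsilon>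
  define u where "u \<epsilon> = sX (\<epsilon> ^ Suc p) (w (Suc p))" for \<epsilon>
  have N: "Suc p * N \<le> K" unfolding N_def by (rule times_div_less_eq_dividend)
  then have NK: "N \<le> K" by simp
  have le: "Suc p * n \<le> K" if "n \<le> N" for n using N that by (meson mult_le_mono2 order_trans)
  have "K < Suc p * (N + 1)"
    unfolding N_def using dividend_less_div_times[of "Suc p" K] by (simp add: algebra_simps)
  then have KN: "K + 1 \<le> Suc p * (N + 1)" by simp
  obtain C d where C: "C \<ge> 0" "d > 0" "\<And>z ks. z \<in> S \<Longrightarrow> norm (z - 0) < d \<Longrightarrow> length ks = j + N + 1 \<Longrightarrow>
      norm (hderiv f ks z) \<le> C * prod_norm ks"
    using hderiv_locally_bounded[of "j + N + 1" 0] Suc.prems NK S by auto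
  have lim: "((\<lambda>\<epsilon>. norm (y \<epsilon>) + norm (u \<epsilon>)) \<longlongrightarrow> 0) (nhds 0)"
  proof -
    have "(y \<longlongrightarrow> 0) (nhds 0)" "(u \<longlongrightarrow> 0) (nhds 0)"
      unfolding y_def u_def by (rule X.tendsto_scale_polynomial X.tendsto_scale_power; simp)+
    then have "((\<lambda>\<epsilon>. norm (y \<epsilon>) + norm (u \<epsilon>)) \<longlongrightarrow> norm (0::'a) + norm (0::'a)) (nhds 0)"
      by (intro tendsto_intros) simp_all
    then show ?thesis by simp
  qed
  have "\<forall>\<^sub>F \<epsilon> in nhds 0. norm (y \<epsilon>) + norm (u \<epsilon>) < d"
    by (rule order_tendstoD(2)[OF lim C(2)])
  then have "\<forall>\<^sub>F \<epsilon> in nhds 0. \<forall>hs. length hs = j \<longrightarrow>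
    norm (hderiv f hs (y \<epsilon> + u \<epsilon>) - (\<Sum>n\<le>N. (1 / fact n) *\<^sub>R hderiv f (replicate n (u \<epsilon>) @ hs) (y \<epsilon>)))
      \<le> (3 * C * norm (w (Suc p)) ^ (N + 1)) * norm \<epsilon> ^ (Suc p * (N + 1)) * prod_norm hs"
  proof eventually_elim
    case (elim \<epsilon>)
    show ?case
    proof (intro allI impI)
      fix hs :: "'a list" assume hs: "length hs = j"
      have "norm (hderiv f hs (y \<epsilon> + u \<epsilon>) - (\<Sum>n\<le>N. (1 / fact n) *\<^sub>R hderiv f (replicate n (u \<epsilon>) @ hs) (y \<epsilon>)))
        \<le> 3 * C * norm (u \<epsilon>) ^ (N + 1) * prod_norm hs"
      proof (rule hderiv_taylor)
        fix t :: real and ks :: "'a list" assume t: "t \<in> {0..1}" and ks: "length ks = length hs + N + 1"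
        have "norm (y \<epsilon> + t *\<^sub>R u \<epsilon>) \<le> norm (y \<epsilon>) + 1 * norm (u \<epsilon>)"
          using t by (intro order_trans[OF norm_triangle_ineq] add_left_mono) (auto intro!: mult_left_le_one_le)
        then show "norm (hderiv f ks (y \<epsilon> + t *\<^sub>R u \<epsilon>)) \<le> C * prod_norm ks"
          using elim ks hs by (intro C(3)) (auto simp: S)
      qed (use Suc.prems NK hs S in auto)
      also have "norm (u \<epsilon>) ^ (N + 1) = norm (w (Suc p)) ^ (N + 1) * norm \<epsilon> ^ (Suc p * (N + 1))"
        by (simp only: u_def X.norm_scale norm_power power_mult_distrib power_mult mult.commute)
      finally show "norm (hderiv f hs (y \<epsilon> + u \<epsilon>) - (\<Sum>n\<le>N. (1 / fact n) *\<^sub>R hderiv f (replicate n (u \<epsilon>) @ hs) (y \<epsilon>)))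
        \<le> (3 * C * norm (w (Suc p)) ^ (N + 1)) * norm \<epsilon> ^ (Suc p * (N + 1)) * prod_norm hs"
        by (simp only: mult.assoc)
    qed
  qed
  then have "unif_O j (Suc p * (N + 1)) (\<lambda>\<epsilon> hs. hderiv f hs (y \<epsilon> + u \<epsilon>) -
      (\<Sum>n\<le>N. (1 / fact n) *\<^sub>R hderiv f (replicate n (u \<epsilon>) @ hs) (y \<epsilon>)))"
    using C(1) unfolding unif_O_def by (intro exI[of _ "3 * C * norm (w (Suc p)) ^ (N + 1)"]) auto
  then have F1: "unif_O j (K + 1) (\<lambda>\<epsilon> hs. hderiv f hs (y \<epsilon> + u \<epsilon>) -
      (\<Sum>n\<le>N. (1 / fact n) *\<^sub>R hderiv f (replicate n (u \<epsilon>) @ hs) (y \<epsilon>)))"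
    by (rule unif_O_mono) (rule KN)
  have F2: "unif_O j (K + 1) (\<lambda>\<epsilon> hs. \<Sum>n\<le>N. (1 / fact n) *\<^sub>R sY (\<epsilon> ^ (Suc p * n)) (hderiv f (replicate n (w (Suc p)) @ hs) (y \<epsilon>) -
      (\<Sum>i\<le>K - Suc p * n. sY (\<epsilon> ^ i) (curve_coeff f w p i (replicate n (w (Suc p)) @ hs)))))"
  proof (intro unif_O_sum unif_O_scaleR)
    fix n assume "n \<in> {..N}"
    then have n: "Suc p * n \<le> K" using le by auto
    have "unif_O (j + n) (K - Suc p * n + 1) (\<lambda>\<epsilon> hs. hderiv f hs (y \<epsilon>) -
      (\<Sum>i\<le>K - Suc p * n. sY (\<epsilon> ^ i) (curve_coeff f w p i hs)))"
      unfolding y_def by (rule Suc.IH) (use n Suc.prems in \<open>auto simp: algebra_simps\<close>)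
    then have "unif_O j (K - Suc p * n + 1 + Suc p * n) (\<lambda>\<epsilon> hs. sY (\<epsilon> ^ (Suc p * n)) (hderiv f (replicate n (w (Suc p)) @ hs) (y \<epsilon>) -
      (\<Sum>i\<le>K - Suc p * n. sY (\<epsilon> ^ i) (curve_coeff f w p i (replicate n (w (Suc p)) @ hs)))))"
      by (intro Y.unif_O_scale unif_O_prepend[where F = "\<lambda>\<epsilon> hs. hderiv f hs (y \<epsilon>) -
      (\<Sum>i\<le>K - Suc p * n. sY (\<epsilon> ^ i) (curve_coeff f w p i hs))"]) (simp add: add.commute)
    moreover have "K - Suc p * n + 1 + Suc p * n = K + 1" using n by linarith
    ultimately show "unif_O j (K + 1) (\<lambda>\<epsilon> hs. sY (\<epsilon> ^ (Suc p * n)) (hderiv f (replicate n (w (Suc p)) @ hs) (y \<epsilon>) -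
      (\<Sum>i\<le>K - Suc p * n. sY (\<epsilon> ^ i) (curve_coeff f w p i (replicate n (w (Suc p)) @ hs)))))" by simp
  qed
  define F where "F \<epsilon> hs = (hderiv f hs (y \<epsilon> + u \<epsilon>) -
      (\<Sum>n\<le>N. (1 / fact n) *\<^sub>R hderiv f (replicate n (u \<epsilon>) @ hs) (y \<epsilon>))) +
     (\<Sum>n\<le>N. (1 / fact n) *\<^sub>R sY (\<epsilon> ^ (Suc p * n)) (hderiv f (replicate n (w (Suc p)) @ hs) (y \<epsilon>) -
      (\<Sum>i\<le>K - Suc p * n. sY (\<epsilon> ^ i) (curve_coeff f w p i (replicate n (w (Suc p)) @ hs)))))" for \<epsilon> hs
  have FO: "unif_O j (K + 1) F" unfolding F_def by (rule unif_O_add[OF F1 F2])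
  have Feq: "F \<epsilon> hs = hderiv f hs (\<Sum>\<tau>=1..Suc p. sX (\<epsilon> ^ \<tau>) (w \<tau>)) -
    (\<Sum>i\<le>K. sY (\<epsilon> ^ i) (curve_coeff f w (Suc p) i hs))" if hs: "length hs = j" for \<epsilon> hs
  proof -
    let ?c = "\<lambda>n i. curve_coeff f w p i (replicate n (w (Suc p)) @ hs)"
    have 1: "hderiv f (replicate n (u \<epsilon>) @ hs) (y \<epsilon>) = sY (\<epsilon> ^ (Suc p * n)) (hderiv f (replicate n (w (Suc p)) @ hs) (y \<epsilon>))"
      if "n \<le> N" for n
    proof -
      have "hderiv f ([] @ replicate n (sX (\<epsilon> ^ Suc p) (w (Suc p))) @ hs) (y \<epsilon>) =
        sY ((\<epsilon> ^ Suc p) ^ n) (hderiv f ([] @ replicate n (w (Suc p)) @ hs) (y \<epsilon>))"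
        by (rule hderiv_scale_replicate) (use that NK Suc.prems hs S in auto)
      then show ?thesis by (simp only: u_def power_mult append_Nil)
    qed
    have "(\<Sum>i\<le>K. sY (\<epsilon> ^ i) (curve_coeff f w (Suc p) i hs)) =
      (\<Sum>i\<le>K. \<Sum>n\<le>i div Suc p. (1 / fact n) *\<^sub>R sY (\<epsilon> ^ (Suc p * n)) (sY (\<epsilon> ^ (i - Suc p * n)) (?c n (i - Suc p * n))))"
    proof (intro sum.cong refl)
      fix i
      have *: "\<epsilon> ^ i = \<epsilon> ^ (Suc p * n) * \<epsilon> ^ (i - Suc p * n)" if "n \<le> i div Suc p" for n
      proof -
        have "Suc p * n \<le> i" using that by (metis less_eq_div_iff_mult_less_eq mult.commute zero_less_Suc)
        then show ?thesis by (metis le_add_diff_inverse power_add)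
      qed
      show "sY (\<epsilon> ^ i) (curve_coeff f w (Suc p) i hs) = (\<Sum>n\<le>i div Suc p. (1 / fact n) *\<^sub>R sY (\<epsilon> ^ (Suc p * n)) (sY (\<epsilon> ^ (i - Suc p * n)) (?c n (i - Suc p * n))))"
        unfolding curve_coeff.simps Y.scale_sum_right
        by (intro sum.cong refl) (simp only: Y.scale_scaleR Y.scale_scale *[symmetric] atMost_iff)
    qed
    also have "\<dots> = (\<Sum>n\<le>N. \<Sum>i\<le>K - Suc p * n. (1 / fact n) *\<^sub>R sY (\<epsilon> ^ (Suc p * n)) (sY (\<epsilon> ^ i) (?c n i)))"
      unfolding N_def by (rule div_reindex) simp
    finally have 2: "(\<Sum>i\<le>K. sY (\<epsilon> ^ i) (curve_coeff f w (Suc p) i hs)) =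
       (\<Sum>n\<le>N. (1 / fact n) *\<^sub>R sY (\<epsilon> ^ (Suc p * n)) (\<Sum>i\<le>K - Suc p * n. sY (\<epsilon> ^ i) (?c n i)))"
      by (simp only: Y.scale_sum_right scaleR_sum_right)
    have 3: "(\<Sum>n\<le>N. (1 / fact n) *\<^sub>R hderiv f (replicate n (u \<epsilon>) @ hs) (y \<epsilon>)) =
      (\<Sum>n\<le>N. (1 / fact n) *\<^sub>R sY (\<epsilon> ^ (Suc p * n)) (hderiv f (replicate n (w (Suc p)) @ hs) (y \<epsilon>)))"
      by (intro sum.cong refl) (simp only: 1 atMost_iff)
    have 4: "(\<Sum>\<tau>=1..Suc p. sX (\<epsilon> ^ \<tau>) (w \<tau>)) = y \<epsilon> + u \<epsilon>" by (simp add: y_def u_def)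
    show ?thesis unfolding F_def 2 3 4
      by (simp only: Y.scale_right_diff_distrib scaleR_diff_right sum_subtractf) simp
  qed
  \<comment> \<open>\<open>F\<close> agrees with the desired difference only on lists of length
    \<open>j\<close>, and \<open>unif_O\<close> looks at no others.\<close>
  show ?case using FO unfolding unif_O_def by (simp only: Feq cong: imp_cong)
qed

end

section \<open>The fine resolution without factorials\<close>

definition multi_indices :: "nat \<Rightarrow> nat \<Rightarrow> nat \<Rightarrow> (nat \<Rightarrow> nat) set"
  where "multi_indices b p i = {n \<in> {1..p} \<rightarrow>\<^sub>E {..b}. (\<Sum>\<tau>=1..p. \<tau> * n \<tau>) = i}"

lemma finite_multi_indices: "finite (multi_indices b p i)"
  unfolding multi_indices_def by (rule finite_subset[of _ "{1..p} \<rightarrow>\<^sub>E {..b}"]) (auto intro: finite_PiE)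

text \<open>Splits off the exponent of the last direction. Index functions are extensional, so
  removing a component means resetting it to \<open>undefined\<close>. The bound \<open>b\<close>
  stays fixed while \<open>i\<close> decreases, and i \<le> b ensures that the split exponent is
  admissible.\<close>

lemma multi_indices_Suc:
  fixes F :: "nat \<Rightarrow> (nat \<Rightarrow> nat) \<Rightarrow> 'a::comm_monoid_add"
  assumes "i \<le> b"
  shows "(\<Sum>n\<le>i div Suc p. \<Sum>g\<in>multi_indices b p (i - Suc p * n). F n g) =
    (\<Sum>g\<in>multi_indices b (Suc p) i. F (g (Suc p)) (g(Suc p := undefined)))"
proof -
  have le: "n \<le> i div Suc p \<longleftrightarrow> Suc p * n \<le> i" for n
    by (simp add: less_eq_div_iff_mult_less_eq mult.commute del: mult_Suc mult_Suc_right)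
  have upd: "(\<Sum>\<tau>=1..p. \<tau> * (g(Suc p := n)) \<tau>) = (\<Sum>\<tau>=1..p. \<tau> * g \<tau>)" for g n
    by (rule sum.cong) auto
  have split: "(\<Sum>\<tau>=1..Suc p. \<tau> * h \<tau>) = (\<Sum>\<tau>=1..p. \<tau> * h \<tau>) + Suc p * h (Suc p)" for h :: "nat \<Rightarrow> nat"
    by simp
  have "(\<Sum>(n, g)\<in>(SIGMA n:{..i div Suc p}. multi_indices b p (i - Suc p * n)). F n g) =
     (\<Sum>g\<in>multi_indices b (Suc p) i. F (g (Suc p)) (g(Suc p := undefined)))"
  proof (rule sum.reindex_bij_witness[of _ "\<lambda>g. (g (Suc p), g(Suc p := undefined))" "\<lambda>(n, g). g(Suc p := n)"])
    fix a assume a: "a \<in> (SIGMA n:{..i div Suc p}. multi_indices b p (i - Suc p * n))"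
    obtain n g where ng: "a = (n, g)" by (cases a)
    have n: "Suc p * n \<le> i" and g: "g \<in> {1..p} \<rightarrow>\<^sub>E {..b}" and s: "(\<Sum>\<tau>=1..p. \<tau> * g \<tau>) = i - Suc p * n"
      using a unfolding ng multi_indices_def mem_Sigma_iff atMost_iff le by auto
    have nb: "n \<le> b" using n assms by simp
    have gu: "g (Suc p) = undefined" using PiE_arb[OF g, of "Suc p"] by simp
    show "((case a of (n, g) \<Rightarrow> g(Suc p := n)) (Suc p), (case a of (n, g) \<Rightarrow> g(Suc p := n))(Suc p := undefined)) = a"
      using gu by (simp add: ng fun_eq_iff)
    have "g(Suc p := n) \<in> {1..Suc p} \<rightarrow>\<^sub>E {..b}"
      using g nb by (auto simp: PiE_iff extensional_def)
    moreover have "(\<Sum>\<tau>=1..Suc p. \<tau> * (g(Suc p := n)) \<tau>) = i" unfolding split upd s using n by simp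
    ultimately show "(case a of (n, g) \<Rightarrow> g(Suc p := n)) \<in> multi_indices b (Suc p) i"
      unfolding ng multi_indices_def by simp
    show "F ((case a of (n, g) \<Rightarrow> g(Suc p := n)) (Suc p)) ((case a of (n, g) \<Rightarrow> g(Suc p := n))(Suc p := undefined)) = (case a of (n, g) \<Rightarrow> F n g)"
      using gu by (simp add: ng) (metis fun_upd_triv)
  next
    fix g assume g: "g \<in> multi_indices b (Suc p) i"
    have gE: "g \<in> {1..Suc p} \<rightarrow>\<^sub>E {..b}" and s: "(\<Sum>\<tau>=1..p. \<tau> * g \<tau>) + Suc p * g (Suc p) = i"
      using g unfolding multi_indices_def mem_Collect_eq split by blast+
    show "(case (g (Suc p), g(Suc p := undefined)) of (n, g) \<Rightarrow> g(Suc p := n)) = g" by simp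
    have "g(Suc p := undefined) \<in> {1..p} \<rightarrow>\<^sub>E {..b}"
      using gE by (auto simp: PiE_iff extensional_def)
    moreover have "(\<Sum>\<tau>=1..p. \<tau> * (g(Suc p := undefined)) \<tau>) = i - Suc p * g (Suc p)"
      unfolding upd using s by simp
    moreover have "g (Suc p) \<le> i div Suc p" unfolding le using s by linarith
    ultimately show "(g (Suc p), g(Suc p := undefined)) \<in> (SIGMA n:{..i div Suc p}. multi_indices b p (i - Suc p * n))"
      unfolding multi_indices_def by simp
  qed
  then show ?thesis by (simp add: sum.Sigma finite_multi_indices del: mult_Suc)
qed

lemma curve_coeff_explicit:
  assumes "i \<le> b"
  shows "curve_coeff f w p i hs = (\<Sum>n\<in>multi_indices b p i. (1 / (\<Prod>\<tau>=1..p. fact (n \<tau>))) *\<^sub>R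
    hderiv f (concat (map (\<lambda>\<tau>. replicate (n \<tau>) (w \<tau>)) [1..<Suc p]) @ hs) 0)"
  using assms
proof (induction p arbitrary: i hs)
  case 0
  have "multi_indices b 0 i = (if i = 0 then {\<lambda>_. undefined} else {})"
    by (auto simp: multi_indices_def)
  then show ?case by simp
next
  case (Suc p)
  let ?W = "\<lambda>n. concat (map (\<lambda>\<tau>. replicate (n \<tau>) (w \<tau>)) [1..<Suc p])"
  have "curve_coeff f w (Suc p) i hs = (\<Sum>m\<le>i div Suc p. \<Sum>n\<in>multi_indices b p (i - Suc p * m).
    (1 / fact m) *\<^sub>R (1 / (\<Prod>\<tau>=1..p. fact (n \<tau>))) *\<^sub>R hderiv f (?W n @ replicate m (w (Suc p)) @ hs) 0)"
  proof -
    have "i - Suc p * m \<le> b" for m using Suc.prems by (simp add: le_diff_conv)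
    then show ?thesis
      unfolding curve_coeff.simps scaleR_sum_right[symmetric]
      by (intro sum.cong refl) (simp only: Suc.IH)
  qed
  also have "\<dots> = (\<Sum>n\<in>multi_indices b (Suc p) i. (1 / fact (n (Suc p))) *\<^sub>R (1 / (\<Prod>\<tau>=1..p. fact ((n(Suc p := undefined)) \<tau>))) *\<^sub>R
      hderiv f (?W (n(Suc p := undefined)) @ replicate (n (Suc p)) (w (Suc p)) @ hs) 0)"
    by (rule multi_indices_Suc[OF Suc.prems])
  also have "\<dots> = (\<Sum>n\<in>multi_indices b (Suc p) i. (1 / (\<Prod>\<tau>=1..Suc p. fact (n \<tau>))) *\<^sub>R
    hderiv f (concat (map (\<lambda>\<tau>. replicate (n \<tau>) (w \<tau>)) [1..<Suc (Suc p)]) @ hs) 0)"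
  proof (rule sum.cong[OF refl])
    fix n
    have 1: "?W (n(Suc p := undefined)) = ?W n"
      by (intro arg_cong[of _ _ concat] map_cong) auto
    have 2: "(\<Prod>\<tau>=1..p. fact ((n(Suc p := undefined)) \<tau>)) = (\<Prod>\<tau>=1..p. fact (n \<tau>) :: real)"
      by (rule prod.cong) auto
    show "(1 / fact (n (Suc p))) *\<^sub>R (1 / (\<Prod>\<tau>=1..p. fact ((n(Suc p := undefined)) \<tau>))) *\<^sub>R
      hderiv f (?W (n(Suc p := undefined)) @ replicate (n (Suc p)) (w (Suc p)) @ hs) 0 =
      (1 / (\<Prod>\<tau>=1..Suc p. fact (n \<tau>))) *\<^sub>R
      hderiv f (concat (map (\<lambda>\<tau>. replicate (n \<tau>) (w \<tau>)) [1..<Suc (Suc p)]) @ hs) 0"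
      unfolding 1 2 by (simp add: mult.commute)
  qed
  finally show ?case .
qed

text \<open>The order of the derivative is determined by the multi-index as the number of factors
  plus one. The sum over it only groups the multi-indices, and its range 1..2m covers them
  all.\<close>

lemma W_op_curve_coeff:
  assumes "1 \<le> m" "m \<le> \<mu>" "\<mu> \<le> 2 * m"
  shows "W_op G m \<mu> z x = (fact (2 * m) / fact \<mu>) *\<^sub>R
    curve_coeff G (\<lambda>\<tau>. (1 / fact \<tau>) *\<^sub>R z \<tau>) (m - 1) (2 * m - \<mu>) [x]"
proof -
  define h where "h n = (fact (2 * m) / (\<Prod>i=1..m-1. fact (n i))) *\<^sub>R
      hderiv G (concat (map (\<lambda>\<tau>. replicate (n \<tau>) ((1 / fact \<tau>) *\<^sub>R z \<tau>)) [1..<m]) @ [x]) 0" for n :: "nat \<Rightarrow> nat"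
  define I where "I = multi_indices (2 * m) (m - 1) (2 * m - \<mu>)"
  have W: "W_indices m \<mu> \<beta> = {n \<in> I. (\<Sum>i=1..m-1. n i) + 1 = \<beta>}" for \<beta>
    using assms by (auto simp: W_indices_def I_def multi_indices_def)
  have "(\<Sum>i=1..m-1. n i) + 1 \<in> {1..2*m}" if "n \<in> I" for n
  proof -
    have "(\<Sum>i=1..m-1. n i) \<le> (\<Sum>i=1..m-1. i * n i)" by (rule sum_mono) auto
    also have "\<dots> = 2 * m - \<mu>" using that by (simp add: I_def multi_indices_def)
    finally show ?thesis using assms by auto
  qed
  then have "(\<lambda>n. (\<Sum>i=1..m-1. n i) + 1) ` I \<subseteq> {1..2*m}" by blast
  then have "(\<Sum>\<beta>=1..2*m. \<Sum>n\<in>{n \<in> I. (\<Sum>i=1..m-1. n i) + 1 = \<beta>}. h n) = sum h I"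
    by (intro sum.group) (auto simp: I_def finite_multi_indices)
  then have "W_op G m \<mu> z x = (1 / fact \<mu>) *\<^sub>R sum h I"
    unfolding W_op_def h_def[symmetric] W by simp
  moreover have "sum h I = fact (2 * m) *\<^sub>R curve_coeff G (\<lambda>\<tau>. (1 / fact \<tau>) *\<^sub>R z \<tau>) (m - 1) (2 * m - \<mu>) [x]"
    using assms(1)
    by (subst curve_coeff_explicit[of _ "2 * m"]) (auto simp: I_def scaleR_sum_right h_def)
  ultimately show ?thesis by simp
qed

lemma W_indices_sum: "n \<in> W_indices m \<mu> \<beta> \<Longrightarrow> (\<Sum>i=1..m-1. n i) + 1 = \<beta>"
  unfolding W_indices_def by blast

lemma (in smooth_map) W_op_op:
  assumes "0 \<in> S" "2 * m \<le> q" "1 \<le> m"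
  shows "bounded_op_on sX sY UNIV (W_op f m \<mu> z)"
proof -
  note s = X.normed_space_over_axioms Y.normed_space_over_axioms
  have "bounded_op_on sX sY UNIV (\<lambda>x. (1 / fact \<mu>) *\<^sub>R (\<Sum>\<beta>=1..2*m. \<Sum>n\<in>W_indices m \<mu> \<beta>.
    (fact (2 * m) / (\<Prod>i=1..m-1. fact (n i))) *\<^sub>R
      hderiv f (concat (map (\<lambda>\<tau>. replicate (n \<tau>) ((1 / fact \<tau>) *\<^sub>R z \<tau>)) [1..<m]) @ [x]) 0))"
  proof (intro bounded_op_on_scaleR[OF s] bounded_op_on_sum[OF s] hderiv_last_op assms(1))
    fix \<beta> n assume \<beta>: "\<beta> \<in> {1..2*m}" and n: "n \<in> W_indices m \<mu> \<beta>"
    have "length (concat (map (\<lambda>\<tau>. replicate (n \<tau>) ((1 / fact \<tau>) *\<^sub>R z \<tau>)) [1..<m])) = (\<Sum>\<tau>\<in>set [1..<m]. n \<tau>)"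
      by (simp add: length_concat o_def sum_list_distinct_conv_sum_set)
    also have "set [1..<m] = {1..m-1}" using assms(3) by auto
    finally show "length (concat (map (\<lambda>\<tau>. replicate (n \<tau>) ((1 / fact \<tau>) *\<^sub>R z \<tau>)) [1..<m])) < q"
      using W_indices_sum[OF n] \<beta> assms(2) by simp
  qed
  moreover have "W_op f m \<mu> z = (\<lambda>x. (1 / fact \<mu>) *\<^sub>R (\<Sum>\<beta>=1..2*m. \<Sum>n\<in>W_indices m \<mu> \<beta>.
    (fact (2 * m) / (\<Prod>i=1..m-1. fact (n i))) *\<^sub>R
      hderiv f (concat (map (\<lambda>\<tau>. replicate (n \<tau>) ((1 / fact \<tau>) *\<^sub>R z \<tau>)) [1..<m]) @ [x]) 0))"
    by (rule ext) (simp only: W_op_def)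
  ultimately show ?thesis by simp
qed

text \<open>The part of 1 / \<open>cnum m l\<close> that depends on \<open>l\<close> alone. Putting
  it into the entries of \<open>E\<close> leaves only quotients of factorials in the conjugated
  matrices.\<close>

definition scaling :: "nat \<Rightarrow> real"
  where "scaling i = fact (2 * i - 2) / fact (i - 1)"

lemma scaling_pos: "scaling i > 0"
  by (simp add: scaling_def)

lemma cnum_scaling:
  assumes "l \<le> m + 1"
  shows "cnum m l = fact m / (fact (m - (l - 1)) * scaling l)"
proof -
  have "l - 1 \<le> m" "l - 1 \<le> 2 * l - 2" "2 * l - 2 - (l - 1) = l - 1" using assms by auto
  then show ?thesis unfolding cnum_def scaling_def
    by (simp add: binomial_fact field_simps)
qed

section \<open>Operators of the fine resolution and their rescaled form\<close>

locale transversal_resolution = resolution_data G zb Nc R Rc + G: smooth_map sB sC q UNIV G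
  for G :: "'b::banach \<Rightarrow> 'c::banach" and zb :: "nat \<Rightarrow> 'b" and Nc :: "nat \<Rightarrow> 'b set" and R Rc :: "nat \<Rightarrow> 'c set"
    and sB :: "'k::real_or_complex \<Rightarrow> 'b \<Rightarrow> 'b" and sC :: "'k \<Rightarrow> 'c \<Rightarrow> 'c" and q :: nat +
  fixes k :: nat and N :: "nat \<Rightarrow> 'b set"
  assumes k: "1 \<le> k" and q: "2 * k + 2 \<le> q"
    and res: "fine_resolution sB sC k N" and transversal: "Rc (k + 1) = {0}"
begin

lemma sBC: "normed_space_over sB" "normed_space_over sC"
  using G.X.normed_space_over_axioms G.Y.normed_space_over_axioms by auto

lemma res_step:
  assumes "1 \<le> i" "i \<le> k + 1"
  shows "N i = {x \<in> N (i - 1). S_op i x = 0}" "R i = S_op i ` N (i - 1)" "GL_on sB sC (Nc i) (R i) (S_op i)"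
    "top_direct_sum sB (N (i - 1)) (Nc i) (N i)" "top_direct_sum sC (Rc (i - 1)) (R i) (Rc i)"
proof -
  have "i \<in> {1..k+1}" using assms by simp
  then have "N i = {x \<in> N (i - 1). S_op i x = 0} \<and> R i = S_op i ` N (i - 1) \<and>
      top_direct_sum sB (N (i - 1)) (Nc i) (N i) \<and> top_direct_sum sC (Rc (i - 1)) (R i) (Rc i) \<and>
      GL_on sB sC (Nc i) (R i) (S_op i)"
    using res unfolding fine_resolution_def by blast
  then show "N i = {x \<in> N (i - 1). S_op i x = 0}" "R i = S_op i ` N (i - 1)" "GL_on sB sC (Nc i) (R i) (S_op i)"
    "top_direct_sum sB (N (i - 1)) (Nc i) (N i)" "top_direct_sum sC (Rc (i - 1)) (R i) (Rc i)"
    by blast+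
qed

lemma N_Rc_0: "N 0 = UNIV" "Rc 0 = UNIV"
  using res unfolding fine_resolution_def by blast+

sublocale B: nested_sums sB Nc N "k + 1"
  by unfold_locales (fact N_Rc_0 res_step)+

sublocale C: nested_sums sC R Rc "k + 1"
  by unfold_locales (fact N_Rc_0 res_step)+

lemma P_Rc_rest: "P_Rc j y = rest_proj R Rc j y"
  by (induction j) auto

lemma P_R_summand: "P_R i y = summand_proj R Rc i y"
  by (simp add: P_R_def summand_proj_def P_Rc_rest)

definition w :: "nat \<Rightarrow> 'b" where "w \<tau> = (1 / fact \<tau>) *\<^sub>R zb \<tau>"

text \<open>Coefficient of \<epsilon>^i in the derivative of \<open>G\<close> along the polynomial
  with coefficients \<open>zb\<close>. It is defined from \<open>zb\<close> only; the comparison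
  with derivatives along \<open>z0\<close> is made separately.\<close>

definition T :: "nat \<Rightarrow> 'b \<Rightarrow> 'c" where "T i x = curve_coeff G w i i [x]"

definition e :: "nat \<Rightarrow> nat \<Rightarrow> 'b \<Rightarrow> 'b"
  where "e i j x = (scaling i / scaling j) *\<^sub>R E i j x"

abbreviation S_inv :: "nat \<Rightarrow> 'c \<Rightarrow> 'b"
  where "S_inv i \<equiv> the_inv_into (Nc i) (S_op i)"

abbreviation "\<mu> \<equiv> chain_coeff e"

lemma T_op: "i \<le> k \<Longrightarrow> bounded_op_on sB sC UNIV (T i)"
  using G.curve_coeff_op[of "[]" i w i] q by (simp add: T_def[abs_def])

lemma S_inv_op: "1 \<le> i \<Longrightarrow> i \<le> k + 1 \<Longrightarrow> bounded_op_on sC sB (R i) (S_inv i)"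
  using res_step(3) unfolding GL_on_def by blast

lemma S_bij: "1 \<le> i \<Longrightarrow> i \<le> k + 1 \<Longrightarrow> bij_betw (S_op i) (Nc i) (R i)"
  using res_step(3) unfolding GL_on_def by blast

lemma S_inv_in: "1 \<le> i \<Longrightarrow> i \<le> k + 1 \<Longrightarrow> y \<in> R i \<Longrightarrow> S_inv i y \<in> Nc i"
  using S_bij[of i] by (auto simp: bij_betw_def intro: the_inv_into_into)

lemma S_S_inv: "1 \<le> i \<Longrightarrow> i \<le> k + 1 \<Longrightarrow> y \<in> R i \<Longrightarrow> S_op i (S_inv i y) = y"
  using S_bij[of i] by (auto simp: bij_betw_def intro: f_the_inv_into_f)

lemma S_inv_S: "1 \<le> i \<Longrightarrow> i \<le> k + 1 \<Longrightarrow> x \<in> Nc i \<Longrightarrow> S_inv i (S_op i x) = x"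
  using S_bij[of i] by (auto simp: bij_betw_def intro: the_inv_into_f_f)

lemma E_diag: "E j j x = x" by (simp add: E.simps)

lemma E_less: "i < j \<Longrightarrow> E i j x = - S_inv i (summand_proj R Rc i (\<Sum>v=i+1..j. Sbar v (E v j x)))"
  by (subst E.simps) (simp add: S_op_def P_R_summand)

lemma E_greater: "j < i \<Longrightarrow> E i j x = 0" by (simp add: E.simps)

lemma E_in: "1 \<le> i \<Longrightarrow> i < j \<Longrightarrow> j \<le> k + 1 \<Longrightarrow> E i j x \<in> Nc i"
  unfolding E_less by (intro G.X.subspace_uminus B.subspace_Y S_inv_in C.summand_proj_in) auto

text \<open>The three statements are proved together because the recursion is mutual:
  \<open>Sbar n\<close> uses \<open>E\<close> and \<open>M\<close> of smaller index,
  \<open>E i n\<close> uses \<open>Sbar\<close> up to \<open>n\<close>, and \<open>M n\<close> uses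
  \<open>E\<close> up to column \<open>n\<close> and \<open>M (n - 1)\<close>.\<close>

lemma ops:
  "1 \<le> n \<Longrightarrow> n \<le> k + 1 \<Longrightarrow> bounded_op_on sB sC UNIV (Sbar n) \<and>
    (\<forall>i. 1 \<le> i \<longrightarrow> i \<le> n \<longrightarrow> bounded_op_on sB sB UNIV (E i n)) \<and>
    (\<forall>r s. 1 \<le> s \<longrightarrow> s \<le> n \<longrightarrow> bounded_op_on sB sB UNIV (M n r s))"
proof (induction n rule: less_induct)
  case (less n)
  note zB = bounded_op_on_zero[OF sBC(1) sBC(1)]
  have Sb: "bounded_op_on sB sC UNIV (Sbar v)" if "1 \<le> v" "v < n" for v
    using less.IH[of v] less.prems that by auto
  have Eb: "bounded_op_on sB sB UNIV (E i v)" if "1 \<le> i" "1 \<le> v" "v < n" for i v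
  proof (cases "i \<le> v")
    case False
    then have "E i v = (\<lambda>x. 0)" using E_greater by (intro ext) auto
    then show ?thesis using zB by simp
  qed (use less that in auto)
  have conj_op: "bounded_op_on sB sB UNIV (conj_entry m i j f)" if "bounded_op_on sB sB UNIV f" for m i j f
    unfolding conj_entry_def by (rule bounded_op_on_scaleR[OF sBC(1) sBC(1) that])
  note comp = bounded_op_on_compose_UNIV
  have S: "bounded_op_on sB sC UNIV (Sbar n)"
  proof -
    consider "n = 1" | "n = 2" | "n \<ge> 3" using less.prems by linarith
    then show ?thesis
    proof cases
      case 1
      then have "Sbar n = (\<lambda>x. hderiv G ([] @ [x]) 0)" by (intro ext) (simp add: Sbar.simps)
      then show ?thesis using G.hderiv_last_op[of "[]" 0] q by simp
    next
      case 2
      then have "Sbar n = (\<lambda>x. 2 *\<^sub>R hderiv G ([zb 1] @ [x]) 0)" by (intro ext) (simp add: Sbar.simps)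
      then show ?thesis using bounded_op_on_scaleR[OF sBC G.hderiv_last_op[of "[zb 1]" 0]] q by simp
    next
      case 3
      define m where "m = n - 1"
      have m: "2 \<le> m" "m \<le> k" "m < n" using 3 less.prems by (auto simp: m_def)
      have "bounded_op_on sB sC UNIV (\<lambda>x.
         W_op G m (2*m - 1) zb (conj_entry (2*m - 1) 1 m (E 1 m) x)
         + (\<Sum>r=1..m-1. W_op G m (2*m - 1 - r) zb
             (\<Sum>s=1..m-1. M (m - 1) r s (conj_entry (2*m - 1) (s + 1) m (E (s + 1) m) x)))
         + (fact (2*m) / (fact m)\<^sup>2) *\<^sub>R hderiv G ([zb m] @ [x]) 0)"
      proof (rule bounded_op_on_plus[OF sBC], rule bounded_op_on_plus[OF sBC])
        have W: "bounded_op_on sB sC UNIV (W_op G m \<nu> zb)" for \<nu>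
          by (rule G.W_op_op) (use m q in auto)
        show "bounded_op_on sB sC UNIV (\<lambda>x. W_op G m (2*m - 1) zb (conj_entry (2*m - 1) 1 m (E 1 m) x))"
          by (rule comp[OF W conj_op[OF Eb]]) (use m in auto)
        show "bounded_op_on sB sC UNIV (\<lambda>x. \<Sum>r=1..m-1. W_op G m (2*m - 1 - r) zb
             (\<Sum>s=1..m-1. M (m - 1) r s (conj_entry (2*m - 1) (s + 1) m (E (s + 1) m) x)))"
        proof (rule bounded_op_on_sum[OF sBC], rule comp[OF W], rule bounded_op_on_sum[OF sBC(1) sBC(1)])
          fix r s assume "r \<in> {1..m-1}" and s: "s \<in> {1..m-1}"
          have "bounded_op_on sB sB UNIV (M (m - 1) r s)"
            using less.IH[of "m - 1"] m less.prems s by auto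
          then show "bounded_op_on sB sB UNIV (\<lambda>x. M (m - 1) r s (conj_entry (2*m - 1) (s + 1) m (E (s + 1) m) x))"
            by (rule comp[OF _ conj_op[OF Eb]]) (use m in auto)
        qed
        show "bounded_op_on sB sC UNIV (\<lambda>x. (fact (2*m) / (fact m)\<^sup>2) *\<^sub>R hderiv G ([zb m] @ [x]) 0)"
          by (rule bounded_op_on_scaleR[OF sBC G.hderiv_last_op]) (use q k in auto)
      qed
      moreover have "Sbar n = (\<lambda>x.
         W_op G m (2*m - 1) zb (conj_entry (2*m - 1) 1 m (E 1 m) x)
         + (\<Sum>r=1..m-1. W_op G m (2*m - 1 - r) zb
             (\<Sum>s=1..m-1. M (m - 1) r s (conj_entry (2*m - 1) (s + 1) m (E (s + 1) m) x)))
         + (fact (2*m) / (fact m)\<^sup>2) *\<^sub>R hderiv G ([zb m] @ [x]) 0)"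
        using 3 by (subst Sbar.simps) (simp add: Let_def m_def)
      ultimately show ?thesis by simp
    qed
  qed
  have En: "bounded_op_on sB sB UNIV (E i n)" if "1 \<le> i" "i \<le> n" for i
    using that
  \<comment> \<open>Within column \<open>n\<close> the entries are built from the diagonal
    upwards.\<close>
  proof (induction "n - i" arbitrary: i rule: less_induct)
    case (less i)
    show ?case
    proof (cases "i = n")
      case True
      then have "E i n = (\<lambda>x. x)" by (simp add: E.simps)
      then show ?thesis by (simp add: bounded_op_on_id)
    next
      case False
      then have i: "1 \<le> i" "i < n" using less.prems by auto
      have sum: "bounded_op_on sB sC UNIV (\<lambda>x. \<Sum>v=i+1..n. Sbar v (E v n x))"
      proof (rule bounded_op_on_sum[OF sBC])
        fix v assume v: "v \<in> {i+1..n}"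
        have "bounded_op_on sB sC UNIV (Sbar v)" using S Sb v i by (cases "v = n") auto
        moreover have "bounded_op_on sB sB UNIV (E v n)" by (rule less.hyps) (use v i in auto)
        ultimately show "bounded_op_on sB sC UNIV (\<lambda>x. Sbar v (E v n x))" by (rule comp)
      qed
      have ik: "i \<le> k + 1" using i \<open>n \<le> k + 1\<close> by simp
      have "bounded_op_on sB sB UNIV (\<lambda>x. - S_inv i (summand_proj R Rc i (\<Sum>v=i+1..n. Sbar v (E v n x))))"
        by (rule bounded_op_on_uminus[OF sBC(1) sBC(1)], rule bounded_op_on_compose[OF _ S_inv_op[OF i(1) ik]],
            rule comp[OF C.bounded_op_summand_proj[OF i(1) ik] sum], rule C.summand_proj_in[OF i(1) ik])
      moreover have "E i n = (\<lambda>x. - S_inv i (summand_proj R Rc i (\<Sum>v=i+1..n. Sbar v (E v n x))))"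
        using i by (intro ext) (simp add: E_less)
      ultimately show ?thesis by simp
    qed
  qed
  have En': "bounded_op_on sB sB UNIV (E i v)" if "1 \<le> i" "1 \<le> v" "v \<le> n" for i v
  proof (cases "v = n \<and> i > n")
    case True
    then have "E i v = (\<lambda>x. 0)" using E_greater by (intro ext) auto
    then show ?thesis using zB by simp
  next
    case False
    then show ?thesis using that Eb[of i v] En[of i] by (cases "v = n") auto
  qed
  have Mn: "bounded_op_on sB sB UNIV (M n r s)" if "1 \<le> s" "s \<le> n" for r s
  proof -
    consider "n = 1" | "n > 1" "r = 1" | "n > 1" "r = 2" | "n > 1" "r \<noteq> 1" "r \<noteq> 2" using less.prems by linarith
    then show ?thesis
    proof cases
      case 1
      then have "M n r s = (\<lambda>x. x)" by (simp add: M.simps)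
      then show ?thesis by (simp add: bounded_op_on_id)
    next
      case 2
      then have "M n r s = conj_entry (2*n) 1 s (E 1 s)" by (simp add: M.simps)
      then show ?thesis using conj_op[OF En'] that by simp
    next
      case 3
      then have "M n r s = (\<lambda>x.
         \<Sum>t=1..n-1. conj_entry (2*n - 1) 1 t (E 1 t) (conj_entry (2*n) (t + 1) s (E (t + 1) s) x))"
        by (simp add: M.simps)
      moreover have "bounded_op_on sB sB UNIV \<dots>"
        by (rule bounded_op_on_sum[OF sBC(1) sBC(1)], rule comp[OF conj_op[OF En'] conj_op[OF En']]) (use that in auto)
      ultimately show ?thesis by simp
    next
      case 4
      then have "M n r s = (\<lambda>x.
         \<Sum>u=1..n-1. M (n - 1) (r - 2) u
           (\<Sum>t=1..n-1. conj_entry (2*n - 1) (u + 1) t (E (u + 1) t)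
             (conj_entry (2*n) (t + 1) s (E (t + 1) s) x)))"
        by (subst M.simps) simp
      moreover have "bounded_op_on sB sB UNIV \<dots>"
      proof (intro bounded_op_on_sum[OF sBC(1) sBC(1)])
        fix u assume u: "u \<in> {1..n-1}"
        have Mu: "bounded_op_on sB sB UNIV (M (n - 1) (r - 2) u)"
          using less.IH[of "n - 1"] less.prems u by auto
        have "bounded_op_on sB sB UNIV (\<lambda>x. \<Sum>t=1..n-1. conj_entry (2*n - 1) (u + 1) t (E (u + 1) t)
             (conj_entry (2*n) (t + 1) s (E (t + 1) s) x))"
          by (rule bounded_op_on_sum[OF sBC(1) sBC(1)], rule comp[OF conj_op[OF En'] conj_op[OF En']]) (use that u in auto)
        from comp[OF Mu this] show "bounded_op_on sB sB UNIV (\<lambda>x. M (n - 1) (r - 2) u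
           (\<Sum>t=1..n-1. conj_entry (2*n - 1) (u + 1) t (E (u + 1) t)
             (conj_entry (2*n) (t + 1) s (E (t + 1) s) x)))" .
      qed
      ultimately show ?thesis by simp
    qed
  qed
  show ?case using S En Mn by blast
qed

lemma Sbar_op: "1 \<le> n \<Longrightarrow> n \<le> k + 1 \<Longrightarrow> bounded_op_on sB sC UNIV (Sbar n)"
  and E_op: "1 \<le> i \<Longrightarrow> i \<le> j \<Longrightarrow> j \<le> k + 1 \<Longrightarrow> bounded_op_on sB sB UNIV (E i j)"
  using ops[of n] ops[of j] by auto

lemma e_op: "1 \<le> i \<Longrightarrow> i \<le> j \<Longrightarrow> j \<le> k + 1 \<Longrightarrow> bounded_op_on sB sB UNIV (e i j)"
  using bounded_op_on_scaleR[OF sBC(1) sBC(1) E_op] by (simp add: e_def[abs_def])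

lemma e_diag: "e j j x = x"
  using scaling_pos[of j] by (simp add: e_def E_diag)

lemma e_greater: "j < i \<Longrightarrow> e i j x = 0" by (simp add: e_def E_greater)

lemma e_in: "1 \<le> i \<Longrightarrow> i < j \<Longrightarrow> j \<le> k + 1 \<Longrightarrow> e i j x \<in> Nc i"
  unfolding e_def by (intro G.X.subspace_scaleR B.subspace_Y E_in) auto

text \<open>The quotient of the two \<open>cnum\<close> values is this quotient of factorials times
  \<open>scaling i / scaling j\<close>, and the latter is contained in \<open>e\<close>.\<close>

lemma conj_entry_e:
  assumes "1 \<le> i" "i \<le> m + 1" "1 \<le> j" "j \<le> m + 1"
  shows "conj_entry m i j (E i j) x = (fact (m - (i - 1)) / fact (m - (j - 1))) *\<^sub>R e i j x"
  using scaling_pos[of i] scaling_pos[of j]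
  by (simp add: conj_entry_def e_def cnum_scaling[OF assms(2)] cnum_scaling[OF assms(4)] field_simps)

lemma e_op': "1 \<le> i \<Longrightarrow> 1 \<le> j \<Longrightarrow> j \<le> k + 1 \<Longrightarrow> bounded_op_on sB sB UNIV (e i j)"
proof (cases "i \<le> j")
  case False
  then have "e i j = (\<lambda>x. 0)" using e_greater by (intro ext) auto
  then show ?thesis using bounded_op_on_zero[OF sBC(1) sBC(1)] by simp
qed (use e_op in auto)

lemma chain_op: "r \<le> s \<Longrightarrow> s \<le> k + 1 \<Longrightarrow> bounded_op_on sB sB UNIV (\<mu> r s)"
  by (rule bounded_op_chain_coeff[OF sBC(1) e_op])

lemma chain_op': "1 \<le> s \<Longrightarrow> s \<le> k + 1 \<Longrightarrow> bounded_op_on sB sB UNIV (\<mu> r s)"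
proof (cases "r \<le> s")
  case False
  assume "1 \<le> s"
  then have "\<mu> r s = (\<lambda>x. 0)" using chain_coeff_eq_0[of s r e] False by (intro ext) auto
  then show ?thesis using bounded_op_on_zero[OF sBC(1) sBC(1)] by simp
qed (use chain_op in auto)

text \<open>Full matrix products reduce to the recursion of \<open>chain_coeff\<close>: for t < r
  the left factor vanishes, for t \<ge> s the right one does, both by triangularity.\<close>

lemma chain_Suc:
  assumes "1 \<le> r" "s \<le> n + 1" "n \<le> k"
  shows "(\<Sum>t=1..n. \<mu> r t (e (Suc t) s x)) = \<mu> (Suc r) s x"
proof -
  have "(\<Sum>t=r..<s. \<mu> r t (e (Suc t) s x)) = (\<Sum>t=1..n. \<mu> r t (e (Suc t) s x))"
  proof (rule sum.mono_neutral_left)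
    show "\<forall>t\<in>{1..n} - {r..<s}. \<mu> r t (e (Suc t) s x) = 0"
    proof
      fix t assume t: "t \<in> {1..n} - {r..<s}"
      show "\<mu> r t (e (Suc t) s x) = 0"
      proof (cases "t < r")
        case True then show ?thesis using chain_coeff_eq_0 t by auto
      next
        case False
        then have "e (Suc t) s x = 0" using t e_greater by auto
        moreover have "\<mu> r t 0 = 0"
          by (rule bounded_op_on_zero_arg[OF sBC(1) sBC(1) chain_op']) (use t assms in auto)
        ultimately show ?thesis by simp
      qed
    qed
  qed (use assms in auto)
  then show ?thesis using assms by simp
qed

text \<open>Row 1 is a row of \<open>E\<close>, row 2 takes one further product, and a row r \<ge> 3
  is row r - 2 of the previous matrix followed by two products, that is, by two uses of
  \<open>chain_Suc\<close>. The inner factorials cancel at each product.\<close>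

lemma M_chain:
  assumes "1 \<le> r" "r \<le> m" "1 \<le> s" "s \<le> m" "m \<le> k + 1"
  shows "M m r s x = (fact (2 * m + 1 - r) / fact (2 * m + 1 - s)) *\<^sub>R \<mu> r s x"
  using assms
proof (induction m arbitrary: r s x)
  case (Suc m)
  have conj1: "conj_entry (2 * Suc m) i s (E i s) x = (fact (2 * Suc m + 1 - i) / fact (2 * Suc m + 1 - s)) *\<^sub>R e i s x"
    if "1 \<le> i" "i \<le> Suc m" for i
    using conj_entry_e[of i "2 * Suc m" s x] that Suc.prems by (simp add: Suc_diff_le)
  have conj2: "conj_entry (2 * Suc m - 1) i t (E i t) y = (fact (2 * Suc m - i) / fact (2 * Suc m - t)) *\<^sub>R e i t y"
    if "1 \<le> i" "i \<le> Suc m" "1 \<le> t" "t \<le> Suc m" for i t y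
    using conj_entry_e[of i "2 * Suc m - 1" t y] that Suc.prems by (simp add: Suc_diff_le)
  have eR: "e i t (c *\<^sub>R y) = c *\<^sub>R e i t y" if "1 \<le> i" "1 \<le> t" "t \<le> Suc m" for i t c y
    by (rule bounded_op_on_scaleR_arg[OF sBC(1) sBC(1) e_op']) (use that Suc.prems in auto)
  have inner: "(\<Sum>t=1..m. conj_entry (2 * Suc m - 1) (u + 1) t (E (u + 1) t) (conj_entry (2 * Suc m) (t + 1) s (E (t + 1) s) x)) =
     (fact (2 * m + 1 - u) / fact (2 * Suc m + 1 - s)) *\<^sub>R (\<Sum>t=1..m. e (u + 1) t (e (t + 1) s x))" if "u \<le> m" for u
    unfolding scaleR_sum_right
  proof (rule sum.cong[OF refl])
    fix t assume t: "t \<in> {1..m}"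
    have "conj_entry (2 * Suc m - 1) (u + 1) t (E (u + 1) t) (conj_entry (2 * Suc m) (t + 1) s (E (t + 1) s) x) =
      (fact (2 * Suc m - (u + 1)) / fact (2 * Suc m - t)) *\<^sub>R e (u + 1) t
         ((fact (2 * Suc m + 1 - (t + 1)) / fact (2 * Suc m + 1 - s)) *\<^sub>R e (t + 1) s x)"
      using t that by (subst conj1, simp, simp, subst conj2) auto
    also have "\<dots> = ((fact (2 * Suc m - (u + 1)) / fact (2 * Suc m - t)) * (fact (2 * Suc m + 1 - (t + 1)) / fact (2 * Suc m + 1 - s)))
        *\<^sub>R e (u + 1) t (e (t + 1) s x)"
      using t by (subst eR) auto
    also have "(fact (2 * Suc m - (u + 1)) / fact (2 * Suc m - t)) * (fact (2 * Suc m + 1 - (t + 1)) / fact (2 * Suc m + 1 - s)) =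
       (fact (2 * m + 1 - u) / fact (2 * Suc m + 1 - s) :: real)" by simp
    finally show "conj_entry (2 * Suc m - 1) (u + 1) t (E (u + 1) t) (conj_entry (2 * Suc m) (t + 1) s (E (t + 1) s) x) =
      (fact (2 * m + 1 - u) / fact (2 * Suc m + 1 - s)) *\<^sub>R e (u + 1) t (e (t + 1) s x)" .
  qed
  consider "m = 0" | "m > 0" "r = 1" | "m > 0" "r = 2" | "m > 0" "r \<ge> 3" using Suc.prems by linarith
  then show ?case
  proof cases
    case 1
    then have "r = 1" "s = 1" using Suc.prems by auto
    then show ?thesis using 1 by (simp add: M.simps e_diag)
  next
    case 2
    then have "M (Suc m) r s x = conj_entry (2 * Suc m) 1 s (E 1 s) x" by (simp add: M.simps)
    then show ?thesis using conj1[of 1] 2 by simp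
  next
    case 3
    then have "M (Suc m) r s x = (\<Sum>t=1..m. conj_entry (2 * Suc m - 1) 1 t (E 1 t) (conj_entry (2 * Suc m) (t + 1) s (E (t + 1) s) x))"
      by (simp add: M.simps)
    also have "\<dots> = (fact (2 * m + 1) / fact (2 * Suc m + 1 - s)) *\<^sub>R (\<Sum>t=1..m. \<mu> 1 t (e (Suc t) s x))"
      using inner[of 0] by simp
    also have "(\<Sum>t=1..m. \<mu> 1 t (e (Suc t) s x)) = \<mu> (Suc 1) s x" by (rule chain_Suc) (use Suc.prems in auto)
    finally show ?thesis using 3 by (simp add: numeral_2_eq_2 del: chain_coeff.simps fact_Suc)
  next
    case 4
    obtain r' where r': "r = Suc (Suc r')" "1 \<le> r'" using 4 by (metis One_nat_def Suc_le_D Suc_le_mono numeral_3_eq_3)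
    have rm: "r' \<le> m" using r' Suc.prems by simp
    have "M (Suc m) r s x = (\<Sum>u=1..m. M m r' u (\<Sum>t=1..m. conj_entry (2 * Suc m - 1) (u + 1) t (E (u + 1) t)
             (conj_entry (2 * Suc m) (t + 1) s (E (t + 1) s) x)))"
      using 4 r' by (subst M.simps) simp
    also have "\<dots> = (\<Sum>u=1..m. (fact (2 * m + 1 - r') / fact (2 * Suc m + 1 - s)) *\<^sub>R (\<Sum>t=1..m. \<mu> r' u (e (u + 1) t (e (t + 1) s x))))"
    proof (rule sum.cong[OF refl])
      fix u assume u: "u \<in> {1..m}"
      have op: "bounded_op_on sB sB UNIV (\<mu> r' u)" by (rule chain_op') (use u Suc.prems in auto)
      have "M m r' u (\<Sum>t=1..m. conj_entry (2 * Suc m - 1) (u + 1) t (E (u + 1) t)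
             (conj_entry (2 * Suc m) (t + 1) s (E (t + 1) s) x)) =
          M m r' u ((fact (2 * m + 1 - u) / fact (2 * Suc m + 1 - s)) *\<^sub>R (\<Sum>t=1..m. e (u + 1) t (e (t + 1) s x)))"
        using inner[of u] u by simp
      also have "\<dots> = (fact (2 * m + 1 - r') / fact (2 * m + 1 - u)) *\<^sub>R
           \<mu> r' u ((fact (2 * m + 1 - u) / fact (2 * Suc m + 1 - s)) *\<^sub>R (\<Sum>t=1..m. e (u + 1) t (e (t + 1) s x)))"
        by (rule Suc.IH) (use u r' rm Suc.prems in auto)
      also have "\<dots> = (fact (2 * m + 1 - r') / fact (2 * Suc m + 1 - s)) *\<^sub>R \<mu> r' u (\<Sum>t=1..m. e (u + 1) t (e (t + 1) s x))"
        by (subst bounded_op_on_scaleR_arg[OF sBC(1) sBC(1) op]) auto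
      also have "\<mu> r' u (\<Sum>t=1..m. e (u + 1) t (e (t + 1) s x)) = (\<Sum>t=1..m. \<mu> r' u (e (u + 1) t (e (t + 1) s x)))"
        by (rule bounded_op_on_sum_arg[OF sBC(1) sBC(1) op]) auto
      finally show "M m r' u (\<Sum>t=1..m. conj_entry (2 * Suc m - 1) (u + 1) t (E (u + 1) t)
             (conj_entry (2 * Suc m) (t + 1) s (E (t + 1) s) x)) =
         (fact (2 * m + 1 - r') / fact (2 * Suc m + 1 - s)) *\<^sub>R (\<Sum>t=1..m. \<mu> r' u (e (u + 1) t (e (t + 1) s x)))" .
    qed
    also have "\<dots> = (fact (2 * m + 1 - r') / fact (2 * Suc m + 1 - s)) *\<^sub>R (\<Sum>t=1..m. \<Sum>u=1..m. \<mu> r' u (e (Suc u) t (e (Suc t) s x)))"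
      unfolding scaleR_sum_right[symmetric] by (subst sum.swap) simp
    also have "(\<Sum>t=1..m. \<Sum>u=1..m. \<mu> r' u (e (Suc u) t (e (Suc t) s x))) = (\<Sum>t=1..m. \<mu> (Suc r') t (e (Suc t) s x))"
      by (intro sum.cong refl chain_Suc r') (use Suc.prems in auto)
    also have "\<dots> = \<mu> (Suc (Suc r')) s x" by (rule chain_Suc) (use Suc.prems r' in auto)
    finally show ?thesis unfolding r' by simp
  qed
qed simp

text \<open>The operators W supply the Taylor coefficients along the first m - 1 directions. These
  are all of \<open>T r\<close> for r < m, while for r = m the last summand of \<open>Sbar\<close>
  adds the missing direction \<open>w m\<close>.\<close>

lemma Sbar_chain:
  assumes "1 \<le> m" "m \<le> k"
  shows "Sbar (Suc m) x = scaling (Suc m) *\<^sub>R (\<Sum>r=1..m. T r (\<mu> r m x))"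
proof (cases "m = 1")
  case True
  have "T 1 y = hderiv G [zb 1, y] 0" for y
    unfolding T_def by (subst curve_coeff_top) (auto simp: w_def simp del: hderiv.simps)
  then show ?thesis using True by (simp add: Sbar.simps scaling_def e_diag numeral_2_eq_2 del: hderiv.simps)
next
  case False
  then have m: "2 \<le> m" using assms by simp
  \<comment> \<open>Common to all terms: with \<nu> = 2m - 1 - r, W contributes (2m)!/\<nu>! and the
    matrix entries contribute \<nu>!/m!. It equals \<open>scaling (Suc m)\<close>.\<close>
  define F where "F = (fact (2 * m) / fact m :: real)"
  let ?cc = "\<lambda>i y. curve_coeff G w (m - 1) i [y]"
  have W: "W_op G m \<nu> zb y = (fact (2 * m) / fact \<nu>) *\<^sub>R ?cc (2 * m - \<nu>) y" if "m \<le> \<nu>" "\<nu> \<le> 2 * m" for \<nu> y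
    using W_op_curve_coeff[of m \<nu> G zb y] that assms by (simp add: w_def[abs_def])
  have conj: "conj_entry (2 * m - 1) i m (E i m) x = (fact (2 * m - i) / fact m) *\<^sub>R e i m x" if "1 \<le> i" "i \<le> m" for i
    using conj_entry_e[of i "2 * m - 1" m x] that m by (simp add: Suc_diff_le)
  have ccop: "bounded_op_on sB sC UNIV (?cc i)" if "i \<le> m" for i
    using G.curve_coeff_op[of "[]" i w "m - 1"] that q assms by simp
  have first: "W_op G m (2*m - 1) zb (conj_entry (2*m - 1) 1 m (E 1 m) x) = F *\<^sub>R ?cc 1 (\<mu> 1 m x)"
  proof -
    have "W_op G m (2*m - 1) zb (conj_entry (2*m - 1) 1 m (E 1 m) x) =
       (fact (2 * m) / fact (2 * m - 1)) *\<^sub>R ?cc (2 * m - (2 * m - 1)) ((fact (2 * m - 1) / fact m) *\<^sub>R e 1 m x)"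
      using m by (subst W, simp, simp, subst conj) auto
    also have "2 * m - (2 * m - 1) = 1" using m by simp
    also have "?cc 1 ((fact (2 * m - 1) / fact m) *\<^sub>R e 1 m x) = (fact (2 * m - 1) / fact m) *\<^sub>R ?cc 1 (e 1 m x)"
      by (rule bounded_op_on_scaleR_arg[OF sBC ccop]) (use m in auto)
    finally show ?thesis by (simp add: F_def)
  qed
  have rest: "W_op G m (2*m - 1 - r) zb (\<Sum>s=1..m-1. M (m - 1) r s (conj_entry (2*m - 1) (s + 1) m (E (s + 1) m) x)) =
     F *\<^sub>R ?cc (Suc r) (\<mu> (Suc r) m x)" if r: "r \<in> {1..m-1}" for r
  proof -
    have "(\<Sum>s=1..m-1. M (m - 1) r s (conj_entry (2*m - 1) (s + 1) m (E (s + 1) m) x)) =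
      (\<Sum>s=1..m-1. (fact (2 * m - 1 - r) / fact m) *\<^sub>R \<mu> r s (e (Suc s) m x))"
    proof (rule sum.cong[OF refl])
      fix s assume s: "s \<in> {1..m-1}"
      have "M (m - 1) r s (conj_entry (2*m - 1) (s + 1) m (E (s + 1) m) x) =
        (fact (2 * (m - 1) + 1 - r) / fact (2 * (m - 1) + 1 - s)) *\<^sub>R \<mu> r s ((fact (2 * m - (s + 1)) / fact m) *\<^sub>R e (s + 1) m x)"
      proof -
        have "s + 1 \<le> m" "1 \<le> r" "r \<le> m - 1" "1 \<le> s" "s \<le> m - 1" "m - 1 \<le> k + 1" using s r m assms by auto
        then show ?thesis by (simp only: conj le_add2 M_chain)
      qed
      also have "\<mu> r s ((fact (2 * m - (s + 1)) / fact m) *\<^sub>R e (s + 1) m x) = (fact (2 * m - (s + 1)) / fact m) *\<^sub>R \<mu> r s (e (s + 1) m x)"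
        by (rule bounded_op_on_scaleR_arg[OF sBC(1) sBC(1) chain_op']) (use s m assms in auto)
      also have "2 * (m - 1) + 1 - r = 2 * m - 1 - r" using m by simp
      also have "2 * (m - 1) + 1 - s = 2 * m - (s + 1)" using m s by simp
      finally show "M (m - 1) r s (conj_entry (2*m - 1) (s + 1) m (E (s + 1) m) x) =
         (fact (2 * m - 1 - r) / fact m) *\<^sub>R \<mu> r s (e (Suc s) m x)" by simp
    qed
    also have "\<dots> = (fact (2 * m - 1 - r) / fact m) *\<^sub>R \<mu> (Suc r) m x"
    proof -
      have "(\<Sum>s=1..m-1. \<mu> r s (e (Suc s) m x)) = \<mu> (Suc r) m x" by (rule chain_Suc) (use r m assms in auto)
      then show ?thesis by (simp only: scaleR_sum_right[symmetric])
    qed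
    finally have "W_op G m (2*m - 1 - r) zb (\<Sum>s=1..m-1. M (m - 1) r s (conj_entry (2*m - 1) (s + 1) m (E (s + 1) m) x)) =
       (fact (2 * m) / fact (2 * m - 1 - r)) *\<^sub>R ?cc (2 * m - (2 * m - 1 - r)) ((fact (2 * m - 1 - r) / fact m) *\<^sub>R \<mu> (Suc r) m x)"
      using r m by (subst W) auto
    also have "2 * m - (2 * m - 1 - r) = Suc r" using r m by auto
    also have "?cc (Suc r) ((fact (2 * m - 1 - r) / fact m) *\<^sub>R \<mu> (Suc r) m x) = (fact (2 * m - 1 - r) / fact m) *\<^sub>R ?cc (Suc r) (\<mu> (Suc r) m x)"
      by (rule bounded_op_on_scaleR_arg[OF sBC ccop]) (use m r in auto)
    finally show ?thesis by (simp add: F_def)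
  qed
  \<comment> \<open>One of the two factors m! in the denominator is absorbed by \<open>w m\<close>,
    which is \<open>zb m\<close> divided by m!.\<close>
  have last: "(fact (2*m) / (fact m)\<^sup>2) *\<^sub>R hderiv G [zb m, x] 0 = F *\<^sub>R hderiv G [w m, x] 0"
  proof -
    have "hderiv G [w m, x] 0 = (1 / fact m) *\<^sub>R hderiv G [zb m, x] 0"
      unfolding w_def by (rule bounded_op_on_scaleR_arg[OF sBC G.hderiv_first_op[of "[x]" 0]]) (use q in auto)
    then show ?thesis by (simp add: F_def power2_eq_square del: hderiv.simps)
  qed
  have T: "T r y = ?cc r y" if "r \<le> m - 1" for r y
    unfolding T_def by (rule curve_coeff_stable[symmetric]) (rule that)
  have Tm: "T m x = ?cc m x + hderiv G [w m, x] 0"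
    unfolding T_def using curve_coeff_top[OF assms(1)] by blast
  have "Sbar (Suc m) x = F *\<^sub>R ?cc 1 (\<mu> 1 m x) + (\<Sum>r=1..m-1. F *\<^sub>R ?cc (Suc r) (\<mu> (Suc r) m x)) + F *\<^sub>R hderiv G [w m, x] 0"
  proof -
    have "Sbar (Suc m) x = W_op G m (2*m - 1) zb (conj_entry (2*m - 1) 1 m (E 1 m) x)
         + (\<Sum>r=1..m-1. W_op G m (2*m - 1 - r) zb
             (\<Sum>s=1..m-1. M (m - 1) r s (conj_entry (2*m - 1) (s + 1) m (E (s + 1) m) x)))
         + (fact (2*m) / (fact m)\<^sup>2) *\<^sub>R hderiv G [zb m, x] 0"
      using m by (subst Sbar.simps) (simp add: Let_def del: hderiv.simps)
    also have "(\<Sum>r=1..m-1. W_op G m (2*m - 1 - r) zb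
             (\<Sum>s=1..m-1. M (m - 1) r s (conj_entry (2*m - 1) (s + 1) m (E (s + 1) m) x))) =
         (\<Sum>r=1..m-1. F *\<^sub>R ?cc (Suc r) (\<mu> (Suc r) m x))"
      by (rule sum.cong[OF refl rest])
    finally show ?thesis unfolding first last .
  qed
  also have "(\<Sum>r=1..m-1. F *\<^sub>R ?cc (Suc r) (\<mu> (Suc r) m x)) = (\<Sum>r=2..m. F *\<^sub>R ?cc r (\<mu> r m x))"
    by (rule sum.reindex_bij_witness[of _ "\<lambda>r. r - 1" Suc]) (use m in auto)
  also have "F *\<^sub>R ?cc 1 (\<mu> 1 m x) + (\<Sum>r=2..m. F *\<^sub>R ?cc r (\<mu> r m x)) = (\<Sum>r=1..m. F *\<^sub>R ?cc r (\<mu> r m x))"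
    using m by (simp add: sum.atLeast_Suc_atMost[of "Suc 0" m] numeral_2_eq_2 del: chain_coeff.simps)
  also have "\<dots> = (\<Sum>r=1..m-1. F *\<^sub>R ?cc r (\<mu> r m x)) + F *\<^sub>R ?cc m (\<mu> m m x)"
  proof -
    obtain m' where "m = Suc m'" using m by (cases m) auto
    then show ?thesis by (simp del: chain_coeff.simps curve_coeff.simps)
  qed
  also have "\<dots> + F *\<^sub>R hderiv G [w m, x] 0 = (\<Sum>r=1..m-1. F *\<^sub>R T r (\<mu> r m x)) + F *\<^sub>R T m (\<mu> m m x)"
  proof -
    have "(\<Sum>r=1..m-1. F *\<^sub>R ?cc r (\<mu> r m x)) = (\<Sum>r=1..m-1. F *\<^sub>R T r (\<mu> r m x))"
      by (intro sum.cong refl) (simp add: T)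
    then show ?thesis by (simp add: chain_coeff_diag[OF e_diag assms(1) order_refl] Tm scaleR_add_right del: hderiv.simps)
  qed
  also have "\<dots> = F *\<^sub>R (\<Sum>r=1..m. T r (\<mu> r m x))"
  proof -
    obtain m' where "m = Suc m'" using m by (cases m) auto
    then show ?thesis by (simp add: scaleR_sum_right scaleR_add_right del: chain_coeff.simps)
  qed
  finally show ?thesis by (simp add: F_def scaling_def)
qed

lemma Sbar_1: "Sbar 1 x = T 0 x"
  by (simp add: Sbar.simps T_def)

section \<open>Elimination by the triangular matrix and the verified chain structure\<close>

lemma S_op_in: "1 \<le> i \<Longrightarrow> i \<le> k + 1 \<Longrightarrow> x \<in> N (i - 1) \<Longrightarrow> S_op i x \<in> R i"
  using res_step(2) by blast

text \<open>After v - 1 splittings \<open>Sbar v x\<close> becomes \<open>S_op v x\<close>, which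
  lies in \<open>R v\<close> and disappears at the next one.\<close>

lemma rest_proj_Sbar:
  assumes "1 \<le> v" "v \<le> k + 1" "x \<in> N (v - 1)" "v \<le> j" "j \<le> k + 1"
  shows "rest_proj R Rc j (Sbar v x) = 0"
  by (rule C.rest_proj_summand[of v]) (use assms S_op_in[of v x] in \<open>auto simp: S_op_def P_Rc_rest\<close>)

text \<open>The off-diagonal entries of \<open>E\<close> are chosen so that the sum has no component
  in \<open>R i\<close> for i < j: terms with v < i have none, the term v = i contributes the
  negative of what the terms v > i contribute. In the remaining complement only v = j
  survives.\<close>

lemma triangular:
  assumes j: "1 \<le> j" "j \<le> k + 1" and x: "x \<in> N (j - 1)"
  shows "(\<Sum>v=1..j. Sbar v (E v j x)) = S_op j x"
proof -
  define y where "y = (\<Sum>v=1..j. Sbar v (E v j x))"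
  have En: "E v j x \<in> N (v - 1)" if "1 \<le> v" "v \<le> j" for v
    using E_in[of v j x] B.Y_subset[of v "v - 1"] that j x by (cases "v = j") (auto simp: E_diag)
  have rest_sum: "rest_proj R Rc i (\<Sum>v\<in>I. f v) = (\<Sum>v\<in>I. rest_proj R Rc i (f v))" if "i \<le> k + 1" for i I and f :: "nat \<Rightarrow> 'c"
    by (rule bounded_op_on_sum_arg[OF sBC(2) sBC(2) C.bounded_op_rest_proj[OF that]]) auto
  have P_sum: "summand_proj R Rc i (\<Sum>v\<in>I. f v) = (\<Sum>v\<in>I. summand_proj R Rc i (f v))" if "1 \<le> i" "i \<le> k + 1" for i I and f :: "nat \<Rightarrow> 'c"
    by (rule bounded_op_on_sum_arg[OF sBC(2) sBC(2) C.bounded_op_summand_proj[OF that]]) auto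
  have "summand_proj R Rc i y = 0" if i: "1 \<le> i" "i < j" for i
  proof -
    have ik: "i \<le> k + 1" using i j by simp
    have low: "summand_proj R Rc i (Sbar v (E v j x)) = 0" if v: "1 \<le> v" "v < i" for v
    proof (rule C.summand_proj_zero[OF i(1) ik])
      have "rest_proj R Rc (i - 1) (Sbar v (E v j x)) = 0"
        by (rule rest_proj_Sbar[of v]) (use v i j En[of v] in auto)
      then show "rest_proj R Rc (i - 1) (Sbar v (E v j x)) \<in> Rc i"
        using C.subspace_X[of i] ik by (simp add: G.Y.subspace_0)
    qed
    have diag: "summand_proj R Rc i (Sbar i z) = S_op i z" if "z \<in> N (i - 1)" for z
      using C.summand_proj_of_rest[OF i(1) ik] S_op_in[OF i(1) ik that] by (simp add: S_op_def P_Rc_rest)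
    define t where "t = summand_proj R Rc i (\<Sum>v=i+1..j. Sbar v (E v j x))"
    have tR: "t \<in> R i" unfolding t_def by (rule C.summand_proj_in[OF i(1) ik])
    have "E i j x = - S_inv i t" using E_less[OF i(2)] by (simp add: t_def)
    moreover have "S_op i (- S_inv i t) = - t"
    proof -
      have "bounded_op_on sB sC (Nc i) (S_op i)" using res_step(3)[OF i(1) ik] unfolding GL_on_def by blast
      from bounded_op_on_uminus_arg[OF sBC this S_inv_in[OF i(1) ik tR]] show ?thesis
        using S_S_inv[OF i(1) ik tR] by simp
    qed
    ultimately have "summand_proj R Rc i (Sbar i (E i j x)) = - t" using diag[OF En[of i]] i by simp
    moreover have "y = (\<Sum>v=1..<i. Sbar v (E v j x)) + (Sbar i (E i j x) + (\<Sum>v=i+1..j. Sbar v (E v j x)))"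
    proof -
      have "{1..j} = {1..<i} \<union> {i..j}" "{1..<i} \<inter> {i..j} = {}" using i by auto
      then have "y = (\<Sum>v=1..<i. Sbar v (E v j x)) + (\<Sum>v=i..j. Sbar v (E v j x))"
        unfolding y_def using sum.union_disjoint[of "{1..<i}" "{i..j}"] by simp
      then show ?thesis using i by (simp add: sum.atLeast_Suc_atMost)
    qed
    ultimately show ?thesis
      using bounded_op_on_add[OF C.bounded_op_summand_proj[OF i(1) ik]] P_sum[OF i(1) ik] low
      by (simp add: t_def)
  qed
  moreover have "rest_proj R Rc (j - 1) y = S_op j x"
  proof -
    have "rest_proj R Rc (j - 1) y = (\<Sum>v=1..j. rest_proj R Rc (j - 1) (Sbar v (E v j x)))"
      unfolding y_def by (rule rest_sum) (use j in auto)
    also have "\<dots> = (\<Sum>v\<in>{1..j}. if v = j then S_op j x else 0)"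
    proof (rule sum.cong[OF refl])
      fix v assume v: "v \<in> {1..j}"
      show "rest_proj R Rc (j - 1) (Sbar v (E v j x)) = (if v = j then S_op j x else 0)"
      proof (cases "v = j")
        case True then show ?thesis by (simp add: S_op_def P_Rc_rest E_diag)
      next
        case False
        then show ?thesis using rest_proj_Sbar[of v "E v j x" "j - 1"] En[of v] v j by auto
      qed
    qed
    also have "\<dots> = S_op j x" using j by simp
    finally show ?thesis .
  qed
  moreover have "(\<Sum>i=1..j-1. summand_proj R Rc i y) + rest_proj R Rc (j - 1) y = y"
    by (rule C.nested_decomp) (use j in auto)
  moreover have "(\<Sum>i=1..j-1. summand_proj R Rc i y) = 0"
    by (rule sum.neutral) (use calculation(1) j in auto)
  ultimately show ?thesis by (simp add: y_def)
qed

definition \<sigma> :: "nat \<Rightarrow> 'b \<Rightarrow> 'c" where "\<sigma> i x = (1 / scaling i) *\<^sub>R S_op i x"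

text \<open>Blockwise inverse of the \<open>\<sigma> i\<close>; the factor \<open>scaling i\<close>
  undoes the division in \<open>\<sigma> i\<close>.\<close>

definition K :: "'c \<Rightarrow> 'b"
  where "K y = (\<Sum>i=1..k+1. scaling i *\<^sub>R S_inv i (summand_proj R Rc i y))"

lemma S_op_op: "1 \<le> i \<Longrightarrow> i \<le> k + 1 \<Longrightarrow> bounded_op_on sB sC UNIV (S_op i)"
  using bounded_op_on_compose_UNIV[OF C.bounded_op_rest_proj[of "i - 1"] Sbar_op[of i]]
  by (simp add: S_op_def[abs_def] P_Rc_rest)

text \<open>This is \<open>triangular\<close> divided by \<open>scaling j\<close>: by
  \<open>Sbar_chain\<close> every summand carries the factor \<open>scaling (Suc v)\<close>, which
  cancels the one in \<open>e (Suc v) j\<close>, and \<open>scaling 1\<close> is 1.\<close>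

lemma chain_relation:
  assumes j: "1 \<le> j" "j \<le> k + 1" and x: "x \<in> N (j - 1)"
  shows "T 0 (e 1 j x) + (\<Sum>v=1..<j. \<Sum>r=1..v. T r (\<mu> r v (e (Suc v) j x))) = \<sigma> j x"
proof -
  have s: "Sbar v (e v j x) = (scaling v / scaling j) *\<^sub>R Sbar v (E v j x)" if "1 \<le> v" "v \<le> j" for v
    unfolding e_def by (rule bounded_op_on_scaleR_arg[OF sBC Sbar_op]) (use that j in auto)
  have 1: "T 0 (e 1 j x) = (1 / scaling j) *\<^sub>R Sbar 1 (E 1 j x)"
    using s[of 1] j by (simp add: Sbar_1[symmetric, unfolded One_nat_def] scaling_def)
  have "(\<Sum>r=1..v. T r (\<mu> r v (e (Suc v) j x))) = (1 / scaling j) *\<^sub>R Sbar (Suc v) (E (Suc v) j x)" if "v \<in> {1..<j}" for v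
  proof -
    have "scaling (Suc v) *\<^sub>R (\<Sum>r=1..v. T r (\<mu> r v (e (Suc v) j x))) = Sbar (Suc v) (e (Suc v) j x)"
      by (rule Sbar_chain[symmetric]) (use that j in auto)
    also have "\<dots> = scaling (Suc v) *\<^sub>R ((1 / scaling j) *\<^sub>R Sbar (Suc v) (E (Suc v) j x))"
      using s[of "Suc v"] that by simp
    finally show ?thesis using scaling_pos[of "Suc v"] scaleR_cancel_left[of "scaling (Suc v)"] by (metis less_irrefl)
  qed
  then have "(\<Sum>v=1..<j. \<Sum>r=1..v. T r (\<mu> r v (e (Suc v) j x))) = (\<Sum>v=1..<j. (1 / scaling j) *\<^sub>R Sbar (Suc v) (E (Suc v) j x))"
    by (intro sum.cong refl) auto
  also have "\<dots> = (\<Sum>v=2..j. (1 / scaling j) *\<^sub>R Sbar v (E v j x))"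
    by (rule sum.reindex_bij_witness[of _ "\<lambda>r. r - 1" Suc]) auto
  finally have "T 0 (e 1 j x) + (\<Sum>v=1..<j. \<Sum>r=1..v. T r (\<mu> r v (e (Suc v) j x))) =
      (\<Sum>v=1..j. (1 / scaling j) *\<^sub>R Sbar v (E v j x))"
    using 1 j by (simp add: sum.atLeast_Suc_atMost[of "Suc 0" j] numeral_2_eq_2)
  then show ?thesis unfolding scaleR_sum_right[symmetric] triangular[OF assms] by (simp add: \<sigma>_def)
qed

lemma K_sum_in:
  assumes "\<And>i. 1 \<le> i \<Longrightarrow> i \<le> k + 1 \<Longrightarrow> f i \<in> Nc i"
  shows "rest_proj Nc N (k + 1) (\<Sum>i=1..k+1. f i) = 0"
    and "1 \<le> j \<Longrightarrow> j \<le> k + 1 \<Longrightarrow> summand_proj Nc N j (\<Sum>i=1..k+1. f i) = f j"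
proof -
  have "rest_proj Nc N (k + 1) (\<Sum>i=1..k+1. f i) = (\<Sum>i=1..k+1. rest_proj Nc N (k + 1) (f i))"
    by (rule bounded_op_on_sum_arg[OF sBC(1) sBC(1) B.bounded_op_rest_proj]) auto
  also have "\<dots> = 0"
  proof (rule sum.neutral, rule ballI)
    fix i assume i: "i \<in> {1..k+1}"
    have "rest_proj Nc N (i - 1) (f i) = f i"
      by (rule B.rest_proj_id) (use i assms[of i] B.Y_subset[of i "i - 1"] in auto)
    then show "rest_proj Nc N (k + 1) (f i) = 0"
      using B.rest_proj_summand[of i "k + 1" "f i"] i assms[of i] by auto
  qed
  finally show "rest_proj Nc N (k + 1) (\<Sum>i=1..k+1. f i) = 0" .
  assume j: "1 \<le> j" "j \<le> k + 1"
  have "summand_proj Nc N j (\<Sum>i=1..k+1. f i) = (\<Sum>i=1..k+1. summand_proj Nc N j (f i))"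
    by (rule bounded_op_on_sum_arg[OF sBC(1) sBC(1) B.bounded_op_summand_proj[OF j]]) auto
  also have "\<dots> = (\<Sum>i\<in>{1..k+1}. if i = j then f j else 0)"
    by (intro sum.cong refl) (use B.summand_proj_summand[OF j] assms in auto)
  also have "\<dots> = f j" using j by simp
  finally show "summand_proj Nc N j (\<Sum>i=1..k+1. f i) = f j" .
qed

lemma S_inv_summand_in: "1 \<le> i \<Longrightarrow> i \<le> k + 1 \<Longrightarrow> scaling i *\<^sub>R S_inv i (summand_proj R Rc i y) \<in> Nc i"
  by (intro G.X.subspace_scaleR B.subspace_Y S_inv_in C.summand_proj_in) auto

sublocale chain: operator_chain sB sC Nc N k T e \<sigma> K
proof unfold_locales
  show "bounded_op_on sB sC UNIV (T i)" if "i \<le> k" for i by (rule T_op[OF that])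
  show "bounded_op_on sB sB UNIV (e i j)" if "1 \<le> i" "i \<le> j" "j \<le> k + 1" for i j by (rule e_op[OF that])
  show "e j j x = x" for j x by (rule e_diag)
  show "e i j x \<in> Nc i" if "1 \<le> i" "i < j" "j \<le> k + 1" for i j x by (rule e_in[OF that])
  show "bounded_op_on sB sC UNIV (\<sigma> i)" if "1 \<le> i" "i \<le> k + 1" for i
    using bounded_op_on_scaleR[OF sBC S_op_op[OF that]] by (simp add: \<sigma>_def[abs_def])
  show "T 0 (e 1 j x) + (\<Sum>v=1..<j. \<Sum>r=1..v. T r (\<mu> r v (e (Suc v) j x))) = \<sigma> j x"
    if "1 \<le> j" "j \<le> k + 1" "x \<in> N (j - 1)" for j x by (rule chain_relation[OF that])
  show "\<sigma> j x = 0" if "1 \<le> j" "j \<le> k + 1" "x \<in> N j" for j x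
    using that res_step(1)[of j] by (simp add: \<sigma>_def)
  have "bounded_op_on sC sB UNIV (\<lambda>y. \<Sum>i=1..k+1. scaling i *\<^sub>R S_inv i (summand_proj R Rc i y))"
  proof (rule bounded_op_on_sum[OF sBC(2) sBC(1)], rule bounded_op_on_scaleR[OF sBC(2) sBC(1)])
    fix i assume "i \<in> {1..k+1}"
    then have i: "1 \<le> i" "i \<le> k + 1" by auto
    show "bounded_op_on sC sB UNIV (\<lambda>y. S_inv i (summand_proj R Rc i y))"
      by (rule bounded_op_on_compose[OF C.bounded_op_summand_proj[OF i] S_inv_op[OF i]]) (rule C.summand_proj_in[OF i])
  qed
  then show "bounded_op_on sC sB UNIV K" by (simp add: K_def[abs_def])
  show "rest_proj Nc N (k + 1) (K y) = 0" for y
    unfolding K_def by (rule K_sum_in(1)) (rule S_inv_summand_in)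
  show "(\<Sum>i=1..k+1. \<sigma> i (summand_proj Nc N i (K y))) = y" for y
  proof -
    have "(\<Sum>i=1..k+1. \<sigma> i (summand_proj Nc N i (K y))) = (\<Sum>i=1..k+1. summand_proj R Rc i y)"
    proof (rule sum.cong[OF refl])
      fix i assume "i \<in> {1..k+1}"
      then have i: "1 \<le> i" "i \<le> k + 1" by auto
      have "summand_proj Nc N i (K y) = scaling i *\<^sub>R S_inv i (summand_proj R Rc i y)"
        unfolding K_def by (rule K_sum_in(2)[OF S_inv_summand_in i])
      moreover have "S_op i (scaling i *\<^sub>R S_inv i (summand_proj R Rc i y)) = scaling i *\<^sub>R S_op i (S_inv i (summand_proj R Rc i y))"
        by (rule bounded_op_on_scaleR_arg[OF sBC S_op_op[OF i]]) simp
      ultimately show "\<sigma> i (summand_proj Nc N i (K y)) = summand_proj R Rc i y"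
        using S_S_inv[OF i C.summand_proj_in[OF i]] scaling_pos[of i] by (simp add: \<sigma>_def)
    qed
    \<comment> \<open>Here transversality enters: the component of \<open>y\<close> in
      \<open>Rc (k + 1)\<close> is 0, so the components in the ranges make up all of
      \<open>y\<close>.\<close>
    also have "\<dots> = y"
      using C.nested_decomp[of "k + 1" y] C.rest_proj_in[of "k + 1" y] transversal by simp
    finally show ?thesis .
  qed
  show "K (\<Sum>i=1..k+1. \<sigma> i (summand_proj Nc N i u)) = u" if u: "rest_proj Nc N (k + 1) u = 0" for u
  proof -
    define y where "y = (\<Sum>i=1..k+1. \<sigma> i (summand_proj Nc N i u))"
    have "K y = (\<Sum>i=1..k+1. summand_proj Nc N i u)"
      unfolding K_def
    proof (rule sum.cong[OF refl])
      fix i assume "i \<in> {1..k+1}"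
      then have i: "1 \<le> i" "i \<le> k + 1" by auto
      have \<sigma>R: "\<sigma> j (summand_proj Nc N j u) \<in> R j" if "j \<in> {1..k+1}" for j
        unfolding \<sigma>_def
        by (intro G.Y.subspace_scaleR C.subspace_Y S_op_in) (use that B.summand_proj_in[of j u] B.Y_subset[of j "j - 1"] in auto)
      have "summand_proj R Rc i y = (\<Sum>j=1..k+1. summand_proj R Rc i (\<sigma> j (summand_proj Nc N j u)))"
        unfolding y_def by (rule bounded_op_on_sum_arg[OF sBC(2) sBC(2) C.bounded_op_summand_proj[OF i]]) auto
      also have "\<dots> = (\<Sum>j\<in>{1..k+1}. if j = i then \<sigma> i (summand_proj Nc N i u) else 0)"
        by (intro sum.cong refl) (use C.summand_proj_summand[OF i] \<sigma>R in auto)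
      also have "\<dots> = \<sigma> i (summand_proj Nc N i u)" using i by simp
      finally have "S_inv i (summand_proj R Rc i y) = S_inv i ((1 / scaling i) *\<^sub>R S_op i (summand_proj Nc N i u))"
        by (simp add: \<sigma>_def)
      also have "\<dots> = (1 / scaling i) *\<^sub>R S_inv i (S_op i (summand_proj Nc N i u))"
        by (rule bounded_op_on_scaleR_arg[OF sBC(2) sBC(1) S_inv_op[OF i]])
          (use S_op_in[OF i] B.summand_proj_in[OF i, of u] B.Y_subset[of i "i - 1"] i in auto)
      also have "S_inv i (S_op i (summand_proj Nc N i u)) = summand_proj Nc N i u"
        by (rule S_inv_S[OF i B.summand_proj_in[OF i]])
      finally show "scaling i *\<^sub>R S_inv i (summand_proj R Rc i y) = summand_proj Nc N i u"
        using scaling_pos[of i] by simp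
    qed
    also have "\<dots> = u" using B.nested_decomp[of "k + 1" u] u by simp
    finally show ?thesis by (simp add: y_def)
  qed
qed

end

section \<open>Derivatives of the operator family\<close>

text \<open>Letting \<epsilon> tend to 0 shows that \<open>a 0\<close> vanishes; then \<epsilon> can
  be cancelled, which is why the punctured filter is used, and the degree drops.\<close>

lemma (in normed_space_over) eventually_scale_sum_zero:
  assumes "\<forall>\<^sub>F \<epsilon> in at 0. norm (\<Sum>i\<le>k. scale (\<epsilon> ^ i) (a i)) \<le> C * norm \<epsilon> ^ (k + 1)" "i \<le> k"
  shows "a i = 0"
  using assms
proof (induction k arbitrary: a i)
  case 0
  have "((\<lambda>\<epsilon>::'k. C * norm \<epsilon> ^ (0 + 1)) \<longlongrightarrow> C * norm (0::'k) ^ (0 + 1)) (at 0)"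
    by (intro tendsto_intros)
  moreover have "\<forall>\<^sub>F \<epsilon> in at (0::'k). norm (a 0) \<le> C * norm \<epsilon> ^ (0 + 1)"
    using 0(1) by simp
  ultimately have "norm (a 0) \<le> C * norm (0::'k) ^ (0 + 1)"
    by (intro tendsto_lowerbound[where F = "at (0::'k)"]) auto
  then show ?case using 0 by simp
next
  case (Suc k)
  have split: "(\<Sum>i\<le>Suc k. scale (\<epsilon> ^ i) (a i)) = a 0 + scale \<epsilon> (\<Sum>i\<le>k. scale (\<epsilon> ^ i) (a (Suc i)))" for \<epsilon>
    by (simp add: sum.atMost_Suc_shift scale_sum_right del: sum.atMost_Suc)
  have t: "((\<lambda>\<epsilon>. \<Sum>i\<le>Suc k. scale (\<epsilon> ^ i) (a i)) \<longlongrightarrow> (\<Sum>i\<le>Suc k. scale (0 ^ i) (a i))) (at 0)"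
    by (intro tendsto_sum bounded_bilinear.tendsto[OF bounded_bilinear_scale] tendsto_intros)
  have "((\<lambda>\<epsilon>::'k. C * norm \<epsilon> ^ (Suc k + 1)) \<longlongrightarrow> C * norm (0::'k) ^ (Suc k + 1)) (at 0)"
    by (intro tendsto_intros)
  then have "((\<lambda>\<epsilon>. \<Sum>i\<le>Suc k. scale (\<epsilon> ^ i) (a i)) \<longlongrightarrow> 0) (at 0)"
    by (intro Lim_null_comparison[OF Suc.prems(1)]) simp
  from tendsto_unique[OF _ t this] have a0: "a 0 = 0"
    unfolding split by simp
  have "\<forall>\<^sub>F \<epsilon> in at 0. norm (\<Sum>i\<le>k. scale (\<epsilon> ^ i) (a (Suc i))) \<le> C * norm \<epsilon> ^ (k + 1)"
    using Suc.prems(1) eventually_neq_at_within[of "0::'k" 0 UNIV]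
  proof eventually_elim
    case (elim \<epsilon>)
    then have "norm \<epsilon> * norm (\<Sum>i\<le>k. scale (\<epsilon> ^ i) (a (Suc i))) \<le> norm \<epsilon> * (C * norm \<epsilon> ^ (k + 1))"
      unfolding split a0 by (simp add: norm_scale mult_ac)
    then show ?case using elim by simp
  qed
  then have "a (Suc i) = 0" if "i \<le> k" for i using Suc.IH[of "\<lambda>i. a (Suc i)"] that by blast
  then show ?case using a0 Suc.prems(2) by (cases i) auto
qed

lemma bounded_multilinear_Cons:
  assumes "bounded_multilinear sX sY (Suc n) T"
  shows "bounded_multilinear sX sY n (\<lambda>hs. T (c # hs))"
proof -
  obtain C where C: "\<And>xs. length xs = Suc n \<Longrightarrow> norm (T xs) \<le> C * prod_norm xs"
    using assms unfolding bounded_multilinear_def by blast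
  have lin: "T (xs @ (u + v) # ys) = T (xs @ u # ys) + T (xs @ v # ys)" "T (xs @ sX a u # ys) = sY a (T (xs @ u # ys))"
    if "length xs + length ys + 1 = Suc n" for xs ys u v a
    using assms that unfolding bounded_multilinear_def by blast+
  show ?thesis unfolding bounded_multilinear_def
  proof (intro conjI allI impI exI[of _ "C * norm c"])
    show "norm (T (c # xs)) \<le> C * norm c * prod_norm xs" if "length xs = n" for xs
      using C[of "c # xs"] that by (simp add: mult_ac)
  qed (use lin[of "c # xs" ys for xs ys] in auto)
qed

lemma (in normed_space_over) bounded_multilinear_add:
  assumes "bounded_multilinear sX scale n S" "bounded_multilinear sX scale n T"
  shows "bounded_multilinear sX scale n (\<lambda>hs. S hs + T hs)"
proof -
  obtain C where C: "\<And>xs. length xs = n \<Longrightarrow> norm (S xs) \<le> C * prod_norm xs"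
    using assms(1) unfolding bounded_multilinear_def by blast
  obtain D where D: "\<And>xs. length xs = n \<Longrightarrow> norm (T xs) \<le> D * prod_norm xs"
    using assms(2) unfolding bounded_multilinear_def by blast
  have S: "S (xs @ (u + v) # ys) = S (xs @ u # ys) + S (xs @ v # ys)" "S (xs @ sX a u # ys) = scale a (S (xs @ u # ys))"
    if "length xs + length ys + 1 = n" for xs ys u v a
    using assms(1) that unfolding bounded_multilinear_def by blast+
  have T: "T (xs @ (u + v) # ys) = T (xs @ u # ys) + T (xs @ v # ys)" "T (xs @ sX a u # ys) = scale a (T (xs @ u # ys))"
    if "length xs + length ys + 1 = n" for xs ys u v a
    using assms(2) that unfolding bounded_multilinear_def by blast+
  show ?thesis unfolding bounded_multilinear_def
  proof (intro conjI allI impI exI[of _ "C + D"])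
    show "norm (S xs + T xs) \<le> (C + D) * prod_norm xs" if "length xs = n" for xs
      using norm_triangle_ineq[of "S xs" "T xs"] C[OF that] D[OF that] by (simp add: distrib_right)
  qed (auto simp: S T scale_right_distrib)
qed

lemma (in normed_space_over) bounded_multilinear_zero: "bounded_multilinear sX scale n (\<lambda>hs. 0)"
  unfolding bounded_multilinear_def by (auto intro!: exI[of _ 0])

lemma bounded_multilinear_head:
  assumes "bounded_multilinear sX sY (Suc n) T" "length hs = n"
  shows "T ((u + v) # hs) = T (u # hs) + T (v # hs)" "T (sX a u # hs) = sY a (T (u # hs))"
  using assms unfolding bounded_multilinear_def by (metis One_nat_def add.commute add_0 append_Nil list.size(3) plus_1_eq_Suc)+

lemma bounded_multilinear_bound:
  assumes "bounded_multilinear sX sY n T"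
  obtains C where "C > 0" "\<And>hs. length hs = n \<Longrightarrow> norm (T hs) \<le> C * prod_norm hs"
proof -
  obtain C where C: "\<And>hs. length hs = n \<Longrightarrow> norm (T hs) \<le> C * prod_norm hs"
    using assms unfolding bounded_multilinear_def by blast
  have "norm (T hs) \<le> (\<bar>C\<bar> + 1) * prod_norm hs" if "length hs = n" for hs
    by (rule order_trans[OF C[OF that] mult_right_mono]) auto
  then show ?thesis using that[of "\<bar>C\<bar> + 1"] by simp
qed

text \<open>The derivative with respect to the scalar is given by a vector, since all derivatives are
  linear over the scalar field.\<close>

definition unif_deriv ::
  "('k::real_normed_field \<Rightarrow> 'c \<Rightarrow> 'c) \<Rightarrow> nat \<Rightarrow> ('k \<Rightarrow> 'b::real_normed_vector list \<Rightarrow> 'c::real_normed_vector) \<Rightarrow> ('b list \<Rightarrow> 'c) \<Rightarrow> 'k \<Rightarrow> bool"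
  where "unif_deriv s j F F' \<epsilon> \<longleftrightarrow> (\<forall>e>0. \<forall>\<^sub>F h in nhds 0. \<forall>hs. length hs = j \<longrightarrow>
    norm (F (\<epsilon> + h) hs - F \<epsilon> hs - s h (F' hs)) \<le> e * norm h * prod_norm hs)"

lemma (in normed_space_over) unif_deriv_add:
  fixes F G :: "'k \<Rightarrow> 'x::real_normed_vector list \<Rightarrow> 'a"
  assumes "unif_deriv scale j F F' \<epsilon>" "unif_deriv scale j G G' \<epsilon>"
  shows "unif_deriv scale j (\<lambda>\<epsilon> hs. F \<epsilon> hs + G \<epsilon> hs) (\<lambda>hs. F' hs + G' hs) \<epsilon>"
  unfolding unif_deriv_def
proof (intro allI impI)
  fix e :: real assume "e > 0"
  then have e: "e / 2 > 0" by simp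
  have "\<forall>\<^sub>F h in nhds 0. \<forall>hs. length hs = j \<longrightarrow> norm (F (\<epsilon> + h) hs - F \<epsilon> hs - scale h (F' hs)) \<le> e / 2 * norm h * prod_norm hs"
    "\<forall>\<^sub>F h in nhds 0. \<forall>hs. length hs = j \<longrightarrow> norm (G (\<epsilon> + h) hs - G \<epsilon> hs - scale h (G' hs)) \<le> e / 2 * norm h * prod_norm hs"
    using assms e unfolding unif_deriv_def by blast+
  then show "\<forall>\<^sub>F h in nhds 0. \<forall>hs. length hs = j \<longrightarrow>
    norm (F (\<epsilon> + h) hs + G (\<epsilon> + h) hs - (F \<epsilon> hs + G \<epsilon> hs) - scale h (F' hs + G' hs)) \<le> e * norm h * prod_norm hs"
  proof eventually_elim
    case (elim h)
    show ?case
    proof (intro allI impI)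
      fix hs :: "'x list" assume hs: "length hs = j"
      have "F (\<epsilon> + h) hs + G (\<epsilon> + h) hs - (F \<epsilon> hs + G \<epsilon> hs) - scale h (F' hs + G' hs) =
        (F (\<epsilon> + h) hs - F \<epsilon> hs - scale h (F' hs)) + (G (\<epsilon> + h) hs - G \<epsilon> hs - scale h (G' hs))"
        by (simp add: scale_right_distrib)
      also have "norm \<dots> \<le> e / 2 * norm h * prod_norm hs + e / 2 * norm h * prod_norm hs"
        using elim hs by (intro order_trans[OF norm_triangle_ineq] add_mono) auto
      finally show "norm (F (\<epsilon> + h) hs + G (\<epsilon> + h) hs - (F \<epsilon> hs + G \<epsilon> hs) - scale h (F' hs + G' hs)) \<le> e * norm h * prod_norm hs"
        by simp
    qed
  qed
qed

lemma (in normed_space_over) unif_deriv_zero: "unif_deriv scale j (\<lambda>\<epsilon> hs. 0) (\<lambda>hs. 0) \<epsilon>"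
  unfolding unif_deriv_def by simp

lemma has_derivative_eventually_le:
  assumes "(c has_derivative D) (at \<epsilon>)" "e > 0"
  shows "\<forall>\<^sub>F h in nhds 0. norm (c (\<epsilon> + h) - c \<epsilon> - D h) \<le> e * norm h"
proof -
  obtain d where d: "d > 0" "\<And>y. norm (y - \<epsilon>) < d \<Longrightarrow> norm (c y - c \<epsilon> - D (y - \<epsilon>)) \<le> e * norm (y - \<epsilon>)"
    using assms unfolding has_derivative_at_alt by blast
  show ?thesis unfolding eventually_nhds_metric
    by (intro exI[of _ d]) (use d(1) d(2)[of "\<epsilon> + h" for h] in auto)
qed

text \<open>Product rule for a moving first argument. The error consists of the increment error of
  \<open>F\<close> at the new argument, the term h F' applied to the change of \<open>c\<close>, and
  \<open>F\<close> applied to the linearization error of \<open>c\<close>; each receives a third of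
  \<open>e\<close>.\<close>

lemma unif_deriv_plug:
  fixes sB :: "'k::real_or_complex \<Rightarrow> 'b::real_normed_vector \<Rightarrow> 'b" and sC :: "'k \<Rightarrow> 'c::real_normed_vector \<Rightarrow> 'c"
  assumes sB: "normed_space_over sB" and sC: "normed_space_over sC"
    and F: "unif_deriv sC (Suc j) F F' \<epsilon>"
    and mF: "bounded_multilinear sB sC (Suc j) (F \<epsilon>)" and mF': "bounded_multilinear sB sC (Suc j) F'"
    and c: "(c has_derivative (\<lambda>h. sB h c')) (at \<epsilon>)"
  shows "unif_deriv sC j (\<lambda>\<epsilon> hs. F \<epsilon> (c \<epsilon> # hs)) (\<lambda>hs. F' (c \<epsilon> # hs) + F \<epsilon> (c' # hs)) \<epsilon>"
  unfolding unif_deriv_def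
proof (intro allI impI)
  interpret B: normed_space_over sB by (fact sB)
  interpret C: normed_space_over sC by (fact sC)
  fix e :: real assume e: "e > 0"
  obtain C where C: "C > 0" "\<And>hs. length hs = Suc j \<Longrightarrow> norm (F \<epsilon> hs) \<le> C * prod_norm hs"
    using bounded_multilinear_bound[OF mF] by blast
  obtain C' where C': "C' > 0" "\<And>hs. length hs = Suc j \<Longrightarrow> norm (F' hs) \<le> C' * prod_norm hs"
    using bounded_multilinear_bound[OF mF'] by blast
  \<comment> \<open>Bounds the moving argument once its change is below 1.\<close>
  define r where "r = norm (c \<epsilon>) + 1"
  have r: "r > 0" by (simp add: r_def add_nonneg_pos)
  have ev1: "\<forall>\<^sub>F h in nhds 0. \<forall>hs. length hs = Suc j \<longrightarrow>
      norm (F (\<epsilon> + h) hs - F \<epsilon> hs - sC h (F' hs)) \<le> e / (3 * r) * norm h * prod_norm hs"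
    by (rule F[unfolded unif_deriv_def, THEN spec, THEN mp]) (use e r in simp)
  have ev2: "\<forall>\<^sub>F h in nhds 0. norm (c (\<epsilon> + h) - c \<epsilon> - sB h c') \<le> e / (3 * C) * norm h"
    by (rule has_derivative_eventually_le[OF c]) (use e C in auto)
  have "isCont c \<epsilon>" using has_derivative_continuous[OF c] .
  then have lim: "((\<lambda>h. c (\<epsilon> + h) - c \<epsilon>) \<longlongrightarrow> 0) (nhds 0)"
  proof -
    have "((\<lambda>h. \<epsilon> + h) \<longlongrightarrow> \<epsilon> + 0) (nhds 0)" by (intro tendsto_intros) (simp add: filterlim_ident)
    then have "((\<lambda>h. c (\<epsilon> + h)) \<longlongrightarrow> c \<epsilon>) (nhds 0)"
      using isCont_tendsto_compose[OF \<open>isCont c \<epsilon>\<close>, of "\<lambda>h. \<epsilon> + h" "nhds 0"] by simp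
    from tendsto_diff[OF this tendsto_const[of "c \<epsilon>"]] show ?thesis by simp
  qed
  have ev3: "\<forall>\<^sub>F h in nhds 0. norm (c (\<epsilon> + h) - c \<epsilon>) < min 1 (e / (3 * C'))"
    by (rule order_tendstoD(2)[OF tendsto_norm_zero[OF lim]]) (use e C' in auto)
  from ev1 ev2 ev3 show "\<forall>\<^sub>F h in nhds 0. \<forall>hs. length hs = j \<longrightarrow>
    norm (F (\<epsilon> + h) (c (\<epsilon> + h) # hs) - F \<epsilon> (c \<epsilon> # hs) - sC h (F' (c \<epsilon> # hs) + F \<epsilon> (c' # hs))) \<le> e * norm h * prod_norm hs"
  proof eventually_elim
    case (elim h)
    show ?case
    proof (intro allI impI)
      fix hs :: "'b list" assume hs: "length hs = j"
      define d where "d = c (\<epsilon> + h) - c \<epsilon>"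
      define P where "P = prod_norm hs"
      have P: "P \<ge> 0" by (simp add: P_def)
      have nd: "norm d < min 1 (e / (3 * C'))" using elim(3) by (simp only: d_def)
      have cd: "c (\<epsilon> + h) = c \<epsilon> + d" by (simp add: d_def)
      have dd: "d = (d - sB h c') + sB h c'" by simp
      have 1: "F \<epsilon> (c (\<epsilon> + h) # hs) = F \<epsilon> (c \<epsilon> # hs) + (F \<epsilon> ((d - sB h c') # hs) + sC h (F \<epsilon> (c' # hs)))"
        unfolding cd bounded_multilinear_head(1)[OF mF hs]
        by (subst dd) (simp only: bounded_multilinear_head[OF mF hs])
      have 2: "F' (c (\<epsilon> + h) # hs) = F' (c \<epsilon> # hs) + F' (d # hs)"
        unfolding cd by (rule bounded_multilinear_head(1)[OF mF' hs])
      have "F (\<epsilon> + h) (c (\<epsilon> + h) # hs) - F \<epsilon> (c \<epsilon> # hs) - sC h (F' (c \<epsilon> # hs) + F \<epsilon> (c' # hs)) =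
        (F (\<epsilon> + h) (c (\<epsilon> + h) # hs) - F \<epsilon> (c (\<epsilon> + h) # hs) - sC h (F' (c (\<epsilon> + h) # hs)))
        + sC h (F' (d # hs)) + F \<epsilon> ((d - sB h c') # hs)"
        unfolding 1 2 by (simp add: C.scale_right_distrib)
      also have "norm \<dots> \<le> e / 3 * norm h * P + e / 3 * norm h * P + e / 3 * norm h * P"
      proof (intro order_trans[OF norm_triangle_ineq] add_mono)
        have "norm (c (\<epsilon> + h)) \<le> r"
          using nd norm_triangle_ineq[of "c \<epsilon>" d] unfolding cd r_def by simp
        then have "e / (3 * r) * norm h * (norm (c (\<epsilon> + h)) * P) \<le> e / (3 * r) * norm h * (r * P)"
          using e r P by (intro mult_left_mono mult_right_mono) auto
        also have "\<dots> = e / 3 * norm h * P" using r by simp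
        finally have le: "e / (3 * r) * norm h * (norm (c (\<epsilon> + h)) * P) \<le> e / 3 * norm h * P" .
        have "norm (F (\<epsilon> + h) (c (\<epsilon> + h) # hs) - F \<epsilon> (c (\<epsilon> + h) # hs) - sC h (F' (c (\<epsilon> + h) # hs)))
            \<le> e / (3 * r) * norm h * (norm (c (\<epsilon> + h)) * P)"
          using elim(1)[rule_format, of "c (\<epsilon> + h) # hs"] hs by (simp add: P_def)
        then show "norm (F (\<epsilon> + h) (c (\<epsilon> + h) # hs) - F \<epsilon> (c (\<epsilon> + h) # hs) - sC h (F' (c (\<epsilon> + h) # hs))) \<le> e / 3 * norm h * P"
          using le by (rule order_trans)
        have "norm d \<le> e / (3 * C')" using nd by simp
        then have "norm h * (C' * (norm d * P)) \<le> norm h * (C' * (e / (3 * C') * P))"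
          using C' P by (intro mult_left_mono mult_right_mono) auto
        also have "\<dots> = e / 3 * norm h * P" using C' by simp
        finally have le: "norm h * (C' * (norm d * P)) \<le> e / 3 * norm h * P" .
        have "norm (sC h (F' (d # hs))) \<le> norm h * (C' * (norm d * P))"
          using mult_left_mono[OF C'(2)[of "d # hs"], of "norm h"] hs by (simp add: C.norm_scale P_def)
        then show "norm (sC h (F' (d # hs))) \<le> e / 3 * norm h * P" using le by (rule order_trans)
        have "C * (norm (d - sB h c') * P) \<le> C * (e / (3 * C) * norm h * P)"
          using elim(2) C P by (intro mult_left_mono mult_right_mono) (auto simp: d_def)
        also have "\<dots> = e / 3 * norm h * P" using C by simp
        finally have le: "C * (norm (d - sB h c') * P) \<le> e / 3 * norm h * P" .
        have "norm (F \<epsilon> ((d - sB h c') # hs)) \<le> C * (norm (d - sB h c') * P)"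
          using C(2)[of "(d - sB h c') # hs"] hs by (simp add: P_def)
        then show "norm (F \<epsilon> ((d - sB h c') # hs)) \<le> e / 3 * norm h * P" using le by (rule order_trans)
      qed
      also have "\<dots> = e * norm h * prod_norm hs" by (simp add: P_def)
      finally show "norm (F (\<epsilon> + h) (c (\<epsilon> + h) # hs) - F \<epsilon> (c \<epsilon> # hs) - sC h (F' (c \<epsilon> # hs) + F \<epsilon> (c' # hs))) \<le> e * norm h * prod_norm hs" .
    qed
  qed
qed

section \<open>Chain and product rules for the derivative of G along the curve\<close>

locale curve_family = G: smooth_map sB sC q UNIV G + Z: smooth_map "(*)" sB q "ball 0 \<delta>0" z0
  for sB :: "'k::real_or_complex \<Rightarrow> 'b::real_normed_vector \<Rightarrow> 'b"
    and sC :: "'k \<Rightarrow> 'c::real_normed_vector \<Rightarrow> 'c" and q :: nat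
    and G :: "'b \<Rightarrow> 'c" and z0 :: "'k \<Rightarrow> 'b" and \<delta>0 :: real +
  assumes \<delta>0: "0 < \<delta>0"
begin

lemma sBC: "normed_space_over sB" "normed_space_over sC"
  using G.X.normed_space_over_axioms G.Y.normed_space_over_axioms by auto

definition zd :: "nat \<Rightarrow> 'k \<Rightarrow> 'b" where "zd a \<epsilon> = hderiv z0 (replicate a 1) \<epsilon>"

lemma zd_derivative:
  assumes "a < q" "norm \<epsilon> < \<delta>0"
  shows "(zd a has_derivative (\<lambda>h. sB h (zd (Suc a) \<epsilon>))) (at \<epsilon>)"
proof -
  have e: "\<epsilon> \<in> ball 0 \<delta>0" using assms by simp
  have d: "(hderiv z0 (replicate a 1) has_derivative (\<lambda>h. hderiv z0 (h # replicate a 1) \<epsilon>)) (at \<epsilon>)"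
    by (rule Z.hderiv_has_derivative) (use assms e in auto)
  have z: "hderiv z0 (h # replicate a 1) \<epsilon> = sB h (zd (Suc a) \<epsilon>)" for h
    using Z.hderiv_scale[of "[]" "replicate a 1" \<epsilon> h 1] assms e by (simp add: zd_def del: hderiv.simps)
  have "zd a = hderiv z0 (replicate a 1)" by (rule ext) (simp only: zd_def)
  with d show ?thesis by (simp only: z)
qed

text \<open>Chain rule, uniform in \<open>hs\<close>: the increment of the curve is replaced by its
  linear part inside the next derivative of \<open>G\<close>, which is bounded at the base
  point.\<close>

lemma base_deriv:
  assumes j: "j < q" and \<epsilon>: "norm \<epsilon> < \<delta>0"
  shows "unif_deriv sC j (\<lambda>\<epsilon> hs. hderiv G hs (z0 \<epsilon>)) (\<lambda>hs. hderiv G (zd 1 \<epsilon> # hs) (z0 \<epsilon>)) \<epsilon>"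
  unfolding unif_deriv_def
proof (intro allI impI)
  fix e :: real assume e: "e > 0"
  define x where "x = z0 \<epsilon>"
  have mult: "bounded_multilinear sB sC (Suc j) (\<lambda>hs. hderiv G hs x)"
    using G.multilinear[of "Suc j" x] j by simp
  obtain C where C: "C > 0" "\<And>hs. length hs = Suc j \<Longrightarrow> norm (hderiv G hs x) \<le> C * prod_norm hs"
    using bounded_multilinear_bound[OF mult] by blast
  define z1 where "z1 = zd 1 \<epsilon>"
  define r where "r = norm z1 + 1"
  have r: "r > 0" by (simp add: r_def add_nonneg_pos)
  have z0d: "(z0 has_derivative (\<lambda>h. sB h z1)) (at \<epsilon>)"
    using zd_derivative[of 0 \<epsilon>] j \<epsilon> by (simp add: zd_def[abs_def] z1_def)
  obtain d where d: "d > 0" "\<And>y hs. y \<in> UNIV \<Longrightarrow> norm (y - x) < d \<Longrightarrow> length hs = j \<Longrightarrow>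
    norm (hderiv G hs y - hderiv G hs x - hderiv G ((y - x) # hs) x) \<le> e / (2 * r) * norm (y - x) * prod_norm hs"
    by (rule G.hderiv_increment[OF j, of x "e / (2 * r)"]) (use e r in \<open>auto simp del: hderiv.simps\<close>)
  \<comment> \<open>The bound 1 keeps the increment of the curve below r times the norm of h; the
    other bound makes the linearization error at most e/2 after applying the derivative.\<close>
  define e1 where "e1 = min 1 (e / (2 * C))"
  have e1: "e1 > 0" "e1 \<le> 1" "e1 \<le> e / (2 * C)" using e C by (auto simp: e1_def)
  have ev1: "\<forall>\<^sub>F h in nhds 0. norm (z0 (\<epsilon> + h) - z0 \<epsilon> - sB h z1) \<le> e1 * norm h"
    by (rule has_derivative_eventually_le[OF z0d e1(1)])
  have "((\<lambda>h::'k. norm h) \<longlongrightarrow> norm (0::'k)) (nhds 0)" by (intro tendsto_intros) (simp add: filterlim_ident)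
  then have ev2: "\<forall>\<^sub>F h in nhds (0::'k). norm h < d / r"
    by (rule order_tendstoD) (use d r in simp)
  from ev1 ev2 show "\<forall>\<^sub>F h in nhds 0. \<forall>hs. length hs = j \<longrightarrow>
    norm (hderiv G hs (z0 (\<epsilon> + h)) - hderiv G hs (z0 \<epsilon>) - sC h (hderiv G (zd 1 \<epsilon> # hs) (z0 \<epsilon>))) \<le> e * norm h * prod_norm hs"
  proof eventually_elim
    case (elim h)
    define y where "y = z0 (\<epsilon> + h)"
    define D where "D = y - x"
    have D1: "norm (D - sB h z1) \<le> e1 * norm h" using elim(1) by (simp add: D_def y_def x_def)
    have "norm D \<le> norm (D - sB h z1) + norm (sB h z1)" using norm_triangle_sub[of D "sB h z1"] by simp
    also have "\<dots> \<le> 1 * norm h + norm h * norm z1"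
      using D1 e1(2) mult_right_mono[OF e1(2) norm_ge_zero[of h]] by (simp add: G.X.norm_scale)
    finally have D2: "norm D \<le> r * norm h" by (simp add: r_def algebra_simps)
    then have D3: "norm (y - x) < d" using elim(2) r by (simp add: D_def[symmetric] field_simps)
    show ?case
    proof (intro allI impI)
      fix hs :: "'b list" assume hs: "length hs = j"
      define P where "P = prod_norm hs"
      have P: "P \<ge> 0" by (simp add: P_def)
      have DD: "D = (D - sB h z1) + sB h z1" by simp
      have "hderiv G (D # hs) x = hderiv G ((D - sB h z1) # hs) x + sC h (hderiv G (z1 # hs) x)"
        by (subst DD) (simp only: bounded_multilinear_head[OF mult hs])
      then have "hderiv G hs y - hderiv G hs x - sC h (hderiv G (z1 # hs) x) =
        (hderiv G hs y - hderiv G hs x - hderiv G (D # hs) x) + hderiv G ((D - sB h z1) # hs) x"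
        by (simp del: hderiv.simps)
      also have "norm \<dots> \<le> e / 2 * norm h * P + e / 2 * norm h * P"
      proof (intro order_trans[OF norm_triangle_ineq] add_mono)
        have "e / (2 * r) * norm D * P \<le> e / (2 * r) * (r * norm h) * P"
          using D2 e r P by (intro mult_left_mono mult_right_mono) auto
        also have "\<dots> = e / 2 * norm h * P" using r by simp
        finally have le: "e / (2 * r) * norm D * P \<le> e / 2 * norm h * P" .
        have "norm (hderiv G hs y - hderiv G hs x - hderiv G (D # hs) x) \<le> e / (2 * r) * norm D * P"
          using d(2)[OF UNIV_I D3 hs] by (simp only: D_def P_def)
        then show "norm (hderiv G hs y - hderiv G hs x - hderiv G (D # hs) x) \<le> e / 2 * norm h * P"
          using le by (rule order_trans)
        have "C * (norm (D - sB h z1) * P) \<le> C * (e / (2 * C) * norm h * P)"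
          using D1 mult_right_mono[OF e1(3) norm_ge_zero[of h]] C P by (intro mult_left_mono mult_right_mono) auto
        also have "\<dots> = e / 2 * norm h * P" using C by simp
        finally have le: "C * (norm (D - sB h z1) * P) \<le> e / 2 * norm h * P" .
        have "norm (hderiv G ((D - sB h z1) # hs) x) \<le> C * (norm (D - sB h z1) * P)"
          using C(2)[of "(D - sB h z1) # hs"] hs by (simp add: P_def del: hderiv.simps)
        then show "norm (hderiv G ((D - sB h z1) # hs) x) \<le> e / 2 * norm h * P"
          using le by (rule order_trans)
      qed
      also have "\<dots> = e * norm h * prod_norm hs" by (simp add: P_def)
      finally show "norm (hderiv G hs (z0 (\<epsilon> + h)) - hderiv G hs (z0 \<epsilon>) - sC h (hderiv G (zd 1 \<epsilon> # hs) (z0 \<epsilon>))) \<le> e * norm h * prod_norm hs"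
        unfolding x_def y_def z1_def .
    qed
  qed
qed

text \<open>By the chain and product rules the derivative of a \<open>term_of\<close> is the sum of the terms listed by
  \<open>diff_terms\<close>: either one of the factors \<open>zd a\<close> is differentiated, or the base point \<open>z0\<close>, which
  adds the factor \<open>zd 1\<close>.\<close>

primrec term_of :: "nat list \<Rightarrow> 'k \<Rightarrow> 'b list \<Rightarrow> 'c"
  where
    "term_of [] \<epsilon> hs = hderiv G hs (z0 \<epsilon>)"
  | "term_of (a # as) \<epsilon> hs = term_of as \<epsilon> (zd a \<epsilon> # hs)"

end

primrec diff_terms :: "nat list \<Rightarrow> nat list list"
  where
    "diff_terms [] = [[1]]"
  | "diff_terms (a # as) = map ((#) a) (diff_terms as) @ [Suc a # as]"

primrec iter_diff_terms :: "nat \<Rightarrow> nat list list"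
  where
    "iter_diff_terms 0 = [[]]"
  | "iter_diff_terms (Suc n) = concat (map diff_terms (iter_diff_terms n))"

lemma diff_terms_bounds:
  assumes "bs \<in> set (diff_terms as)"
  shows "length bs \<le> Suc (length as)" "\<forall>a\<in>set as. a \<le> n \<Longrightarrow> \<forall>b\<in>set bs. b \<le> Suc n"
  using assms by (induction as arbitrary: bs) fastforce+

text \<open>Keeps all derivatives of \<open>G\<close> and \<open>z0\<close> occurring in n-fold
  differentiation within the order of smoothness.\<close>

lemma iter_diff_terms_bounds:
  "as \<in> set (iter_diff_terms n) \<Longrightarrow> length as \<le> n \<and> (\<forall>a\<in>set as. a \<le> n)"
proof (induction n arbitrary: as)
  case (Suc n)
  then obtain bs where bs: "bs \<in> set (iter_diff_terms n)" "as \<in> set (diff_terms bs)" by auto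
  then show ?case using Suc.IH[OF bs(1)] diff_terms_bounds[OF bs(2)] by fastforce
qed simp

context curve_family
begin

lemma term_of_multilinear:
  "length as + j \<le> q \<Longrightarrow> bounded_multilinear sB sC j (term_of as \<epsilon>)"
proof (induction as arbitrary: j)
  case Nil
  then show ?case using G.multilinear[of j "z0 \<epsilon>"] by (simp add: term_of.simps[abs_def])
next
  case (Cons a as)
  have "bounded_multilinear sB sC j (\<lambda>hs. term_of as \<epsilon> (zd a \<epsilon> # hs))"
    by (rule bounded_multilinear_Cons[OF Cons.IH]) (use Cons.prems in simp)
  moreover have "term_of (a # as) \<epsilon> = (\<lambda>hs. term_of as \<epsilon> (zd a \<epsilon> # hs))" by (rule ext) simp
  ultimately show ?case by simp
qed

lemma sum_multilinear:
  "(\<And>as. as \<in> set L \<Longrightarrow> length as + j \<le> q) \<Longrightarrow> bounded_multilinear sB sC j (\<lambda>hs. \<Sum>as\<leftarrow>L. term_of as \<epsilon> hs)"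
  by (induction L) (auto intro!: G.Y.bounded_multilinear_add G.Y.bounded_multilinear_zero term_of_multilinear)

lemma term_of_deriv:
  assumes "norm \<epsilon> < \<delta>0"
  shows "length as + j < q \<Longrightarrow> \<forall>a\<in>set as. a < q \<Longrightarrow>
    unif_deriv sC j (term_of as) (\<lambda>hs. \<Sum>bs\<leftarrow>diff_terms as. term_of bs \<epsilon> hs) \<epsilon>"
proof (induction as arbitrary: j)
  case Nil
  have "term_of [] = (\<lambda>\<epsilon> hs. hderiv G hs (z0 \<epsilon>))" by (intro ext) simp
  then show ?case using base_deriv[of j \<epsilon>] Nil assms by (simp del: hderiv.simps)
next
  case (Cons a as)
  have "unif_deriv sC j (\<lambda>\<epsilon> hs. term_of as \<epsilon> (zd a \<epsilon> # hs))
    (\<lambda>hs. (\<Sum>bs\<leftarrow>diff_terms as. term_of bs \<epsilon> (zd a \<epsilon> # hs)) + term_of as \<epsilon> (zd (Suc a) \<epsilon> # hs)) \<epsilon>"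
  proof (rule unif_deriv_plug[OF sBC])
    show "unif_deriv sC (Suc j) (term_of as) (\<lambda>hs. \<Sum>bs\<leftarrow>diff_terms as. term_of bs \<epsilon> hs) \<epsilon>"
      by (rule Cons.IH) (use Cons.prems in auto)
    show "bounded_multilinear sB sC (Suc j) (term_of as \<epsilon>)"
      by (rule term_of_multilinear) (use Cons.prems in simp)
    show "bounded_multilinear sB sC (Suc j) (\<lambda>hs. \<Sum>bs\<leftarrow>diff_terms as. term_of bs \<epsilon> hs)"
      by (rule sum_multilinear) (use Cons.prems diff_terms_bounds(1)[of _ as] in fastforce)
    show "(zd a has_derivative (\<lambda>h. sB h (zd (Suc a) \<epsilon>))) (at \<epsilon>)"
      by (rule zd_derivative) (use Cons.prems assms in auto)
  qed
  moreover have "term_of (a # as) = (\<lambda>\<epsilon> hs. term_of as \<epsilon> (zd a \<epsilon> # hs))" by (intro ext) simp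
  moreover have "(\<lambda>hs. \<Sum>bs\<leftarrow>diff_terms (a # as). term_of bs \<epsilon> hs) =
     (\<lambda>hs. (\<Sum>bs\<leftarrow>diff_terms as. term_of bs \<epsilon> (zd a \<epsilon> # hs)) + term_of as \<epsilon> (zd (Suc a) \<epsilon> # hs))"
    by (rule ext) (simp add: o_def)
  ultimately show ?case by simp
qed

text \<open>The n-th derivative of \<epsilon> -> \<open>hderiv G hs (z0 \<epsilon>)\<close>: the
  formula of Faa di Bruno without collecting equal terms.\<close>

definition fam :: "nat \<Rightarrow> 'k \<Rightarrow> 'b list \<Rightarrow> 'c"
  where "fam n \<epsilon> hs = (\<Sum>as\<leftarrow>iter_diff_terms n. term_of as \<epsilon> hs)"

lemma sum_deriv:
  assumes "norm \<epsilon> < \<delta>0"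
  shows "(\<And>as. as \<in> set L \<Longrightarrow> length as + j < q \<and> (\<forall>a\<in>set as. a < q)) \<Longrightarrow>
    unif_deriv sC j (\<lambda>\<epsilon> hs. \<Sum>as\<leftarrow>L. term_of as \<epsilon> hs) (\<lambda>hs. \<Sum>bs\<leftarrow>concat (map diff_terms L). term_of bs \<epsilon> hs) \<epsilon>"
  by (induction L) (auto intro!: G.Y.unif_deriv_add G.Y.unif_deriv_zero term_of_deriv assms)

lemma fam_deriv: "norm \<epsilon> < \<delta>0 \<Longrightarrow> n + 1 < q \<Longrightarrow> unif_deriv sC 1 (fam n) (fam (Suc n) \<epsilon>) \<epsilon>"
proof -
  assume a: "norm \<epsilon> < \<delta>0" "n + 1 < q"
  have "unif_deriv sC 1 (\<lambda>\<epsilon> hs. \<Sum>as\<leftarrow>iter_diff_terms n. term_of as \<epsilon> hs)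
     (\<lambda>hs. \<Sum>bs\<leftarrow>concat (map diff_terms (iter_diff_terms n)). term_of bs \<epsilon> hs) \<epsilon>"
    by (rule sum_deriv[OF a(1)]) (use a iter_diff_terms_bounds[of _ n] in fastforce)
  then show ?thesis by (simp add: fam_def[abs_def])
qed

lemma fam_multilinear: "n + 1 \<le> q \<Longrightarrow> bounded_multilinear sB sC 1 (fam n \<epsilon>)"
  using sum_multilinear[of "iter_diff_terms n" 1 \<epsilon>] iter_diff_terms_bounds[of _ n]
  by (fastforce simp: fam_def[abs_def])

definition Lder :: "nat \<Rightarrow> 'k \<Rightarrow> 'b \<Rightarrow>\<^sub>L 'c"
  where "Lder n \<epsilon> = Blinfun (\<lambda>x. fam n \<epsilon> [x])"

lemma fam_op:
  assumes "n + 1 \<le> q"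
  shows "bounded_op_on sB sC UNIV (\<lambda>x. fam n \<epsilon> [x])"
proof -
  have m: "bounded_multilinear sB sC (Suc 0) (fam n \<epsilon>)" using fam_multilinear[OF assms] by simp
  obtain C where C: "C > 0" "\<And>hs. length hs = Suc 0 \<Longrightarrow> norm (fam n \<epsilon> hs) \<le> C * prod_norm hs"
    using bounded_multilinear_bound[OF m] by blast
  show ?thesis
    by (rule bounded_op_onI[where C = C])
      (use bounded_multilinear_head[OF m, of "[]"] C(2)[of "[x]" for x] in auto)
qed

lemma Lder_apply: "n + 1 \<le> q \<Longrightarrow> Lder n \<epsilon> x = fam n \<epsilon> [x]"
  unfolding Lder_def
  by (subst bounded_linear_Blinfun_apply[OF bounded_op_UNIV_bounded_linear[OF sBC fam_op]]) auto

lemma Lder_lin: "n + 1 \<le> q \<Longrightarrow> Lder n \<epsilon> (sB c x) = sC c (Lder n \<epsilon> x)"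
  using bounded_op_on_scale[OF fam_op] by (simp add: Lder_apply)

lemma Lder_0: "q \<ge> 1 \<Longrightarrow> Lder 0 \<epsilon> x = hderiv G [x] (z0 \<epsilon>)"
  by (simp add: Lder_apply fam_def del: hderiv.simps)

text \<open>Uniformity over argument lists of length 1 is differentiability in operator
  norm.\<close>

lemma Lder_derivative:
  assumes "n + 1 < q" "norm \<epsilon> < \<delta>0"
  shows "(Lder n has_derivative (\<lambda>h. G.Y.scale_op h o\<^sub>L Lder (Suc n) \<epsilon>)) (at \<epsilon>)"
  unfolding has_derivative_at_alt
proof (intro conjI allI impI)
  show "bounded_linear (\<lambda>h. G.Y.scale_op h o\<^sub>L Lder (Suc n) \<epsilon>)"
    by (rule bounded_linear_compose[OF bounded_bilinear.bounded_linear_left[OF bounded_bilinear_blinfun_compose] G.Y.bounded_linear_scale_op])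
  fix e :: real assume e: "e > 0"
  have "\<forall>\<^sub>F h in nhds 0. \<forall>hs. length hs = 1 \<longrightarrow>
    norm (fam n (\<epsilon> + h) hs - fam n \<epsilon> hs - sC h (fam (Suc n) \<epsilon> hs)) \<le> e * norm h * prod_norm hs"
    using fam_deriv[OF assms(2,1)] e unfolding unif_deriv_def by blast
  then obtain d where d: "d > 0" "\<And>h hs. norm h < d \<Longrightarrow> length hs = 1 \<Longrightarrow>
    norm (fam n (\<epsilon> + h) hs - fam n \<epsilon> hs - sC h (fam (Suc n) \<epsilon> hs)) \<le> e * norm h * prod_norm hs"
    unfolding eventually_nhds_metric dist_norm by auto
  show "\<exists>d>0. \<forall>y. norm (y - \<epsilon>) < d \<longrightarrow>
    norm (Lder n y - Lder n \<epsilon> - (G.Y.scale_op (y - \<epsilon>) o\<^sub>L Lder (Suc n) \<epsilon>)) \<le> e * norm (y - \<epsilon>)"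
  proof (intro exI[of _ d] conjI allI impI d(1))
    fix y assume y: "norm (y - \<epsilon>) < d"
    show "norm (Lder n y - Lder n \<epsilon> - (G.Y.scale_op (y - \<epsilon>) o\<^sub>L Lder (Suc n) \<epsilon>)) \<le> e * norm (y - \<epsilon>)"
    proof (rule norm_blinfun_bound)
      show "norm ((Lder n y - Lder n \<epsilon> - (G.Y.scale_op (y - \<epsilon>) o\<^sub>L Lder (Suc n) \<epsilon>)) x) \<le> e * norm (y - \<epsilon>) * norm x" for x
        using d(2)[OF y, of "[x]"] assms by (simp add: blinfun.diff_left Lder_apply)
    qed (use e in simp)
  qed
qed

lemma isCont_Lder: "n + 1 < q \<Longrightarrow> norm \<epsilon> < \<delta>0 \<Longrightarrow> isCont (Lder n) \<epsilon>"
  using has_derivative_continuous[OF Lder_derivative] .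

lemma deriv_family_eq: "deriv_family G z0 = Lder 0"
  by (rule ext) (simp add: deriv_family_def Lder_def fam_def)

text \<open>Connects the directional derivatives in \<open>taylor_poly\<close> with
  \<open>Lder\<close>: by linearity over the field every derivative in the direction
  \<open>h\<close> brings out a factor \<open>h\<close>.\<close>

lemma hderiv_family:
  "n + 1 \<le> q \<Longrightarrow> norm \<epsilon> < \<delta>0 \<Longrightarrow> hderiv (Lder 0) (replicate n h) \<epsilon> = G.Y.scale_op (h ^ n) o\<^sub>L Lder n \<epsilon>"
proof (induction n arbitrary: \<epsilon>)
  case 0
  then show ?case by (auto intro!: blinfun_eqI)
next
  case (Suc n)
  have bl: "bounded_linear (\<lambda>T. G.Y.scale_op (h ^ n) o\<^sub>L T)"
    by (rule bounded_bilinear.bounded_linear_right[OF bounded_bilinear_blinfun_compose])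
  have "((\<lambda>\<epsilon>. G.Y.scale_op (h ^ n) o\<^sub>L Lder n \<epsilon>) has_derivative
     (\<lambda>h'. G.Y.scale_op (h ^ n) o\<^sub>L (G.Y.scale_op h' o\<^sub>L Lder (Suc n) \<epsilon>))) (at \<epsilon>)"
    by (rule bounded_linear.has_derivative[OF bl Lder_derivative]) (use Suc.prems in auto)
  then have "(hderiv (Lder 0) (replicate n h) has_derivative
     (\<lambda>h'. G.Y.scale_op (h ^ n) o\<^sub>L (G.Y.scale_op h' o\<^sub>L Lder (Suc n) \<epsilon>))) (at \<epsilon>)"
    by (rule has_derivative_transform_within_open[OF _ open_ball[of 0 \<delta>0]]) (use Suc in auto)
  from frechet_derivative_at[OF this]
  have "frechet_derivative (hderiv (Lder 0) (replicate n h)) (at \<epsilon>) h =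
     G.Y.scale_op (h ^ n) o\<^sub>L (G.Y.scale_op h o\<^sub>L Lder (Suc n) \<epsilon>)" by metis
  also have "\<dots> = G.Y.scale_op (h ^ Suc n) o\<^sub>L Lder (Suc n) \<epsilon>"
    by (rule blinfun_eqI) (simp add: mult.commute)
  finally show ?case by simp
qed

lemma taylor_poly_family:
  assumes "k + 1 \<le> q"
  shows "taylor_poly k (deriv_family G z0) \<epsilon> x = (\<Sum>n\<le>k. sC (\<epsilon> ^ n) ((1 / fact n) *\<^sub>R Lder n 0 x))"
  unfolding taylor_poly_def deriv_family_eq blinfun.sum_left
proof (rule sum.cong[OF refl])
  fix n assume "n \<in> {..k}"
  then have "hderiv (Lder 0) (replicate n \<epsilon>) 0 = G.Y.scale_op (\<epsilon> ^ n) o\<^sub>L Lder n 0"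
    using hderiv_family[of n 0 \<epsilon>] assms \<delta>0 by simp
  then show "((1 / fact n) *\<^sub>R hderiv (Lder 0) (replicate n \<epsilon>) 0) x = sC (\<epsilon> ^ n) ((1 / fact n) *\<^sub>R Lder n 0 x)"
    by (simp add: blinfun.scaleR_left G.Y.scale_scaleR)
qed

text \<open>Continuity of the last derivative at 0 makes its oscillation small, so the error is
  o(\<epsilon>^n). This small-o form is what yields a continuous remainder at 0.\<close>

lemma family_taylor:
  assumes n: "n + 1 < q" and e: "e > 0"
  obtains d where "0 < d" "d \<le> \<delta>0"
    "\<And>\<epsilon>. norm \<epsilon> < d \<Longrightarrow> norm (Lder 0 \<epsilon> - (\<Sum>i\<le>n. (1 / fact i) *\<^sub>R (G.Y.scale_op (\<epsilon> ^ i) o\<^sub>L Lder i 0))) \<le> e * norm \<epsilon> ^ n"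
proof -
  have "isCont (Lder n) 0" by (rule isCont_Lder) (use n \<delta>0 in auto)
  then obtain d' where d': "d' > 0" "\<And>t. norm t < d' \<Longrightarrow> norm (Lder n t - Lder n 0) < e"
    using e unfolding continuous_at_eps_delta by (auto simp: dist_norm)
  define d where "d = min d' \<delta>0"
  have "norm (Lder 0 \<epsilon> - (\<Sum>i\<le>n. (1 / fact i) *\<^sub>R (G.Y.scale_op (\<epsilon> ^ i) o\<^sub>L Lder i 0))) \<le> e * norm \<epsilon> ^ n"
    if \<epsilon>: "norm \<epsilon> < d" for \<epsilon>
  proof -
    \<comment> \<open>The derivatives in t along the segment from 0 to \<epsilon>; each
      differentiation brings out one factor \<epsilon>.\<close>
    define g where "g = (\<lambda>i t. G.Y.scale_op (\<epsilon> ^ i) o\<^sub>L Lder i (t *\<^sub>R \<epsilon>))"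
    have small: "norm (t *\<^sub>R \<epsilon>) < d" if "t \<in> {0..1}" for t
    proof -
      have "\<bar>t\<bar> * norm \<epsilon> \<le> 1 * norm \<epsilon>" using that by (intro mult_right_mono) auto
      then show ?thesis using \<epsilon> by simp
    qed
    have "norm (g 0 1 - (\<Sum>i\<le>n. (1 ^ i / fact i) *\<^sub>R g i 0)) \<le> e * norm \<epsilon> ^ n"
    proof (rule taylor_segment)
      fix i and t :: real assume i: "i < n" and t: "t \<in> {0..1}"
      have bl: "bounded_linear (\<lambda>T. G.Y.scale_op (\<epsilon> ^ i) o\<^sub>L T)"
        by (rule bounded_bilinear.bounded_linear_right[OF bounded_bilinear_blinfun_compose])
      have "(Lder i has_derivative (\<lambda>h. G.Y.scale_op h o\<^sub>L Lder (Suc i) (t *\<^sub>R \<epsilon>)))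
         (at (t *\<^sub>R \<epsilon>) within ((\<lambda>t. t *\<^sub>R \<epsilon>) ` {0..1}))"
        by (rule has_derivative_at_withinI[OF Lder_derivative]) (use n i small[OF t] in \<open>auto simp: d_def\<close>)
      moreover have "((\<lambda>t. t *\<^sub>R \<epsilon>) has_vector_derivative \<epsilon>) (at t within {0..1})"
        by (auto intro!: derivative_eq_intros)
      ultimately have "(Lder i \<circ> (\<lambda>t. t *\<^sub>R \<epsilon>) has_vector_derivative (G.Y.scale_op \<epsilon> o\<^sub>L Lder (Suc i) (t *\<^sub>R \<epsilon>))) (at t within {0..1})"
        by (rule vector_derivative_diff_chain_within[rotated])
      from bounded_linear.has_vector_derivative[OF bl this]
      have "(g i has_vector_derivative G.Y.scale_op (\<epsilon> ^ i) o\<^sub>L (G.Y.scale_op \<epsilon> o\<^sub>L Lder (Suc i) (t *\<^sub>R \<epsilon>))) (at t within {0..1})"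
        by (simp add: g_def o_def)
      moreover have "G.Y.scale_op (\<epsilon> ^ i) o\<^sub>L (G.Y.scale_op \<epsilon> o\<^sub>L Lder (Suc i) (t *\<^sub>R \<epsilon>)) = g (Suc i) t"
        by (rule blinfun_eqI) (simp add: g_def mult.commute)
      ultimately show "(g i has_vector_derivative g (Suc i) t) (at t within {0..1})" by simp
    next
      fix t :: real assume t: "t \<in> {0..1}"
      have "norm (Lder n (t *\<^sub>R \<epsilon>) - Lder n 0) \<le> e"
        using d'(2)[of "t *\<^sub>R \<epsilon>"] small[OF t] by (simp add: d_def)
      then have b: "norm (Lder n (t *\<^sub>R \<epsilon>) x - Lder n 0 x) \<le> e * norm x" for x
        using norm_blinfun[of "Lder n (t *\<^sub>R \<epsilon>) - Lder n 0" x] mult_right_mono[of _ e "norm x"]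
        by (simp add: blinfun.diff_left) (meson norm_ge_zero order_trans)
      show "norm (g n t - g n 0) \<le> e * norm \<epsilon> ^ n"
      proof (rule norm_blinfun_bound)
        fix x
        have "(g n t - g n 0) x = sC (\<epsilon> ^ n) (Lder n (t *\<^sub>R \<epsilon>) x - Lder n 0 x)"
          by (simp add: g_def blinfun.diff_left G.Y.scale_right_diff_distrib)
        then have "norm ((g n t - g n 0) x) = norm \<epsilon> ^ n * norm (Lder n (t *\<^sub>R \<epsilon>) x - Lder n 0 x)"
          by (simp add: G.Y.norm_scale norm_power)
        also have "\<dots> \<le> norm \<epsilon> ^ n * (e * norm x)" by (intro mult_left_mono b) auto
        finally show "norm ((g n t - g n 0) x) \<le> e * norm \<epsilon> ^ n * norm x" by (simp add: mult_ac)
      qed (use e in simp)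
    qed simp
    moreover have "g 0 1 = Lder 0 \<epsilon>" by (rule blinfun_eqI) (simp add: g_def)
    ultimately show ?thesis by (simp add: g_def)
  qed
  then show ?thesis using that[of d] d' \<delta>0 by (auto simp: d_def)
qed

text \<open>Taylor coefficients are unique, so those computed from derivatives of \<open>z0\<close> agree with those
  computed from the given expansion of \<open>z0\<close>.\<close>

lemma family_coefficients:
  assumes k: "k + 3 \<le> q"
    and z0: "(\<lambda>\<epsilon>. norm (z0 \<epsilon> - (\<Sum>\<tau>=1..k. sB (\<epsilon> ^ \<tau>) (w \<tau>)))) \<in> O[nhds 0](\<lambda>\<epsilon>. norm \<epsilon> ^ (k + 1))"
    and i: "i \<le> k"
  shows "curve_coeff G w i i [x] = (1 / fact i) *\<^sub>R Lder i 0 x"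
proof -
  define y where "y \<epsilon> = (\<Sum>\<tau>=1..k. sB (\<epsilon> ^ \<tau>) (w \<tau>))" for \<epsilon>
  define T where "T i = curve_coeff G w i i [x]" for i
  obtain C1 where C1: "C1 > 0" "\<forall>\<^sub>F \<epsilon> in nhds 0. norm (z0 \<epsilon> - y \<epsilon>) \<le> C1 * norm \<epsilon> ^ (k + 1)"
  proof -
    from landau_o.bigE[OF z0] obtain c where "c > 0"
      "\<forall>\<^sub>F \<epsilon> in nhds 0. norm (norm (z0 \<epsilon> - (\<Sum>\<tau>=1..k. sB (\<epsilon> ^ \<tau>) (w \<tau>)))) \<le> c * norm (norm \<epsilon> ^ (k + 1))" .
    then show ?thesis using that[of c] by (simp add: y_def)
  qed
  have "unif_O 1 (k + 1) (\<lambda>\<epsilon> hs. hderiv G hs (y \<epsilon>) - (\<Sum>i\<le>k. sC (\<epsilon> ^ i) (curve_coeff G w k i hs)))"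
    unfolding y_def by (rule G.curve_expansion[OF refl]) (use k in simp)
  then obtain C2 where C2: "C2 \<ge> 0" "\<forall>\<^sub>F \<epsilon> in nhds 0. \<forall>hs. length hs = 1 \<longrightarrow>
      norm (hderiv G hs (y \<epsilon>) - (\<Sum>i\<le>k. sC (\<epsilon> ^ i) (curve_coeff G w k i hs))) \<le> C2 * norm \<epsilon> ^ (k + 1) * prod_norm hs"
    unfolding unif_O_def by blast
  have Tk: "(\<Sum>i\<le>k. sC (\<epsilon> ^ i) (curve_coeff G w k i [x])) = (\<Sum>i\<le>k. sC (\<epsilon> ^ i) (T i))" for \<epsilon>
    by (intro sum.cong refl) (simp add: T_def curve_coeff_stable[of _ k])
  obtain C3 d where C3: "C3 \<ge> 0" "d > 0" "\<And>z ks. z \<in> UNIV \<Longrightarrow> norm (z - 0) < d \<Longrightarrow> length ks = 2 \<Longrightarrow>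
      norm (hderiv G ks z) \<le> C3 * prod_norm ks"
    using G.hderiv_locally_bounded[of 2 0] k by auto
  have limy: "(y \<longlongrightarrow> 0) (nhds 0)"
    unfolding y_def by (rule G.X.tendsto_scale_polynomial)
  have limu: "((\<lambda>\<epsilon>. z0 \<epsilon> - y \<epsilon>) \<longlongrightarrow> 0) (nhds 0)"
  proof (rule Lim_null_comparison[OF C1(2)])
    have "((\<lambda>\<epsilon>::'k. C1 * norm \<epsilon> ^ (k + 1)) \<longlongrightarrow> C1 * norm (0::'k) ^ (k + 1)) (nhds 0)"
      by (intro tendsto_intros) (simp add: filterlim_ident)
    then show "((\<lambda>\<epsilon>::'k. C1 * norm \<epsilon> ^ (k + 1)) \<longlongrightarrow> 0) (nhds 0)" by simp
  qed
  have "((\<lambda>\<epsilon>. norm (y \<epsilon>) + norm (z0 \<epsilon> - y \<epsilon>)) \<longlongrightarrow> norm (0::'b) + norm (0::'b)) (nhds 0)"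
    by (intro tendsto_intros limy limu)
  then have ev: "\<forall>\<^sub>F \<epsilon> in nhds 0. norm (y \<epsilon>) + norm (z0 \<epsilon> - y \<epsilon>) < d"
    by (intro order_tendstoD(2)[OF _ C3(2)]) simp
  obtain d4 where d4: "d4 > 0" "d4 \<le> \<delta>0" "\<And>\<epsilon>. norm \<epsilon> < d4 \<Longrightarrow>
     norm (Lder 0 \<epsilon> - (\<Sum>i\<le>k+1. (1 / fact i) *\<^sub>R (G.Y.scale_op (\<epsilon> ^ i) o\<^sub>L Lder i 0))) \<le> 1 * norm \<epsilon> ^ (k + 1)"
    using family_taylor[of "k + 1" 1] k by (auto simp del: sum.atMost_Suc)
  have ev4: "\<forall>\<^sub>F \<epsilon> in nhds (0::'k). norm \<epsilon> < d4"
    unfolding eventually_nhds_metric using d4(1) by auto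
  define a where "a i = T i - (1 / fact i) *\<^sub>R Lder i 0 x" for i
  \<comment> \<open>One term per source of error: replacing the curve by its polynomial, expanding
    the derivative of \<open>G\<close> along the polynomial, the Taylor error of the family, and its
    coefficient of order k + 1.\<close>
  define M where "M = 3 * C3 * C1 * norm x + C2 * norm x + norm x + norm ((1 / fact (k + 1)) *\<^sub>R Lder (k + 1) 0 x)"
  have "\<forall>\<^sub>F \<epsilon> in nhds 0. norm (\<Sum>i\<le>k. sC (\<epsilon> ^ i) (a i)) \<le> M * norm \<epsilon> ^ (k + 1)"
    using C1(2) C2(2) ev ev4
  proof eventually_elim
    case (elim \<epsilon>)
    define E where "E = norm \<epsilon> ^ (k + 1)"
    have E: "E \<ge> 0" by (simp add: E_def)
    define u where "u = z0 \<epsilon> - y \<epsilon>"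
    have L0: "Lder 0 \<epsilon> x = hderiv G [x] (y \<epsilon> + u)" using Lder_0 k by (simp add: u_def del: hderiv.simps)
    have "norm (hderiv G [x] (y \<epsilon> + u) - (\<Sum>n\<le>0. (1 / fact n) *\<^sub>R hderiv G (replicate n u @ [x]) (y \<epsilon>))) \<le> 3 * C3 * norm u ^ (0 + 1) * prod_norm [x]"
    proof (rule G.hderiv_taylor)
      fix t :: real and ks :: "'b list" assume t: "t \<in> {0..1}" and ks: "length ks = length [x] + 0 + 1"
      have "norm (y \<epsilon> + t *\<^sub>R u) \<le> norm (y \<epsilon>) + 1 * norm u"
        using t by (intro order_trans[OF norm_triangle_ineq] add_left_mono) (auto intro!: mult_left_le_one_le)
      then show "norm (hderiv G ks (y \<epsilon> + t *\<^sub>R u)) \<le> C3 * prod_norm ks"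
        using elim(3) ks by (intro C3(3)) (auto simp: u_def)
    qed (use k in auto)
    then have b1: "norm (Lder 0 \<epsilon> x - hderiv G [x] (y \<epsilon>)) \<le> 3 * C3 * norm u * norm x"
      by (simp add: L0 del: hderiv.simps)
    also have "\<dots> \<le> 3 * C3 * (C1 * E) * norm x"
      using elim(1) C3(1) by (intro mult_left_mono mult_right_mono) (auto simp: u_def E_def)
    finally have b1: "norm (Lder 0 \<epsilon> x - hderiv G [x] (y \<epsilon>)) \<le> 3 * C3 * (C1 * E) * norm x" .
    have b2: "norm (hderiv G [x] (y \<epsilon>) - (\<Sum>i\<le>k. sC (\<epsilon> ^ i) (T i))) \<le> C2 * E * norm x"
      using elim(2)[rule_format, of "[x]"] by (simp add: Tk E_def del: hderiv.simps)
    define S where "S = (\<Sum>i\<le>k+1. (1 / fact i) *\<^sub>R (G.Y.scale_op (\<epsilon> ^ i) o\<^sub>L Lder i 0))"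
    have "norm ((Lder 0 \<epsilon> - S) x) \<le> norm (Lder 0 \<epsilon> - S) * norm x" by (rule norm_blinfun)
    also have "\<dots> \<le> E * norm x" using d4(3)[OF elim(4)] by (intro mult_right_mono) (auto simp: S_def E_def)
    finally have b3: "norm (Lder 0 \<epsilon> x - S x) \<le> E * norm x" by (simp add: blinfun.diff_left)
    have Sx: "S x = (\<Sum>i\<le>k. sC (\<epsilon> ^ i) ((1 / fact i) *\<^sub>R Lder i 0 x)) + sC (\<epsilon> ^ (k + 1)) ((1 / fact (k + 1)) *\<^sub>R Lder (k + 1) 0 x)"
      unfolding S_def by (simp add: blinfun.sum_left blinfun.add_left blinfun.scaleR_left G.Y.scale_scaleR)
    define r where "r = sC (\<epsilon> ^ (k + 1)) ((1 / fact (k + 1)) *\<^sub>R Lder (k + 1) 0 x)"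
    have b4: "norm r = E * norm ((1 / fact (k + 1)) *\<^sub>R Lder (k + 1) 0 x)"
      unfolding r_def E_def by (simp only: G.Y.norm_scale norm_power)
    have "(\<Sum>i\<le>k. sC (\<epsilon> ^ i) (a i)) = (Lder 0 \<epsilon> x - S x) - (Lder 0 \<epsilon> x - hderiv G [x] (y \<epsilon>))
        - (hderiv G [x] (y \<epsilon>) - (\<Sum>i\<le>k. sC (\<epsilon> ^ i) (T i))) + r"
      unfolding Sx r_def[symmetric] by (simp add: a_def G.Y.scale_right_diff_distrib sum_subtractf del: hderiv.simps)
    also have "norm \<dots> \<le> norm (Lder 0 \<epsilon> x - S x) + norm (Lder 0 \<epsilon> x - hderiv G [x] (y \<epsilon>))
        + norm (hderiv G [x] (y \<epsilon>) - (\<Sum>i\<le>k. sC (\<epsilon> ^ i) (T i))) + norm r"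
      by (intro order_trans[OF norm_triangle_ineq] add_mono order_trans[OF norm_triangle_ineq4] order_refl)
    also have "\<dots> \<le> E * norm x + 3 * C3 * (C1 * E) * norm x + C2 * E * norm x + norm r"
      by (intro add_mono b1 b2 b3 order_refl)
    also have "\<dots> = M * E" unfolding b4 M_def by (simp add: algebra_simps)
    finally show ?case by (simp add: E_def)
  qed
  then have "\<forall>\<^sub>F \<epsilon> in at 0. norm (\<Sum>i\<le>k. sC (\<epsilon> ^ i) (a i)) \<le> M * norm \<epsilon> ^ (k + 1)"
    unfolding eventually_at_filter by (rule eventually_mono) simp
  from G.Y.eventually_scale_sum_zero[OF this i] show ?thesis by (simp add: a_def T_def)
qed

end

section \<open>The remainder as a continuous operator family\<close>

context curve_family
begin

text \<open>The value at 0 is the next Taylor coefficient, the limit of the difference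
  quotient.\<close>

definition remainder :: "nat \<Rightarrow> 'k \<Rightarrow> 'b \<Rightarrow>\<^sub>L 'c"
  where "remainder k \<epsilon> = (if \<epsilon> = 0 then (1 / fact (k + 1)) *\<^sub>R Lder (k + 1) 0
    else G.Y.scale_op (inverse (\<epsilon> ^ (k + 1))) o\<^sub>L
      (Lder 0 \<epsilon> - (\<Sum>i\<le>k. (1 / fact i) *\<^sub>R (G.Y.scale_op (\<epsilon> ^ i) o\<^sub>L Lder i 0))))"

lemma taylor_apply:
  "(\<Sum>i\<le>k. (1 / fact i) *\<^sub>R (G.Y.scale_op (\<epsilon> ^ i) o\<^sub>L Lder i 0)) x = (\<Sum>i\<le>k. sC (\<epsilon> ^ i) ((1 / fact i) *\<^sub>R Lder i 0 x))"
  unfolding blinfun.sum_left by (intro sum.cong refl) (simp add: blinfun.scaleR_left G.Y.scale_scaleR)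

lemma remainder_lin:
  assumes "k + 2 \<le> q"
  shows "remainder k \<epsilon> (sB c x) = sC c (remainder k \<epsilon> x)"
proof (cases "\<epsilon> = 0")
  case True
  then show ?thesis using assms
    by (simp add: remainder_def blinfun.scaleR_left Lder_lin G.Y.scale_scaleR)
next
  case False
  have "(\<Sum>i\<le>k. sC (\<epsilon> ^ i) ((1 / fact i) *\<^sub>R Lder i 0 (sB c x))) = sC c (\<Sum>i\<le>k. sC (\<epsilon> ^ i) ((1 / fact i) *\<^sub>R Lder i 0 x))"
    unfolding G.Y.scale_sum_right
    by (intro sum.cong refl) (use assms in \<open>simp add: Lder_lin G.Y.scale_scaleR mult.commute\<close>)
  moreover have "remainder k \<epsilon> y = sC (inverse (\<epsilon> ^ (k + 1))) (Lder 0 \<epsilon> y - (\<Sum>i\<le>k. sC (\<epsilon> ^ i) ((1 / fact i) *\<^sub>R Lder i 0 y)))" for y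
    using False by (simp add: remainder_def blinfun.diff_left taylor_apply)
  moreover have "Lder 0 \<epsilon> (sB c x) = sC c (Lder 0 \<epsilon> x)" by (rule Lder_lin) (use assms in simp)
  ultimately show ?thesis
    by (simp only: G.Y.scale_right_diff_distrib G.Y.scale_left_commute[of _ c])
qed

lemma remainder_eq:
  "Lder 0 \<epsilon> x = (\<Sum>i\<le>k. sC (\<epsilon> ^ i) ((1 / fact i) *\<^sub>R Lder i 0 x)) + sC (\<epsilon> ^ (k + 1)) (remainder k \<epsilon> x)"
proof (cases "\<epsilon> = 0")
  case True
  have "(\<Sum>i\<le>k. sC (0 ^ i) ((1 / fact i) *\<^sub>R Lder i 0 x)) = (\<Sum>i\<le>k. if i = 0 then Lder 0 0 x else 0)"
    by (intro sum.cong refl) auto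
  then show ?thesis using True by simp
next
  case False
  then have "\<epsilon> ^ (k + 1) * inverse (\<epsilon> ^ (k + 1)) = 1" by (intro right_inverse) simp
  then show ?thesis using False by (simp add: remainder_def blinfun.diff_left taylor_apply del: power_Suc)
qed

text \<open>Away from 0 this is a composition of continuous maps. At 0 the difference to the
  assigned value is the Taylor error of order k + 1 divided by t^(k+1), which
  \<open>family_taylor\<close> makes small.\<close>

lemma continuous_on_remainder:
  assumes k: "k + 3 \<le> q"
  shows "continuous_on (ball 0 \<delta>0) (remainder k)"
proof -
  have "isCont (remainder k) \<epsilon>" if \<epsilon>: "\<epsilon> \<in> ball 0 \<delta>0" for \<epsilon>
  proof (cases "\<epsilon> = 0")
    case True
    have "\<exists>d>0. \<forall>t. norm (t - 0) < d \<longrightarrow> norm (remainder k t - remainder k 0) < e" if e: "e > 0" for e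
    proof -
      obtain d where d: "0 < d" "d \<le> \<delta>0" "\<And>t. norm t < d \<Longrightarrow>
          norm (Lder 0 t - (\<Sum>i\<le>k+1. (1 / fact i) *\<^sub>R (G.Y.scale_op (t ^ i) o\<^sub>L Lder i 0))) \<le> e / 2 * norm t ^ (k + 1)"
        using family_taylor[of "k + 1" "e / 2"] k e by (auto simp del: sum.atMost_Suc)
      have "norm (remainder k t - remainder k 0) < e" if t: "norm t < d" for t
      proof (cases "t = 0")
        case False
        define D where "D = Lder 0 t - (\<Sum>i\<le>k+1. (1 / fact i) *\<^sub>R (G.Y.scale_op (t ^ i) o\<^sub>L Lder i 0))"
        have "norm (remainder k t - remainder k 0) \<le> e / 2"
        proof (rule norm_blinfun_bound)
          fix x
          have "D x = Lder 0 t x - ((\<Sum>i\<le>k. sC (t ^ i) ((1 / fact i) *\<^sub>R Lder i 0 x)) +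
              sC (t ^ (k + 1)) ((1 / fact (k + 1)) *\<^sub>R Lder (k + 1) 0 x))"
            unfolding D_def blinfun.diff_left taylor_apply by simp
          moreover have "inverse (t ^ (k + 1)) * t ^ (k + 1) = 1" using False by (intro left_inverse) simp
          ultimately have "(remainder k t - remainder k 0) x = sC (inverse (t ^ (k + 1))) (D x)"
            using False by (simp add: remainder_def blinfun.diff_left taylor_apply blinfun.scaleR_left
                G.Y.scale_right_diff_distrib G.Y.scale_right_distrib del: power_Suc fact_Suc)
          then have "norm ((remainder k t - remainder k 0) x) = norm (D x) / norm t ^ (k + 1)"
            by (simp only: G.Y.norm_scale norm_inverse norm_power divide_inverse mult.commute)
          also have "\<dots> \<le> (e / 2 * norm t ^ (k + 1) * norm x) / norm t ^ (k + 1)"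
          proof (rule divide_right_mono)
            show "norm (D x) \<le> e / 2 * norm t ^ (k + 1) * norm x"
              using d(3)[OF t] unfolding D_def[symmetric]
              by (intro order_trans[OF norm_blinfun] mult_right_mono) auto
          qed simp
          also have "\<dots> = e / 2 * norm x" using False by simp
          finally show "norm ((remainder k t - remainder k 0) x) \<le> e / 2 * norm x" .
        qed (use e in simp)
        then show ?thesis using e by simp
      qed (use e in simp)
      then show ?thesis using d(1) by auto
    qed
    then show ?thesis unfolding True continuous_at_eps_delta dist_norm by blast
  next
    case False
    have cont: "continuous_on (ball 0 \<delta>0 - {0}) (Lder 0)"
      using isCont_Lder[of 0] k by (intro continuous_at_imp_continuous_on) auto
    have "continuous_on (ball 0 \<delta>0 - {0}) (\<lambda>\<epsilon>. G.Y.scale_op (inverse (\<epsilon> ^ (k + 1))) o\<^sub>L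
        (Lder 0 \<epsilon> - (\<Sum>i\<le>k. (1 / fact i) *\<^sub>R (G.Y.scale_op (\<epsilon> ^ i) o\<^sub>L Lder i 0))))"
      by (intro continuous_intros G.Y.continuous_on_scale_op cont) auto
    then have "continuous_on (ball 0 \<delta>0 - {0}) (remainder k)"
      by (rule continuous_on_eq) (auto simp: remainder_def)
    moreover have "open (ball (0::'k) \<delta>0 - {0})" by (intro open_Diff) auto
    ultimately show ?thesis using False \<epsilon> by (simp add: continuous_on_eq_continuous_at)
  qed
  then show ?thesis by (simp add: continuous_at_imp_continuous_on)
qed

end

section \<open>Asymptotic form of the estimates and the equivalences\<close>

lemma GL_on_asymptotics:
  fixes L :: "'k::real_or_complex \<Rightarrow> 'b::real_normed_vector \<Rightarrow> 'c::real_normed_vector"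
  assumes sB: "normed_space_over sB" and sC: "normed_space_over sC" and \<delta>: "0 < \<delta>"
    and L: "\<And>\<epsilon>. 0 < norm \<epsilon> \<Longrightarrow> norm \<epsilon> < \<delta> \<Longrightarrow> GL_on sB sC U UNIV (L \<epsilon>)"
    and bound: "\<And>\<epsilon> y. 0 < norm \<epsilon> \<Longrightarrow> norm \<epsilon> < \<delta> \<Longrightarrow> norm (the_inv_into U (L \<epsilon>) y) \<le> c / norm \<epsilon> ^ k * norm y"
  shows "\<forall>\<^sub>F \<epsilon> in at 0. GL_on sB sC U UNIV (L \<epsilon>)"
    and "(\<lambda>\<epsilon>. onorm (the_inv_into U (L \<epsilon>))) \<in> O[at 0](\<lambda>\<epsilon>. 1 / norm \<epsilon> ^ k)"
proof -
  have small: "\<forall>\<^sub>F \<epsilon> in at (0::'k). 0 < norm \<epsilon> \<and> norm \<epsilon> < \<delta>"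
    unfolding eventually_at using \<delta> by (intro exI[of _ \<delta>]) auto
  then show "\<forall>\<^sub>F \<epsilon> in at 0. GL_on sB sC U UNIV (L \<epsilon>)"
    by eventually_elim (use L in blast)
  show "(\<lambda>\<epsilon>. onorm (the_inv_into U (L \<epsilon>))) \<in> O[at 0](\<lambda>\<epsilon>. 1 / norm \<epsilon> ^ k)"
  \<comment> \<open>The sign of \<open>c\<close> is not part of the hypotheses.\<close>
  proof (rule bigoI[of _ "\<bar>c\<bar>"])
    from small show "\<forall>\<^sub>F \<epsilon> in at 0. norm (onorm (the_inv_into U (L \<epsilon>))) \<le> \<bar>c\<bar> * norm (1 / norm \<epsilon> ^ k)"
    proof eventually_elim
      case (elim \<epsilon>)
      have "bounded_op_on sC sB UNIV (the_inv_into U (L \<epsilon>))"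
        using L[of \<epsilon>] elim unfolding GL_on_def by blast
      then have "bounded_linear (the_inv_into U (L \<epsilon>))"
        by (rule bounded_op_UNIV_bounded_linear[OF sC sB])
      then have "0 \<le> onorm (the_inv_into U (L \<epsilon>))" by (rule onorm_pos_le)
      moreover have "onorm (the_inv_into U (L \<epsilon>)) \<le> \<bar>c\<bar> / norm \<epsilon> ^ k"
      proof (rule onorm_bound)
        fix y
        have "norm (the_inv_into U (L \<epsilon>) y) \<le> c / norm \<epsilon> ^ k * norm y" using bound elim by blast
        also have "\<dots> \<le> \<bar>c\<bar> / norm \<epsilon> ^ k * norm y" by (intro mult_right_mono divide_right_mono) auto
        finally show "norm (the_inv_into U (L \<epsilon>) y) \<le> \<bar>c\<bar> / norm \<epsilon> ^ k * norm y" .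
      qed simp
      ultimately show ?case by simp
    qed
  qed
qed

theorem corollary1:
  fixes sB :: "'k::real_or_complex \<Rightarrow> 'b::banach \<Rightarrow> 'b"
    and sC :: "'k \<Rightarrow> 'c::banach \<Rightarrow> 'c"
    and k q l :: nat
    and G :: "'b \<Rightarrow> 'c"
    and z0 :: "'k \<Rightarrow> 'b"
    and \<delta>0 :: real
    and zb :: "nat \<Rightarrow> 'b"
    and Nc N :: "nat \<Rightarrow> 'b set"
    and R Rc :: "nat \<Rightarrow> 'c set"
    and C :: "'b set"
  assumes "normed_space_over sB" and "normed_space_over sC"
    and "\<exists>y::'c. y \<noteq> 0"
    and "1 \<le> k" and "2 * k + 2 \<le> q"
    and "C_on sB sC q UNIV G" and "G 0 = 0"
    and "0 < \<delta>0" and "C_on (*) sB q (ball 0 \<delta>0) z0"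
    and "(\<lambda>\<epsilon>. norm (z0 \<epsilon> - (\<Sum>j=1..k. sB (\<epsilon> ^ j / fact j) (zb j)))) \<in> O[nhds 0](\<lambda>\<epsilon>. norm \<epsilon> ^ (k + 1))"
    and "1 \<le> l" and "l \<le> k" and "zb l \<noteq> 0" and "\<forall>j\<in>{1..<l}. zb j = 0"
    and "resolution_data.fine_resolution G zb Nc R Rc sB sC k N"
    and "resolution_data.is_cone G zb Nc R Rc sB k l N z0 \<delta>0 C"
    and "Rc (k + 1) = {0}"
  shows
    "(resolution_data.k_transversal G zb Nc R Rc sB sC k l N z0 \<delta>0 C
      \<longleftrightarrow>
      (\<exists>U V. U \<noteq> {0} \<and> V \<noteq> {0} \<and> closed_direct_sum sB UNIV U V \<and>
        (\<forall>\<^sub>F \<epsilon> in at 0. GL_on sB sC U UNIV (frechet_derivative G (at (z0 \<epsilon>)))) \<and>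
        (\<lambda>\<epsilon>. onorm (the_inv_into U (frechet_derivative G (at (z0 \<epsilon>))))) \<in> O[at 0](\<lambda>\<epsilon>. 1 / norm \<epsilon> ^ k) \<and>
        (\<exists>Q \<delta>1. 0 < \<delta>1 \<and> \<delta>1 \<le> \<delta>0 \<and> continuous_op_family sB sB (ball 0 \<delta>1) V Q \<and>
          (\<forall>\<epsilon>\<in>ball 0 \<delta>1. \<forall>v\<in>V. frechet_derivative G (at (z0 \<epsilon>)) (v + sB \<epsilon> (Q \<epsilon> v)) = 0))))
     \<and>
     (resolution_data.k_transversal G zb Nc R Rc sB sC k l N z0 \<delta>0 C
      \<longleftrightarrow>
      (\<exists>U V. U \<noteq> {0} \<and> V \<noteq> {0} \<and> closed_direct_sum sB UNIV U V \<and>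
        (\<forall>\<^sub>F \<epsilon> in at 0. GL_on sB sC U UNIV (taylor_poly k (deriv_family G z0) \<epsilon>)) \<and>
        (\<lambda>\<epsilon>. onorm (the_inv_into U (taylor_poly k (deriv_family G z0) \<epsilon>))) \<in> O[at 0](\<lambda>\<epsilon>. 1 / norm \<epsilon> ^ k) \<and>
        (\<exists>Q \<delta>1. 0 < \<delta>1 \<and> continuous_op_family sB sB (ball 0 \<delta>1) V Q \<and>
          (\<lambda>\<epsilon>. onorm_on V (\<lambda>v. taylor_poly k (deriv_family G z0) \<epsilon> (v + sB \<epsilon> (Q \<epsilon> v))))
            \<in> O[at 0](\<lambda>\<epsilon>. norm \<epsilon> ^ (k + 1)))))"
proof -
  have BG: "smooth_map sB sC q UNIV G" and Bz: "smooth_map (*) sB q (ball 0 \<delta>0) z0"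
    using assms normed_space_over_mult unfolding smooth_map_def smooth_map_axioms_def by blast+
  interpret F: curve_family sB sC q G z0 \<delta>0
    using BG Bz assms(8) unfolding curve_family_def curve_family_axioms_def by blast
  interpret W: transversal_resolution G zb Nc R Rc sB sC q k N
    using BG assms(4,5,15,17) unfolding transversal_resolution_def transversal_resolution_axioms_def by blast
  define U where "U = W.chain.ker (k + 1)"
  define V where "V = N (k + 1)"
  note s = assms(1,2)
  have kt: "W.k_transversal sB sC k l N z0 \<delta>0 C"
    using assms(15-17) unfolding W.k_transversal_def by blast
  have cone: "zb l \<notin> W.Nc_sum k"
    using assms(16) unfolding W.is_cone_def by blast
  have q: "k + 3 \<le> q" using assms(4,5) by simp

  \<comment> \<open>If \<open>V\<close> were trivial, the decomposition would place
    \<open>zb l\<close> in the sum of the complements, which the cone condition excludes.\<close>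
  have "V \<noteq> {0}"
  proof
    assume "V = {0}"
    then have "rest_proj Nc N (k + 1) (zb l) = 0" using W.B.rest_proj_in[of "k + 1" "zb l"] by (simp add: V_def)
    then have "zb l = (\<Sum>i=1..k+1. summand_proj Nc N i (zb l))" using W.B.nested_decomp[of "k + 1" "zb l"] by simp
    then have "zb l \<in> W.Nc_sum k" unfolding W.Nc_sum_def
      using W.B.summand_proj_in by (intro CollectI exI[of _ "\<lambda>i. summand_proj Nc N i (zb l)"]) auto
    then show False using cone by simp
  qed
  \<comment> \<open>\<open>K\<close> maps the nonzero target injectively into
    \<open>U\<close>.\<close>
  have "U \<noteq> {0}"
  proof
    assume "U = {0}"
    obtain y :: 'c where y: "y \<noteq> 0" using assms(3) by blast
    have "W.K y = 0" using W.chain.K_in[of y] \<open>U = {0}\<close> by (auto simp: U_def W.chain.ker_def)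
    have "\<And>i. i \<in> {1..k+1} \<Longrightarrow> W.\<sigma> i (summand_proj Nc N i 0) = 0"
      using bounded_op_on_zero_arg[OF s(1,1) W.B.bounded_op_summand_proj]
        bounded_op_on_zero_arg[OF s W.chain.\<sigma>_op] by simp
    then have "(\<Sum>i=1..k+1. W.\<sigma> i (summand_proj Nc N i (W.K y))) = 0"
      unfolding \<open>W.K y = 0\<close> by (intro sum.neutral ballI)
    then show False using W.chain.\<sigma>_K[of y] y by simp
  qed
  have rest_op: "bounded_op_on sB sB UNIV (rest_proj Nc N (k + 1))" by (rule W.B.bounded_op_rest_proj) simp
  have bl: "bounded_linear (rest_proj Nc N (k + 1))" by (rule bounded_op_UNIV_bounded_linear[OF s(1,1) rest_op])
  have sum: "closed_direct_sum sB UNIV U V"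
    unfolding closed_direct_sum_def direct_sum_def
  proof (intro conjI)
    show "module.subspace sB U" unfolding U_def by (rule W.chain.subspace_ker) simp
    show subV: "module.subspace sB V" unfolding V_def by (rule W.B.subspace_X) simp
    have "x = 0" if "x \<in> U" "x \<in> V" for x
      using W.B.rest_proj_id[of "k + 1" x] that by (simp add: U_def V_def W.chain.ker_def)
    moreover have "0 \<in> U" using linear_0[OF bounded_linear.linear[OF bl]] by (simp add: U_def W.chain.ker_def)
    moreover have "0 \<in> V" by (rule F.G.X.subspace_0[OF subV])
    ultimately show "U \<inter> V = {0}" by auto
    show "UNIV = {u + v |u v. u \<in> U \<and> v \<in> V}"
    proof (intro set_eqI iffI UNIV_I CollectI)
      fix x
      define v where "v = rest_proj Nc N (k + 1) x"
      have v: "v \<in> V" unfolding v_def V_def by (rule W.B.rest_proj_in) simp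
      have "rest_proj Nc N (k + 1) (x - v) = v - rest_proj Nc N (k + 1) v"
        using linear_diff[OF bounded_linear.linear[OF bl]] by (simp only: v_def)
      also have "\<dots> = 0" using W.B.rest_proj_id[of "k + 1" v] v unfolding V_def by (simp del: rest_proj.simps)
      finally have "x - v \<in> U" by (simp only: U_def W.chain.ker_def mem_Collect_eq)
      then show "\<exists>u w. x = u + w \<and> u \<in> U \<and> w \<in> V" using v by (intro exI[of _ "x - v"] exI[of _ v]) simp
    qed
    show "closed U" unfolding U_def W.chain.ker_def
      by (intro closed_Collect_eq linear_continuous_on bl continuous_on_const)
    show "closed V" unfolding V_def by (rule W.B.closed_X) auto
  qed

  have curve: "(\<Sum>\<tau>=1..k. sB (\<epsilon> ^ \<tau>) (W.w \<tau>)) = (\<Sum>j=1..k. sB (\<epsilon> ^ j / fact j) (zb j))" for \<epsilon>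
  proof (rule sum.cong[OF refl])
    fix j
    have "W.w j = sB (of_real (1 / fact j)) (zb j)" unfolding W.w_def F.G.X.scale_of_real ..
    then show "sB (\<epsilon> ^ j) (W.w j) = sB (\<epsilon> ^ j / fact j) (zb j)" by (simp add: divide_inverse)
  qed
  have T: "W.T i x = (1 / fact i) *\<^sub>R F.Lder i 0 x" if "i \<le> k" for i x
    unfolding W.T_def by (rule F.family_coefficients[OF q _ that]) (use assms(10) curve in simp)
  have L: "frechet_derivative G (at (z0 \<epsilon>)) = blinfun_apply (F.Lder 0 \<epsilon>)" for \<epsilon>
    by (rule ext) (use F.Lder_0 q in simp)

  have ex2: "\<exists>U V. U \<noteq> {0} \<and> V \<noteq> {0} \<and> closed_direct_sum sB UNIV U V \<and>
        (\<forall>\<^sub>F \<epsilon> in at 0. GL_on sB sC U UNIV (frechet_derivative G (at (z0 \<epsilon>)))) \<and>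
        (\<lambda>\<epsilon>. onorm (the_inv_into U (frechet_derivative G (at (z0 \<epsilon>))))) \<in> O[at 0](\<lambda>\<epsilon>. 1 / norm \<epsilon> ^ k) \<and>
        (\<exists>Q \<delta>1. 0 < \<delta>1 \<and> \<delta>1 \<le> \<delta>0 \<and> continuous_op_family sB sB (ball 0 \<delta>1) V Q \<and>
          (\<forall>\<epsilon>\<in>ball 0 \<delta>1. \<forall>v\<in>V. frechet_derivative G (at (z0 \<epsilon>)) (v + sB \<epsilon> (Q \<epsilon> v)) = 0))"
  proof -
    have Lr: "F.Lder 0 \<epsilon> x = (\<Sum>i\<le>k. sC (\<epsilon> ^ i) (W.T i x)) + sC (\<epsilon> ^ (k + 1)) (F.remainder k \<epsilon> x)" for \<epsilon> x
      using F.remainder_eq[of \<epsilon> x k] T by simp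
    have "\<exists>\<delta>1 c. 0 < \<delta>1 \<and> \<delta>1 \<le> \<delta>0 \<and>
      (\<forall>\<epsilon>. 0 < norm \<epsilon> \<and> norm \<epsilon> < \<delta>1 \<longrightarrow>
        GL_on sB sC U UNIV (F.Lder 0 \<epsilon>) \<and> (\<forall>y. norm (the_inv_into U (F.Lder 0 \<epsilon>) y) \<le> c / norm \<epsilon> ^ k * norm y)) \<and>
      (\<exists>Q. continuous_op_family sB sB (ball 0 \<delta>1) V Q \<and>
        (\<forall>\<epsilon>\<in>ball 0 \<delta>1. \<forall>v\<in>V. F.Lder 0 \<epsilon> (v + sB \<epsilon> (Q \<epsilon> v)) = 0))"
      unfolding U_def V_def
      by (rule W.chain.family_inversion[OF assms(8) Lr F.continuous_on_remainder[OF q] F.remainder_lin]) (use q in simp)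
    then obtain \<delta>1 c where \<delta>1: "0 < \<delta>1" "\<delta>1 \<le> \<delta>0"
      and "\<forall>\<epsilon>. 0 < norm \<epsilon> \<and> norm \<epsilon> < \<delta>1 \<longrightarrow>
        GL_on sB sC U UNIV (F.Lder 0 \<epsilon>) \<and> (\<forall>y. norm (the_inv_into U (F.Lder 0 \<epsilon>) y) \<le> c / norm \<epsilon> ^ k * norm y)"
      and "\<exists>Q. continuous_op_family sB sB (ball 0 \<delta>1) V Q \<and>
        (\<forall>\<epsilon>\<in>ball 0 \<delta>1. \<forall>v\<in>V. F.Lder 0 \<epsilon> (v + sB \<epsilon> (Q \<epsilon> v)) = 0)"
      by blast
    then obtain Q where Q: "continuous_op_family sB sB (ball 0 \<delta>1) V Q"
        "\<forall>\<epsilon>\<in>ball 0 \<delta>1. \<forall>v\<in>V. F.Lder 0 \<epsilon> (v + sB \<epsilon> (Q \<epsilon> v)) = 0"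
      and inv: "\<And>\<epsilon>. 0 < norm \<epsilon> \<Longrightarrow> norm \<epsilon> < \<delta>1 \<Longrightarrow> GL_on sB sC U UNIV (F.Lder 0 \<epsilon>)"
        "\<And>\<epsilon> y. 0 < norm \<epsilon> \<Longrightarrow> norm \<epsilon> < \<delta>1 \<Longrightarrow> norm (the_inv_into U (F.Lder 0 \<epsilon>) y) \<le> c / norm \<epsilon> ^ k * norm y"
      by blast
    show ?thesis unfolding L
      by (rule exI[of _ U], rule exI[of _ V], intro conjI \<open>U \<noteq> {0}\<close> \<open>V \<noteq> {0}\<close> sum
          GL_on_asymptotics[OF s \<delta>1(1) inv] exI[of _ Q] exI[of _ \<delta>1] \<delta>1 Q)
  qed

  have ex3: "\<exists>U V. U \<noteq> {0} \<and> V \<noteq> {0} \<and> closed_direct_sum sB UNIV U V \<and>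
        (\<forall>\<^sub>F \<epsilon> in at 0. GL_on sB sC U UNIV (taylor_poly k (deriv_family G z0) \<epsilon>)) \<and>
        (\<lambda>\<epsilon>. onorm (the_inv_into U (taylor_poly k (deriv_family G z0) \<epsilon>))) \<in> O[at 0](\<lambda>\<epsilon>. 1 / norm \<epsilon> ^ k) \<and>
        (\<exists>Q \<delta>1. 0 < \<delta>1 \<and> continuous_op_family sB sB (ball 0 \<delta>1) V Q \<and>
          (\<lambda>\<epsilon>. onorm_on V (\<lambda>v. taylor_poly k (deriv_family G z0) \<epsilon> (v + sB \<epsilon> (Q \<epsilon> v))))
            \<in> O[at 0](\<lambda>\<epsilon>. norm \<epsilon> ^ (k + 1)))"
  proof -
    let ?P = "taylor_poly k (deriv_family G z0)"
    \<comment> \<open>The Taylor polynomial is its own expansion, so the inversion applies with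
      remainder 0.\<close>
    have P: "?P \<epsilon> x = (\<Sum>i\<le>k. sC (\<epsilon> ^ i) (W.T i x)) + sC (\<epsilon> ^ (k + 1)) (blinfun_apply 0 x)" for \<epsilon> x
      using F.taylor_poly_family[of k \<epsilon> x] T q by simp
    have "\<exists>\<delta>1 c. 0 < \<delta>1 \<and> \<delta>1 \<le> \<delta>0 \<and>
      (\<forall>\<epsilon>. 0 < norm \<epsilon> \<and> norm \<epsilon> < \<delta>1 \<longrightarrow>
        GL_on sB sC U UNIV (?P \<epsilon>) \<and> (\<forall>y. norm (the_inv_into U (?P \<epsilon>) y) \<le> c / norm \<epsilon> ^ k * norm y)) \<and>
      (\<exists>Q. continuous_op_family sB sB (ball 0 \<delta>1) V Q \<and>
        (\<forall>\<epsilon>\<in>ball 0 \<delta>1. \<forall>v\<in>V. ?P \<epsilon> (v + sB \<epsilon> (Q \<epsilon> v)) = 0))"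
      unfolding U_def V_def
      by (rule W.chain.family_inversion[OF assms(8), where Rm = "\<lambda>_. 0"]) (simp_all add: P)
    then obtain \<delta>1 c where \<delta>1: "0 < \<delta>1" "\<delta>1 \<le> \<delta>0"
      and "\<forall>\<epsilon>. 0 < norm \<epsilon> \<and> norm \<epsilon> < \<delta>1 \<longrightarrow>
        GL_on sB sC U UNIV (?P \<epsilon>) \<and> (\<forall>y. norm (the_inv_into U (?P \<epsilon>) y) \<le> c / norm \<epsilon> ^ k * norm y)"
      and "\<exists>Q. continuous_op_family sB sB (ball 0 \<delta>1) V Q \<and>
        (\<forall>\<epsilon>\<in>ball 0 \<delta>1. \<forall>v\<in>V. ?P \<epsilon> (v + sB \<epsilon> (Q \<epsilon> v)) = 0)"
      by blast
    then obtain Q where Q: "continuous_op_family sB sB (ball 0 \<delta>1) V Q"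
        "\<forall>\<epsilon>\<in>ball 0 \<delta>1. \<forall>v\<in>V. ?P \<epsilon> (v + sB \<epsilon> (Q \<epsilon> v)) = 0"
      and inv: "\<And>\<epsilon>. 0 < norm \<epsilon> \<Longrightarrow> norm \<epsilon> < \<delta>1 \<Longrightarrow> GL_on sB sC U UNIV (?P \<epsilon>)"
        "\<And>\<epsilon> y. 0 < norm \<epsilon> \<Longrightarrow> norm \<epsilon> < \<delta>1 \<Longrightarrow> norm (the_inv_into U (?P \<epsilon>) y) \<le> c / norm \<epsilon> ^ k * norm y"
      by blast
    have "0 \<in> V" using F.G.X.subspace_0 sum unfolding closed_direct_sum_def direct_sum_def by blast
    have "(\<lambda>\<epsilon>. onorm_on V (\<lambda>v. ?P \<epsilon> (v + sB \<epsilon> (Q \<epsilon> v)))) \<in> O[at 0](\<lambda>\<epsilon>. norm \<epsilon> ^ (k + 1))"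
    \<comment> \<open>The constant is 0: with the family \<open>Q\<close> obtained here the
      polynomial annihilates the perturbed vectors exactly.\<close>
    proof (rule bigoI[of _ 0])
      have "\<forall>\<^sub>F \<epsilon> in at (0::'k). norm \<epsilon> < \<delta>1"
        unfolding eventually_at using \<delta>1 by (intro exI[of _ \<delta>1]) auto
      then show "\<forall>\<^sub>F \<epsilon> in at 0. norm (onorm_on V (\<lambda>v. ?P \<epsilon> (v + sB \<epsilon> (Q \<epsilon> v)))) \<le> 0 * norm (norm \<epsilon> ^ (k + 1))"
      proof eventually_elim
        case (elim \<epsilon>)
        then have "norm (?P \<epsilon> (v + sB \<epsilon> (Q \<epsilon> v))) \<le> 0 * norm v" if "v \<in> V" for v
          using Q(2) that by simp
        from onorm_on_le[OF this \<open>0 \<in> V\<close> order_refl]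
        show ?case by simp
      qed
    qed
    then show ?thesis
      by (intro exI[of _ U] exI[of _ V] exI[of _ Q] exI[of _ \<delta>1] conjI \<open>U \<noteq> {0}\<close> \<open>V \<noteq> {0}\<close> sum
          GL_on_asymptotics[OF s \<delta>1(1) inv] \<delta>1 Q(1))
  qed
  show ?thesis using kt ex2 ex3 by (intro conjI iffI) assumption+
qed

end
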